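(* Let $G$ be a connected Lie group of positive dimension with Lie algebra $\mathfrak{g}$. (1) If $\sigma: P(\mathfrak{g}) \to G$ is a linear continuous unoriented Kakeya line configuration, then $|\sigma|$ contains the identity element of $G$. (2) If $\sigma: P(\mathfrak{g}) \to G$ is a taut continuous unoriented Kakeya line configuration, then $|\sigma|$ contains an open neighborhood of the identity in $G$, and hence has positive (left) Haar measure. (3) If the dimension of $G$ is odd, the same two statements hold for continuous oriented Kakeya line configurations $\sigma: S(\mathfrak{g}) \to G$ (linear, respectively taut).
   Context: $\exp: \mathfrak{g} \to G$ is the exponential map. $P(\mathfrak{g})$ is the projective space of one-dimensional linear subspaces $L$ of the real vector space $\mathfrak{g}$, and $\exp(L)$ is the one-parameter subgroup of $G$ corresponding to $L$. $S(\mathfrak{g})$ is the unit sphere of $\mathfrak{g}$ with respect to a fixed positive definite inner product on $\mathfrak{g}$. A continuous unoriented Kakeya line configuration in $G$ is a continuous map $\sigma: P(\mathfrak{g}) \to G$, with underlying space $|\sigma| = \bigcup_{L \in P(\mathfrak{g})} \sigma(L)\exp(L)$. A continuous oriented Kakeya line configuration in $G$ is a continuous map $\sigma: S(\mathfrak{g}) \to G$, with underlying space $|\sigma| = \bigcup_{x \in S(\mathfrak{g})} \sigma(x)\exp(\mathbb{R}x)$. A configuration $\sigma$ (with domain $D = P(\mathfrak{g})$ or $D = S(\mathfrak{g})$) is called linear if there is a continuous map $\mu: D \to \mathfrak{g}$ with $\exp \circ \mu = \sigma$. It is called taut if its image lies in an open neighborhood $U$ of the identity in $G$ such that $\exp$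 restricts to a diffeomorphism from some open neighborhood of $0$ in $\mathfrak{g}$ onto $U$. *)

theory Defs
  imports "HOL-Analysis.Analysis" "HOL-Algebra.Coset"
begin

section \<open>Smooth maps between manifolds\<close>

text \<open>The following two predicates are meant for open sets \<open>S\<close>, on which all (iterated)
  directional derivatives make sense.\<close>

primrec Ck_on :: "nat \<Rightarrow> 'd::euclidean_space set \<Rightarrow> ('d \<Rightarrow> 'e::euclidean_space) \<Rightarrow> bool" where
  "Ck_on 0 S f \<longleftrightarrow> continuous_on S f"
| "Ck_on (Suc k) S f \<longleftrightarrow>
     f differentiable_on S \<and> (\<forall>v. Ck_on k S (\<lambda>x. frechet_derivative f (at x) v))"

definition smooth_on :: "'d::euclidean_space set \<Rightarrow> ('d \<Rightarrow> 'e::euclidean_space) \<Rightarrow> bool" where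
  "smooth_on S f \<longleftrightarrow> (\<forall>k. Ck_on k S f)"

text \<open>A chart is a pair of a domain and a coordinate map; the values of the coordinate map
  outside of the domain are irrelevant.\<close>

type_synonym ('a, 'e) chart = "'a set \<times> ('a \<Rightarrow> 'e)"

definition is_chart :: "'a topology \<Rightarrow> ('a, 'e::euclidean_space) chart \<Rightarrow> bool" where
  "is_chart X c \<longleftrightarrow> openin X (fst c) \<and> open (snd c ` fst c) \<and>
     homeomorphic_map (subtopology X (fst c)) (top_of_set (snd c ` fst c)) (snd c)"

definition transition :: "('a, 'd::euclidean_space) chart \<Rightarrow> ('a, 'e::euclidean_space) chart \<Rightarrow> 'd \<Rightarrow> 'e" where
  "transition c d = snd d \<circ> inv_into (fst c) (snd c)"

definition smooth_atlas :: "'a topology \<Rightarrow> ('a, 'e::euclidean_space) chart set \<Rightarrow> bool" where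
  "smooth_atlas X A \<longleftrightarrow>
     (\<forall>c\<in>A. is_chart X c) \<and> (\<Union>c\<in>A. fst c) = topspace X \<and>
     (\<forall>c\<in>A. \<forall>d\<in>A. smooth_on (snd c ` (fst c \<inter> fst d)) (transition c d))"

text \<open>Manifolds are given by an arbitrary, not necessarily maximal, smooth atlas. Their dimension
  is that of the model space, \<open>DIM('e)\<close>, which is always positive.\<close>

definition smooth_manifold :: "'a topology \<Rightarrow> ('a, 'e::euclidean_space) chart set \<Rightarrow> bool" where
  "smooth_manifold X A \<longleftrightarrow> Hausdorff_space X \<and> second_countable X \<and> smooth_atlas X A"

definition smooth_map ::
  "'a topology \<Rightarrow> ('a, 'd::euclidean_space) chart set \<Rightarrow>
   'b topology \<Rightarrow> ('b, 'e::euclidean_space) chart set \<Rightarrow> ('a \<Rightarrow> 'b) \<Rightarrow> bool" where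
  "smooth_map X A Y B f \<longleftrightarrow> continuous_map X Y f \<and>
     (\<forall>c\<in>A. \<forall>d\<in>B. smooth_on (snd c ` (fst c \<inter> f -` fst d))
        (snd d \<circ> f \<circ> inv_into (fst c) (snd c)))"

definition diffeomorphism ::
  "'a topology \<Rightarrow> ('a, 'd::euclidean_space) chart set \<Rightarrow>
   'b topology \<Rightarrow> ('b, 'e::euclidean_space) chart set \<Rightarrow> ('a \<Rightarrow> 'b) \<Rightarrow> bool" where
  "diffeomorphism X A Y B f \<longleftrightarrow> smooth_map X A Y B f \<and>
     (\<exists>g. smooth_map Y B X A g \<and>
        (\<forall>x\<in>topspace X. g (f x) = x) \<and> (\<forall>y\<in>topspace Y. f (g y) = y))"

definition restrict_atlas :: "'a set \<Rightarrow> ('a, 'e) chart set \<Rightarrow> ('a, 'e) chart set" where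
  "restrict_atlas U A = (\<lambda>c. (fst c \<inter> U, snd c)) ` A"

definition prod_atlas ::
  "('a, 'd) chart set \<Rightarrow> ('b, 'e) chart set \<Rightarrow> ('a \<times> 'b, 'd \<times> 'e) chart set" where
  "prod_atlas A B = {(fst c \<times> fst d, map_prod (snd c) (snd d)) | c d. c \<in> A \<and> d \<in> B}"

definition standard_atlas :: "('e, 'e) chart set" where
  "standard_atlas = {(UNIV, \<lambda>x. x)}"

text \<open>A tangent vector at \<open>p\<close> is the family of its coordinate vectors in all charts of the
  atlas around \<open>p\<close>, related by the derivatives of the transition maps; the value at all other
  charts is fixed to \<open>0\<close>. The vector space operations are pointwise.\<close>

definition tangent_space ::
  "('a, 'e::euclidean_space) chart set \<Rightarrow> 'a \<Rightarrow> (('a, 'e) chart \<Rightarrow> 'e) set" where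
  "tangent_space A p = {v.
     (\<forall>c\<in>A. \<forall>d\<in>A. p \<in> fst c \<longrightarrow> p \<in> fst d \<longrightarrow>
        v d = frechet_derivative (transition c d) (at (snd c p)) (v c)) \<and>
     (\<forall>c. \<not> (c \<in> A \<and> p \<in> fst c) \<longrightarrow> v c = 0)}"

definition velocity ::
  "('a, 'e::euclidean_space) chart set \<Rightarrow> (real \<Rightarrow> 'a) \<Rightarrow> ('a, 'e) chart \<Rightarrow> 'e" where
  "velocity A \<gamma> = (\<lambda>c. if c \<in> A \<and> \<gamma> 0 \<in> fst c
     then vector_derivative (snd c \<circ> \<gamma>) (at 0) else 0)"

section \<open>Lie groups and the exponential map\<close>

locale lie_group = group G for G :: "('a, 'm) monoid_scheme" (structure) +
  fixes T :: "'a topology" and A :: "('a, 'e::euclidean_space) chart set"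
  assumes topspace_eq: "topspace T = carrier G"
    and manifold: "smooth_manifold T A"
    and smooth_mult:
      "smooth_map (prod_topology T T) (prod_atlas A A) T A (\<lambda>(x, y). x \<otimes> y)"
    and smooth_inv: "smooth_map T A T A (\<lambda>x. inv x)"

text \<open>The Lie algebra is the tangent space at the identity (its bracket is not needed).
  Evaluation at any chart around the identity is a linear isomorphism onto the model space.\<close>

definition lie_algebra ::
  "('a, 'm) monoid_scheme \<Rightarrow> ('a, 'e::euclidean_space) chart set \<Rightarrow> (('a, 'e) chart \<Rightarrow> 'e) set" where
  "lie_algebra G A = tangent_space A \<one>\<^bsub>G\<^esub>"

text \<open>The topology is induced from the product topology on families of vectors, under which the
  evaluations are homeomorphisms, i.e. it is the usual topology of a finite-dimensional space.\<close>

definition lie_algebra_topology ::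
  "('a, 'm) monoid_scheme \<Rightarrow> ('a, 'e::euclidean_space) chart set \<Rightarrow> (('a, 'e) chart \<Rightarrow> 'e) topology" where
  "lie_algebra_topology G A = top_of_set (lie_algebra G A)"

definition lie_algebra_atlas ::
  "('a, 'm) monoid_scheme \<Rightarrow> ('a, 'e::euclidean_space) chart set \<Rightarrow>
   (('a, 'e) chart \<Rightarrow> 'e, 'e) chart set" where
  "lie_algebra_atlas G A = {(lie_algebra G A, \<lambda>v. v c) | c. c \<in> A \<and> \<one>\<^bsub>G\<^esub> \<in> fst c}"

definition one_parameter_subgroup ::
  "('a, 'm) monoid_scheme \<Rightarrow> 'a topology \<Rightarrow> ('a, 'e::euclidean_space) chart set \<Rightarrow>
   (real \<Rightarrow> 'a) \<Rightarrow> bool" where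
  "one_parameter_subgroup G T A \<gamma> \<longleftrightarrow>
     smooth_map euclidean standard_atlas T A \<gamma> \<and> (\<forall>s t. \<gamma> (s + t) = \<gamma> s \<otimes>\<^bsub>G\<^esub> \<gamma> t)"

text \<open>\<open>exp v = \<gamma> 1\<close> for the unique one-parameter subgroup \<open>\<gamma>\<close> with initial velocity \<open>v\<close>.\<close>

definition lie_exp ::
  "('a, 'm) monoid_scheme \<Rightarrow> 'a topology \<Rightarrow> ('a, 'e::euclidean_space) chart set \<Rightarrow>
   (('a, 'e) chart \<Rightarrow> 'e) \<Rightarrow> 'a" where
  "lie_exp G T A v = (THE \<gamma>. one_parameter_subgroup G T A \<gamma> \<and> velocity A \<gamma> = v) 1"

definition left_haar_measure ::
  "('a, 'm) monoid_scheme \<Rightarrow> 'a topology \<Rightarrow> 'a measure \<Rightarrow> bool" where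
  "left_haar_measure G T M \<longleftrightarrow>
     space M = topspace T \<and> sets M = sigma_sets (topspace T) {U. openin T U} \<and>
     (\<forall>g\<in>carrier G. \<forall>B\<in>sets M. emeasure M (g <#\<^bsub>G\<^esub> B) = emeasure M B) \<and>
     (\<forall>K. compactin T K \<longrightarrow> emeasure M K < \<infinity>) \<and>
     (\<forall>B\<in>sets M. emeasure M B = (INF U\<in>{U. openin T U \<and> B \<subseteq> U}. emeasure M U)) \<and>
     (\<forall>U. openin T U \<longrightarrow> emeasure M U = (SUP K\<in>{K. compactin T K \<and> K \<subseteq> U}. emeasure M K)) \<and>
     emeasure M (space M) \<noteq> 0"

section \<open>The projective space and the unit sphere of the Lie algebra\<close>

definition line_through :: "('i \<Rightarrow> 'e::real_vector) \<Rightarrow> ('i \<Rightarrow> 'e) set" where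
  "line_through v = range (\<lambda>t::real. \<lambda>i. t *\<^sub>R v i)"

definition proj_space :: "('i \<Rightarrow> 'e::real_vector) set \<Rightarrow> ('i \<Rightarrow> 'e) set set" where
  "proj_space V = line_through ` (V - {\<lambda>i. 0})"

text \<open>The quotient topology with respect to \<open>line_through\<close> from \<open>V - {0}\<close>.\<close>

definition proj_topology :: "('i \<Rightarrow> 'e::euclidean_space) set \<Rightarrow> ('i \<Rightarrow> 'e) set topology" where
  "proj_topology V = topology (\<lambda>W. W \<subseteq> proj_space V \<and>
     openin (top_of_set (V - {\<lambda>i. 0})) {v \<in> V - {\<lambda>i. 0}. line_through v \<in> W})"

lemma openin_proj_topology:
  "openin (proj_topology V) W \<longleftrightarrow> W \<subseteq> proj_space V \<and>
     openin (top_of_set (V - {\<lambda>i. 0})) {v \<in> V - {\<lambda>i. 0}. line_through v \<in> W}"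
proof -
  let ?X = "top_of_set (V - {\<lambda>i. 0})"
  let ?pre = "\<lambda>W. {v \<in> V - {\<lambda>i. 0}. line_through v \<in> W}"
  have "istopology (\<lambda>W. W \<subseteq> proj_space V \<and> openin ?X (?pre W))"
    unfolding istopology_def
  proof (intro conjI allI impI)
    fix S S' assume *: "S \<subseteq> proj_space V \<and> openin ?X (?pre S)"
      "S' \<subseteq> proj_space V \<and> openin ?X (?pre S')"
    show "S \<inter> S' \<subseteq> proj_space V" using * by blast
    have eq: "?pre (S \<inter> S') = ?pre S \<inter> ?pre S'" by blast
    show "openin ?X (?pre (S \<inter> S'))"
      unfolding eq by (rule openin_Int) (use * in simp_all)
  next
    fix \<K> assume *: "\<forall>K\<in>\<K>. K \<subseteq> proj_space V \<and> openin ?X (?pre K)"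
    show "\<Union>\<K> \<subseteq> proj_space V" using * by blast
    have eq: "?pre (\<Union>\<K>) = \<Union>(?pre ` \<K>)" by blast
    show "openin ?X (?pre (\<Union>\<K>))"
      unfolding eq
    proof (rule openin_Union)
      fix S assume "S \<in> ?pre ` \<K>"
      then obtain K where "K \<in> \<K>" "S = ?pre K" by (rule imageE) simp
      then show "openin ?X S" using * by simp
    qed
  qed
  then show ?thesis
    by (simp add: proj_topology_def topology_inverse')
qed

definition inner_product_on :: "('i \<Rightarrow> 'e::real_vector) set \<Rightarrow> (('i \<Rightarrow> 'e) \<Rightarrow> ('i \<Rightarrow> 'e) \<Rightarrow> real) \<Rightarrow> bool" where
  "inner_product_on V ip \<longleftrightarrow>
     (\<forall>v\<in>V. \<forall>w\<in>V. ip v w = ip w v) \<and>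
     (\<forall>u\<in>V. \<forall>v\<in>V. \<forall>w\<in>V. ip (\<lambda>i. u i + v i) w = ip u w + ip v w) \<and>
     (\<forall>r. \<forall>v\<in>V. \<forall>w\<in>V. ip (\<lambda>i. r *\<^sub>R v i) w = r * ip v w) \<and>
     (\<forall>v\<in>V. v \<noteq> (\<lambda>i. 0) \<longrightarrow> 0 < ip v v)"

definition unit_sphere :: "('i \<Rightarrow> 'e) set \<Rightarrow> (('i \<Rightarrow> 'e) \<Rightarrow> ('i \<Rightarrow> 'e) \<Rightarrow> real) \<Rightarrow> ('i \<Rightarrow> 'e) set" where
  "unit_sphere V ip = {v \<in> V. ip v v = 1}"

definition sphere_topology ::
  "('i \<Rightarrow> 'e::euclidean_space) set \<Rightarrow> (('i \<Rightarrow> 'e) \<Rightarrow> ('i \<Rightarrow> 'e) \<Rightarrow> real) \<Rightarrow> ('i \<Rightarrow> 'e) topology" where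
  "sphere_topology V ip = top_of_set (unit_sphere V ip)"

section \<open>Kakeya line configurations\<close>

definition unoriented_config ::
  "('a, 'm) monoid_scheme \<Rightarrow> 'a topology \<Rightarrow> ('a, 'e::euclidean_space) chart set \<Rightarrow>
   ((('a, 'e) chart \<Rightarrow> 'e) set \<Rightarrow> 'a) \<Rightarrow> bool" where
  "unoriented_config G T A \<sigma> \<longleftrightarrow> continuous_map (proj_topology (lie_algebra G A)) T \<sigma>"

definition unoriented_space ::
  "('a, 'm) monoid_scheme \<Rightarrow> 'a topology \<Rightarrow> ('a, 'e::euclidean_space) chart set \<Rightarrow>
   ((('a, 'e) chart \<Rightarrow> 'e) set \<Rightarrow> 'a) \<Rightarrow> 'a set" where
  "unoriented_space G T A \<sigma> =
     (\<Union>L\<in>proj_space (lie_algebra G A). \<sigma> L <#\<^bsub>G\<^esub> (lie_exp G T A ` L))"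

definition oriented_config ::
  "('a, 'm) monoid_scheme \<Rightarrow> 'a topology \<Rightarrow> ('a, 'e::euclidean_space) chart set \<Rightarrow>
   ((('a, 'e) chart \<Rightarrow> 'e) \<Rightarrow> (('a, 'e) chart \<Rightarrow> 'e) \<Rightarrow> real) \<Rightarrow>
   ((('a, 'e) chart \<Rightarrow> 'e) \<Rightarrow> 'a) \<Rightarrow> bool" where
  "oriented_config G T A ip \<sigma> \<longleftrightarrow> continuous_map (sphere_topology (lie_algebra G A) ip) T \<sigma>"

definition oriented_space ::
  "('a, 'm) monoid_scheme \<Rightarrow> 'a topology \<Rightarrow> ('a, 'e::euclidean_space) chart set \<Rightarrow>
   ((('a, 'e) chart \<Rightarrow> 'e) \<Rightarrow> (('a, 'e) chart \<Rightarrow> 'e) \<Rightarrow> real) \<Rightarrow>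
   ((('a, 'e) chart \<Rightarrow> 'e) \<Rightarrow> 'a) \<Rightarrow> 'a set" where
  "oriented_space G T A ip \<sigma> =
     (\<Union>x\<in>unit_sphere (lie_algebra G A) ip. \<sigma> x <#\<^bsub>G\<^esub> (lie_exp G T A ` line_through x))"

text \<open>In the next two definitions \<open>D\<close> is the topological space on which the configuration is
  defined (the projective space or the unit sphere of the Lie algebra).\<close>

definition linear_config ::
  "('a, 'm) monoid_scheme \<Rightarrow> 'a topology \<Rightarrow> ('a, 'e::euclidean_space) chart set \<Rightarrow>
   'd topology \<Rightarrow> ('d \<Rightarrow> 'a) \<Rightarrow> bool" where
  "linear_config G T A D \<sigma> \<longleftrightarrow>
     (\<exists>\<mu>. continuous_map D (lie_algebra_topology G A) \<mu> \<and>
        (\<forall>x\<in>topspace D. lie_exp G T A (\<mu> x) = \<sigma> x))"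

definition taut_config ::
  "('a, 'm) monoid_scheme \<Rightarrow> 'a topology \<Rightarrow> ('a, 'e::euclidean_space) chart set \<Rightarrow>
   'd topology \<Rightarrow> ('d \<Rightarrow> 'a) \<Rightarrow> bool" where
  "taut_config G T A D \<sigma> \<longleftrightarrow>
     (\<exists>U V. openin T U \<and> \<one>\<^bsub>G\<^esub> \<in> U \<and>
        openin (lie_algebra_topology G A) V \<and> (\<lambda>c. 0) \<in> V \<and>
        diffeomorphism
          (subtopology (lie_algebra_topology G A) V) (restrict_atlas V (lie_algebra_atlas G A))
          (subtopology T U) (restrict_atlas U A) (lie_exp G T A) \<and>
        \<sigma> ` topspace D \<subseteq> U)"

definition contains_nbhd_of_one ::
  "('a, 'm) monoid_scheme \<Rightarrow> 'a topology \<Rightarrow> 'a set \<Rightarrow> bool" where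
  "contains_nbhd_of_one G T S \<longleftrightarrow> (\<exists>W. openin T W \<and> \<one>\<^bsub>G\<^esub> \<in> W \<and> W \<subseteq> S)"

end

theory Submission
  imports Defs "HOL-Homology.Homology"
begin

text \<open>If \<open>\<mu>(L)\<close> lies on the line \<open>L\<close>, then \<open>exp(\<mu>(L)) exp(-\<mu>(L)) = 1\<close> lies on the Kakeya line with
  direction \<open>L\<close>. So part (1) says that an even continuous map \<open>f\<close> from the unit sphere to \<open>\<real>\<^sup>n\<close> satisfies
  \<open>f(x) \<in> \<real>x\<close> for some \<open>x\<close>. Otherwise \<open>f/\<bar>f\<bar>\<close> would be an even self-map of the sphere homotopic to the
  identity, hence of degree 1. But even self-maps have even degree: after a homotopy through even maps
  the equator is mapped to a point (its image has measure zero, so it misses some \<open>-q\<close>, and everything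
  away from \<open>-q\<close> can be pushed to \<open>q\<close>), and then both hemispheres contribute the same degree up to sign.
  For arbitrary \<open>f\<close> and odd \<open>n\<close>, \<open>f/\<bar>f\<bar>\<close> would connect the identity with the antipodal map, of degree \<open>-1\<close>.
  For a taut configuration, \<open>h\<^sup>-\<^sup>1\<sigma>\<close> remains linear for all \<open>h\<close> near 1, so that \<open>h\<close> lies in \<open>\<bar>\<sigma>\<bar>\<close>.

  Since \<open>lie_exp\<close> is defined by a definite description, all of this rests on the existence and
  uniqueness of one-parameter subgroups, which are obtained as integral curves of left invariant
  vector fields.\<close>

section \<open>Brouwer degrees of even maps of spheres\<close>

text \<open>Measure zero requires differentiability, so an even map that is nowhere collinear with
  \<open>x\<close> is replaced by an even polynomial with the same property. Collapsing just the
  equator would not suffice: degrees are added by cutting cycles into simplices that lie in one of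
  two open pieces, so the map must be constant on an open band around the equator, where these
  pieces overlap. On the group side a left invariant field has only local solutions near the
  identity. The formula \<gamma>(t) = \<gamma>(t/n)^n makes them global and carries local uniqueness
  to all times. The same device makes exp continuous on the whole Lie algebra, starting from its
  continuity near 0, which is part of tautness. With exp continuous, \<bar>\<sigma>\<bar> is a
  countable union of compact sets, so that it has a Haar measure at all. Both domains of
  configurations are handled at once, as continuous images of the Euclidean unit sphere of the model
  space.\<close>

lemma mult_homologous_rel_set:
  "homologous_rel_set p X S a \<otimes>\<^bsub>relative_homology_group (int p) X S\<^esub> homologous_rel_set p X S b
   = homologous_rel_set p X S (a + b)"
proof -
  \<comment> \<open>Classes are multiplied as sets of chains, so each chain homologous to
    \<open>a + b\<close> has to be split into a sum; \<open>a\<close> and \<open>y - a\<close> do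
    it.\<close>
  have "\<exists>r. homologous_rel p X S a r \<and> (\<exists>s. homologous_rel p X S b s \<and> y = r + s)"
    if "homologous_rel p X S (a + b) y" for y
  proof (intro exI conjI)
    show "homologous_rel p X S b (y - a)"
      using that by (simp add: homologous_rel_def algebra_simps)
  qed auto
  then show ?thesis
    unfolding mult_relative_homology_group by (auto intro: homologous_rel_add)
qed

text \<open>On a small simplex one of \<open>g\<close>, \<open>h\<close> is \<open>f\<close> and the
  other is constant. The constant chain on the left balances the constant one, and which of the two
  it is does not matter for the sum.\<close>

lemma chain_map_add_piecewise:
  assumes "\<And>s. s \<in> Poly_Mapping.keys c \<Longrightarrow>
       (\<forall>x\<in>standard_simplex p. g (s x) = f (s x) \<and> h (s x) = a) \<or>
       (\<forall>x\<in>standard_simplex p. g (s x) = a \<and> h (s x) = f (s x))"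
  shows "chain_map p f c + chain_map p (\<lambda>x. a) c = chain_map p g c + chain_map p h c"
proof -
  have "frag_of (simplex_map p f s) + frag_of (simplex_map p (\<lambda>x. a) s)
      = frag_of (simplex_map p g s) + frag_of (simplex_map p h s)"
    if s: "s \<in> Poly_Mapping.keys c" for s
  proof -
    have "simplex_map p g s = simplex_map p f s \<and> simplex_map p h s = simplex_map p (\<lambda>x. a) s \<or>
        simplex_map p g s = simplex_map p (\<lambda>x. a) s \<and> simplex_map p h s = simplex_map p f s"
      using assms[OF s] by (auto simp: simplex_map_def restrict_def fun_eq_iff)
    then show ?thesis by auto
  qed
  then show ?thesis
    by (simp add: chain_map_def frag_extend_def flip: sum.distrib frag_cmul_distrib2)
qed

text \<open>A map that collapses the intersection of two open pieces of the sphere to a point is a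
  pinch followed by two maps, whose degrees add up: a cycle is homologous to one whose simplices
  are so small that each of them lies in one of the two pieces.\<close>

lemma Brouwer_degree2_add:
  assumes p: "p \<noteq> 0"
    and f: "continuous_map (nsphere p) (nsphere p) f"
    and g: "continuous_map (nsphere p) (nsphere p) g"
    and h: "continuous_map (nsphere p) (nsphere p) h"
    and a: "a \<in> topspace (nsphere p)"
    and UV: "openin (nsphere p) U" "openin (nsphere p) V" "topspace (nsphere p) \<subseteq> U \<union> V"
    and U: "\<And>x. x \<in> U \<Longrightarrow> g x = f x \<and> h x = a"
    and V: "\<And>x. x \<in> V \<Longrightarrow> g x = a \<and> h x = f x"
  shows "Brouwer_degree2 p f = Brouwer_degree2 p g + Brouwer_degree2 p h"
proof (rule Brouwer_degree2_unique[OF f])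
  let ?X = "nsphere p"
  let ?G = "relative_homology_group (int p) ?X {}"
  let ?k = "\<lambda>x::nat\<Rightarrow>real. a"
  let ?i = "hom_induced (int p) ?X {} ?X {}"
  \<comment> \<open>In positive dimension the reduced group is the ordinary one, whose elements are
    classes of singular cycles.\<close>
  have RG: "reduced_homology_group (int p) ?X = ?G"
    using p by (simp add: un_reduced_homology_group)
  interpret group ?G by simp
  have k: "continuous_map ?X ?X ?k"
    using a by simp
  fix x assume x: "x \<in> carrier (reduced_homology_group (int p) ?X)"
  then obtain c0 where c0: "singular_relcycle p ?X {} c0" "x = homologous_rel_set p ?X {} c0"
    by (auto simp: RG carrier_relative_homology_group)
  obtain c where c: "singular_relcycle p ?X {} c" "homologous_rel p ?X {} c0 c"
    and small: "\<And>s. s \<in> Poly_Mapping.keys c \<Longrightarrow> \<exists>W\<in>{U,V}. s \<in> standard_simplex p \<rightarrow> W"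
  proof (rule small_homologous_rel_relcycle_exists[of "{U,V}" ?X p "{}" c0])
    show "openin ?X W" if "W \<in> {U,V}" for W
      using that UV by auto
    show "topspace ?X \<subseteq> \<Union>{U,V}"
      using UV by simp
    show "singular_relcycle p ?X {} c0" by (rule c0(1))
  qed (rule that)
  have xc: "x = homologous_rel_set p ?X {} c"
    using c0(2) homologous_rel_eq[THEN iffD2, OF c(2)] by simp
  have cm: "?i m x = homologous_rel_set p ?X {} (chain_map p m c)"
    if "continuous_map ?X ?X m" for m
    unfolding xc using that c by (simp add: hom_induced_chain_map)
  have "chain_map p f c + chain_map p ?k c = chain_map p g c + chain_map p h c"
    using small U V by (intro chain_map_add_piecewise) (fastforce simp: Pi_iff)
  then have "?i f x \<otimes>\<^bsub>?G\<^esub> ?i ?k x = ?i g x \<otimes>\<^bsub>?G\<^esub> ?i h x"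
    unfolding cm[OF f] cm[OF g] cm[OF h] cm[OF k] mult_homologous_rel_set by (rule arg_cong)
  moreover have pow: "?i m x = x [^]\<^bsub>?G\<^esub> Brouwer_degree2 p m" for m
    using Brouwer_degree2[OF x] unfolding RG .
  \<comment> \<open>The constant map has degree 0, so the balancing term disappears in
    homology.\<close>
  ultimately have "x [^]\<^bsub>?G\<^esub> Brouwer_degree2 p f \<otimes>\<^bsub>?G\<^esub> x [^]\<^bsub>?G\<^esub> (0::int)
      = x [^]\<^bsub>?G\<^esub> Brouwer_degree2 p g \<otimes>\<^bsub>?G\<^esub> x [^]\<^bsub>?G\<^esub> Brouwer_degree2 p h"
    by (simp only: Brouwer_degree2_const)
  moreover have "x \<in> carrier ?G"
    using x unfolding RG .
  ultimately have "x [^]\<^bsub>?G\<^esub> (Brouwer_degree2 p f + 0)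
      = x [^]\<^bsub>?G\<^esub> (Brouwer_degree2 p g + Brouwer_degree2 p h)"
    by (simp only: int_pow_mult)
  then show "?i f x = x [^]\<^bsub>reduced_homology_group (int p) ?X\<^esub> (Brouwer_degree2 p g + Brouwer_degree2 p h)"
    unfolding RG pow by (simp only: add_0_right)
qed

section \<open>The antipodal map and even maps of the standard spheres\<close>

lemma continuous_map_nsphere_uminus:
  "continuous_map (nsphere p) (nsphere p) (\<lambda>x i. - x i)"
proof -
  have "\<And>k. continuous_map (powertop_real UNIV) euclideanreal (\<lambda>x. - x k)"
    by (metis UNIV_I continuous_map_product_projection continuous_map_minus)
  then show ?thesis
    by (force simp: nsphere continuous_map_in_subtopology continuous_map_componentwise_UNIV
        intro: continuous_map_from_subtopology)
qed

lemma abs_Brouwer_degree2_uminus: "\<bar>Brouwer_degree2 p (\<lambda>x i. - x i)\<bar> = 1"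
proof -
  have "homeomorphic_maps (nsphere p) (nsphere p) (\<lambda>x i. - x i) (\<lambda>x i. - x i)"
    by (simp add: homeomorphic_maps_def continuous_map_nsphere_uminus)
  then show ?thesis
    by (rule Brouwer_degree2_homeomorphic_maps)
qed

text \<open>Let \<open>g\<close> and \<open>h\<close> be \<open>f\<close> on one closed hemisphere
  and constant on the other. Evenness makes \<open>h\<close> the composition of \<open>g\<close>
  with the antipodal map, so the degree of \<open>f\<close> is deg \<open>g\<close> times 1 + deg of
  the antipode. The latter degree is 1 or -1, and both signs give an even number.\<close>

lemma even_Brouwer_degree2_of_even_map:
  assumes p: "p \<noteq> 0"
    and f: "continuous_map (nsphere p) (nsphere p) f"
    and even: "\<And>x. x \<in> topspace (nsphere p) \<Longrightarrow> f (\<lambda>i. - x i) = f x"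
    and "0 < d" and const: "\<And>x. x \<in> topspace (nsphere p) \<Longrightarrow> \<bar>x p\<bar> < d \<Longrightarrow> f x = a"
    and a: "a \<in> topspace (nsphere p)"
  shows "2 dvd Brouwer_degree2 p f"
proof -
  let ?X = "nsphere p"
  define g where "g = (\<lambda>x::nat\<Rightarrow>real. if x p \<ge> 0 then f x else a)"
  define h where "h = (\<lambda>x::nat\<Rightarrow>real. if x p \<le> 0 then f x else a)"
  have pr: "continuous_map ?X euclideanreal (\<lambda>x. x p)"
    by (rule continuous_map_nsphere_projection)
  have g: "continuous_map ?X ?X g"
    unfolding g_def
    by (rule continuous_map_cases_le[OF continuous_map_const[THEN iffD2] pr])
       (use f a const \<open>0 < d\<close> in \<open>auto intro: continuous_map_from_subtopology\<close>)
  have h: "continuous_map ?X ?X h"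
    unfolding h_def
    by (rule continuous_map_cases_le[OF pr continuous_map_const[THEN iffD2]])
       (use f a const \<open>0 < d\<close> in \<open>auto intro: continuous_map_from_subtopology\<close>)
  have "Brouwer_degree2 p f = Brouwer_degree2 p g + Brouwer_degree2 p h"
  proof (rule Brouwer_degree2_add[OF p f g h a])
    \<comment> \<open>The pieces are hemispheres enlarged by the band on which \<open>f\<close>,
      \<open>g\<close> and \<open>h\<close> all equal \<open>a\<close>; this makes them open and
      keeps \<open>g = f\<close>, \<open>h = a\<close> on the first and the reverse on the
      second.\<close>
    show "openin ?X {x \<in> topspace ?X. x p \<in> {-d<..}}" "openin ?X {x \<in> topspace ?X. x p \<in> {..<d}}"
      by (intro openin_continuous_map_preimage[OF pr]; simp)+
    show "topspace ?X \<subseteq> {x \<in> topspace ?X. x p \<in> {-d<..}} \<union> {x \<in> topspace ?X. x p \<in> {..<d}}"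
      using \<open>0 < d\<close> by auto
  qed (use const \<open>0 < d\<close> in \<open>auto simp: g_def h_def\<close>)
  moreover have "Brouwer_degree2 p h = Brouwer_degree2 p (g \<circ> (\<lambda>x i. - x i))"
    using even by (intro Brouwer_degree2_eq) (simp add: g_def h_def)
  moreover have "\<dots> = Brouwer_degree2 p g * Brouwer_degree2 p (\<lambda>x i. - x i)"
    by (intro Brouwer_degree2_compose g continuous_map_nsphere_uminus)
  ultimately show ?thesis
    using abs_Brouwer_degree2_uminus[of p] by (auto simp: abs_eq_iff')
qed

text \<open>The antipodal map is a product of \<open>p + 1\<close> reflections in single
  coordinates. Each of them is conjugate to the reflection in coordinate 0 by the swap
  \<open>?s k\<close>, and \<open>?n k\<close> negates the first \<open>k\<close>
  coordinates.\<close>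

lemma Brouwer_degree2_uminus: "Brouwer_degree2 p (\<lambda>x i. - x i) = (- 1) ^ Suc p"
proof -
  let ?X = "nsphere p"
  let ?r = "\<lambda>k (x::nat\<Rightarrow>real) i. if i = k then - x i else x i"
  let ?s = "\<lambda>k (x::nat\<Rightarrow>real) i. if i = k then x 0 else if i = 0 then x k else x i"
  let ?n = "\<lambda>k (x::nat\<Rightarrow>real) i. if i < k then - x i else x i"
  have s: "continuous_map ?X ?X (?s k)" if "k \<le> p" for k
  proof -
    have "(\<Sum>i\<le>p. (?s k x i)\<^sup>2) = (\<Sum>i\<le>p. (x i)\<^sup>2)" for x :: "nat \<Rightarrow> real"
      by (rule sum.reindex_bij_witness[of _ "Transposition.transpose 0 k" "Transposition.transpose 0 k"])
         (use that in \<open>auto simp: Transposition.transpose_def\<close>)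
    then show ?thesis using that
      by (auto simp: nsphere continuous_map_in_subtopology continuous_map_componentwise_UNIV
          intro!: continuous_map_from_subtopology continuous_map_product_projection)
  qed
  have r: "Brouwer_degree2 p (?r k) = -1" if k: "k \<le> p" for k
  proof -
    have eq: "?r k = ?s k \<circ> (?r 0 \<circ> ?s k)"
      by (auto simp: fun_eq_iff)
    have c: "continuous_map ?X ?X (?r 0 \<circ> ?s k)"
      by (rule continuous_map_compose[OF s[OF k] continuous_map_nsphere_reflection])
    have id: "?s k \<circ> ?s k = id"
      by (auto simp: fun_eq_iff)
    \<comment> \<open>The swap is an involution, so the square of its degree is 1 and its sign
      cancels in the conjugation.\<close>
    have ss: "Brouwer_degree2 p (?s k) * Brouwer_degree2 p (?s k) = 1"
      using Brouwer_degree2_compose[OF s[OF k] s[OF k]] unfolding id by simp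
    have "Brouwer_degree2 p (?r k)
        = Brouwer_degree2 p (?s k) * (Brouwer_degree2 p (?r 0) * Brouwer_degree2 p (?s k))"
      unfolding eq Brouwer_degree2_compose[OF c s[OF k]]
        Brouwer_degree2_compose[OF s[OF k] continuous_map_nsphere_reflection] ..
    with ss show ?thesis
      unfolding Brouwer_degree2_reflection by simp
  qed
  have "continuous_map ?X ?X (?n k) \<and> Brouwer_degree2 p (?n k) = (- 1) ^ k" if "k \<le> Suc p" for k
    using that
  proof (induction k)
    case 0
    then show ?case by (simp flip: id_def)
  next
    case (Suc k)
    have eq: "?n (Suc k) = ?r k \<circ> ?n k"
      by (auto simp: fun_eq_iff)
    from Suc have k: "continuous_map ?X ?X (?n k)" "Brouwer_degree2 p (?n k) = (- 1) ^ k" "k \<le> p"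
      by auto
    show ?case
      unfolding eq Brouwer_degree2_compose[OF k(1) continuous_map_nsphere_reflection] r[OF k(3)] k(2)
      using continuous_map_compose[OF k(1) continuous_map_nsphere_reflection] by simp
  qed
  from this[of "Suc p"] have "Brouwer_degree2 p (?n (Suc p)) = (- 1) ^ Suc p"
    by simp
  \<comment> \<open>The two maps differ as functions on sequences but agree on the sphere, where all
    coordinates beyond \<open>p\<close> vanish.\<close>
  moreover have "Brouwer_degree2 p (?n (Suc p)) = Brouwer_degree2 p (\<lambda>x i. - x i)"
    by (rule Brouwer_degree2_eq) (force simp: nsphere fun_eq_iff)
  ultimately show ?thesis by simp
qed

section \<open>Transfer of the degree arguments to unit spheres of Euclidean spaces\<close>

lemma homotopic_sgn_compose:
  fixes f g :: "'a::topological_space \<Rightarrow> 'b::euclidean_space"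
  assumes "continuous_on S f" "continuous_on S g"
    and "\<And>x. x \<in> S \<Longrightarrow> 0 \<notin> closed_segment (f x) (g x)"
  shows "homotopic_with_canon (\<lambda>_. True) S (sphere 0 1) (sgn \<circ> f) (sgn \<circ> g)"
proof (rule homotopic_with_compose_continuous_map_left)
  show "homotopic_with_canon (\<lambda>_. True) S (- {0}) f g"
    using assms by (intro homotopic_with_linear) auto
  show "continuous_map (top_of_set (- {0})) (top_of_set (sphere 0 1)) (sgn :: 'b \<Rightarrow> 'b)"
    by (auto simp: norm_sgn intro!: continuous_intros)
qed auto

text \<open>Degrees live on \<open>nsphere\<close>, a set of real sequences. Oddness of \<phi> and
  \<psi> transports antipodes and evenness, and \<open>e\<close> marks the hyperplane that
  corresponds to the equator where the last coordinate vanishes.\<close>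

lemma homeomorphic_nsphere_sphere:
  obtains \<phi> :: "(nat \<Rightarrow> real) \<Rightarrow> 'e::euclidean_space" and \<psi> and e :: 'e
  where "homeomorphic_maps (nsphere (DIM('e) - 1)) (top_of_set (sphere 0 1)) \<phi> \<psi>"
    and "\<And>x. \<phi> (\<lambda>i. - x i) = - \<phi> x" "\<And>y. \<psi> (- y) = (\<lambda>i. - \<psi> y i)"
    and "\<And>y. \<psi> y (DIM('e) - 1) = y \<bullet> e" "e \<in> Basis"
proof -
  let ?n = "DIM('e)"
  obtain b :: "nat \<Rightarrow> 'e" where b: "bij_betw b {..<?n} Basis"
    using ex_bij_betw_nat_finite[of "Basis :: 'e set"] by (auto simp: atLeast0LessThan)
  have n: "0 < ?n" by simp
  have bB: "b i \<in> Basis" if "i < ?n" for i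
    using b that by (auto simp: bij_betw_def)
  have orth: "b i \<bullet> b j = (if i = j then 1 else 0)" if "i < ?n" "j < ?n" for i j
    using b that inner_Basis[OF bB[OF that(1)] bB[OF that(2)]]
    by (auto simp: bij_betw_def inj_on_def)
  define \<phi> where "\<phi> = (\<lambda>x::nat\<Rightarrow>real. \<Sum>i<?n. x i *\<^sub>R b i)"
  define \<psi> where "\<psi> = (\<lambda>y i. if i < ?n then y \<bullet> b i else 0)"
  have \<phi>b: "\<phi> x \<bullet> b i = x i" if "i < ?n" for x i
    using that by (simp add: \<phi>_def inner_sum_left orth if_distrib sum.delta cong: if_cong)
  have norm: "norm (\<phi> x) ^ 2 = (\<Sum>i<?n. (x i)\<^sup>2)" for x
    unfolding power2_norm_eq_inner
    by (subst (2) \<phi>_def) (simp add: inner_sum_right \<phi>b power2_eq_square)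
  have \<phi>\<psi>: "\<phi> (\<psi> y) = y" for y
  proof -
    have "\<phi> (\<psi> y) = (\<Sum>i<?n. (y \<bullet> b i) *\<^sub>R b i)"
      by (simp add: \<phi>_def \<psi>_def)
    also have "\<dots> = (\<Sum>v\<in>Basis. (y \<bullet> v) *\<^sub>R v)"
      by (rule sum.reindex_bij_betw[OF b])
    finally show ?thesis by (simp add: euclidean_representation)
  qed
  obtain m where m: "?n = Suc m"
    using n gr0_conv_Suc by blast
  have ns: "x \<in> topspace (nsphere (?n - 1)) \<longleftrightarrow> (\<Sum>i<?n. (x i)\<^sup>2) = 1 \<and> (\<forall>i\<ge>?n. x i = 0)" for x
    unfolding nsphere m lessThan_Suc_atMost by (auto simp: Suc_le_eq)
  have "homeomorphic_maps (nsphere (?n - 1)) (top_of_set (sphere 0 1)) \<phi> \<psi>"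
    unfolding homeomorphic_maps_def
  proof (intro conjI ballI)
    have "continuous_map (powertop_real UNIV) euclidean \<phi>"
      unfolding \<phi>_def euclidean_product_topology
      by (auto intro!: continuous_intros continuous_on_product_coordinates)
    then have "continuous_map (nsphere (?n - 1)) euclidean \<phi>"
      unfolding nsphere by (rule continuous_map_from_subtopology)
    moreover have "norm (\<phi> x) = 1" if "x \<in> topspace (nsphere (?n - 1))" for x
      using norm[of x] that power2_eq_imp_eq[of "norm (\<phi> x)" 1] unfolding ns by simp
    ultimately show "continuous_map (nsphere (?n - 1)) (top_of_set (sphere 0 1)) \<phi>"
      by (auto simp: continuous_map_in_subtopology)
    have "continuous_map (top_of_set (sphere 0 1)) (powertop_real UNIV) \<psi>"
      unfolding \<psi>_def continuous_map_componentwise_UNIV by (auto intro!: continuous_intros)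
    moreover have "\<psi> y \<in> topspace (nsphere (?n - 1))" if "y \<in> sphere 0 1" for y
      unfolding ns using norm[of "\<psi> y"] that by (simp add: \<phi>\<psi>) (simp add: \<psi>_def)
    ultimately show "continuous_map (top_of_set (sphere 0 1)) (nsphere (?n - 1)) \<psi>"
      by (auto simp: nsphere continuous_map_in_subtopology)
  next
    fix x assume "x \<in> topspace (nsphere (?n - 1))"
    then have "\<forall>i\<ge>?n. x i = 0"
      unfolding ns by simp
    then show "\<psi> (\<phi> x) = x"
      by (auto simp: \<psi>_def \<phi>b fun_eq_iff)
  qed (rule \<phi>\<psi>)
  moreover have "\<psi> y (?n - 1) = y \<bullet> b (?n - 1)" for y
    by (simp add: \<psi>_def)
  moreover have "b (?n - 1) \<in> Basis"
    by (simp add: bB)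
  ultimately show thesis
    by (rule_tac that[of \<phi> \<psi> "b (?n - 1)"]) (auto simp: \<phi>_def \<psi>_def sum_negf)
qed

lemma homotopic_with_conjugate:
  assumes "homeomorphic_maps X Y \<phi> \<psi>" "homotopic_with (\<lambda>_. True) Y Y f g"
  shows "homotopic_with (\<lambda>_. True) X X (\<psi> \<circ> f \<circ> \<phi>) (\<psi> \<circ> g \<circ> \<phi>)"
  using assms unfolding homeomorphic_maps_def
  by (intro homotopic_with_compose_continuous_map_right[where p = "\<lambda>_. True"]
      homotopic_with_compose_continuous_map_left[where p = "\<lambda>_. True"]) auto

lemma not_homotopic_id_uminus_sphere:
  assumes "odd DIM('e::euclidean_space)"
  shows "\<not> homotopic_with_canon (\<lambda>_. True) (sphere 0 1) (sphere 0 1) id (uminus :: 'e \<Rightarrow> 'e)"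
proof
  let ?p = "DIM('e) - 1"
  assume h: "homotopic_with_canon (\<lambda>_. True) (sphere 0 1) (sphere 0 1) id (uminus :: 'e \<Rightarrow> 'e)"
  obtain \<phi> :: "(nat \<Rightarrow> real) \<Rightarrow> 'e" and \<psi> and e :: 'e
    where hom: "homeomorphic_maps (nsphere ?p) (top_of_set (sphere 0 1)) \<phi> \<psi>"
      and neg: "\<And>y. \<psi> (- y) = (\<lambda>i. - \<psi> y i)"
    using homeomorphic_nsphere_sphere by metis
  have inv: "\<psi> (\<phi> x) = x" if "x \<in> topspace (nsphere ?p)" for x
    using hom that by (simp add: homeomorphic_maps_def)
  have "Brouwer_degree2 ?p (\<psi> \<circ> id \<circ> \<phi>) = Brouwer_degree2 ?p (\<psi> \<circ> uminus \<circ> \<phi>)"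
    by (intro Brouwer_degree2_homotopic homotopic_with_conjugate[OF hom h])
  moreover have "Brouwer_degree2 ?p (\<psi> \<circ> id \<circ> \<phi>) = Brouwer_degree2 ?p id"
    by (rule Brouwer_degree2_eq) (simp add: inv)
  moreover have "Brouwer_degree2 ?p (\<psi> \<circ> uminus \<circ> \<phi>) = Brouwer_degree2 ?p (\<lambda>x i. - x i)"
    by (rule Brouwer_degree2_eq) (simp add: inv neg)
  ultimately show False
    using assms by (simp add: Brouwer_degree2_uminus)
qed

text \<open>The direction \<open>e\<close> comes out before \<open>f\<close> is given, because the
  band to be collapsed is needed in order to construct \<open>f\<close>. Such an \<open>f\<close>
  has even degree, the identity degree 1; the bound on the dimension excludes the 0-sphere.\<close>

lemma even_map_not_homotopic_id_sphere:
  assumes "1 < DIM('e::euclidean_space)"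
  obtains e :: "'e::euclidean_space" where "e \<in> Basis"
    "\<And>(f :: 'e::euclidean_space \<Rightarrow> 'e) d a. (\<And>x. f (- x) = f x) \<Longrightarrow> 0 < d \<Longrightarrow> a \<in> sphere 0 1 \<Longrightarrow>
       (\<And>x. x \<in> sphere 0 1 \<Longrightarrow> \<bar>x \<bullet> e\<bar> < d \<Longrightarrow> f x = a) \<Longrightarrow>
       \<not> homotopic_with_canon (\<lambda>_. True) (sphere 0 1) (sphere 0 1) id f"
proof -
  let ?p = "DIM('e) - 1"
  obtain \<phi> :: "(nat \<Rightarrow> real) \<Rightarrow> 'e" and \<psi> and e :: 'e
    where hom: "homeomorphic_maps (nsphere ?p) (top_of_set (sphere 0 1)) \<phi> \<psi>"
      and neg: "\<And>x. \<phi> (\<lambda>i. - x i) = - \<phi> x"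
      and \<psi>e: "\<And>y. \<psi> y ?p = y \<bullet> e" and e: "e \<in> Basis"
    using homeomorphic_nsphere_sphere by metis
  have inv: "\<psi> (\<phi> x) = x" "\<phi> x \<in> sphere 0 1" if "x \<in> topspace (nsphere ?p)" for x
    using hom that by (auto simp: homeomorphic_maps_def continuous_map_def)
  show thesis
  proof (rule that[OF e])
    fix f :: "'e \<Rightarrow> 'e" and d a
    assume even: "\<And>x. f (- x) = f x" and d: "0 < d" and a: "a \<in> sphere 0 1"
      and const: "\<And>x. x \<in> sphere 0 1 \<Longrightarrow> \<bar>x \<bullet> e\<bar> < d \<Longrightarrow> f x = a"
    show "\<not> homotopic_with_canon (\<lambda>_. True) (sphere 0 1) (sphere 0 1) id f"
    proof
      assume h: "homotopic_with_canon (\<lambda>_. True) (sphere 0 1) (sphere 0 1) id f"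
      let ?F = "\<psi> \<circ> f \<circ> \<phi>"
      have hF: "homotopic_with (\<lambda>_. True) (nsphere ?p) (nsphere ?p) (\<psi> \<circ> id \<circ> \<phi>) ?F"
        by (rule homotopic_with_conjugate[OF hom h])
      have "Brouwer_degree2 ?p (\<psi> \<circ> id \<circ> \<phi>) = Brouwer_degree2 ?p id"
        by (rule Brouwer_degree2_eq) (simp add: inv)
      then have "Brouwer_degree2 ?p ?F = 1"
        using Brouwer_degree2_homotopic[OF hF] by simp
      moreover have "2 dvd Brouwer_degree2 ?p ?F"
      proof (rule even_Brouwer_degree2_of_even_map[where a = "\<psi> a" and d = d])
        show "continuous_map (nsphere ?p) (nsphere ?p) ?F"
          using homotopic_with_imp_continuous_maps[OF hF] by simp
        show "\<psi> a \<in> topspace (nsphere ?p)"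
          using hom a by (auto simp: homeomorphic_maps_def continuous_map_def)
        fix x assume x: "x \<in> topspace (nsphere ?p)" and "\<bar>x ?p\<bar> < d"
        then show "?F x = \<psi> a"
          using inv[OF x] \<psi>e[of "\<phi> x"] const[of "\<phi> x"] by simp
      qed (use assms even neg d in auto)
      ultimately show False by simp
    qed
  qed
qed

section \<open>Maps of the sphere that are collinear with the identity somewhere\<close>

lemma zero_notin_closed_segment_scaleR:
  fixes x y :: "'e::real_normed_vector"
  assumes "c \<noteq> 0" and ne: "\<And>t. y \<noteq> t *\<^sub>R x" and "x \<noteq> 0"
  shows "0 \<notin> closed_segment (c *\<^sub>R x) y"
proof
  assume "0 \<in> closed_segment (c *\<^sub>R x) y"
  then obtain u where u: "(1 - u) *\<^sub>R c *\<^sub>R x + u *\<^sub>R y = 0"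
    by (auto simp: in_segment)
  show False
  proof (cases "u = 0")
    case True
    then show False using u assms by auto
  next
    case False
    have "u *\<^sub>R y = - ((1 - u) *\<^sub>R c *\<^sub>R x)"
      using u by (metis add.commute eq_neg_iff_add_eq_0)
    then have "(1 / u) *\<^sub>R u *\<^sub>R y = (1 / u) *\<^sub>R (- ((1 - u) *\<^sub>R c *\<^sub>R x))"
      by simp
    then have "y = (- (1 / u * ((1 - u) * c))) *\<^sub>R x"
      using False by simp
    then show False using ne by blast
  qed
qed

text \<open>Otherwise \<open>f\<close>, normalized, is never antipodal to \<open>x\<close> nor to \<open>- x\<close>, so that the identity
  and the antipodal map are homotopic.\<close>

lemma exists_collinear_odd_dim:
  fixes f :: "'e::euclidean_space \<Rightarrow> 'e"
  assumes "odd DIM('e)" and f: "continuous_on (sphere 0 1) f"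
  shows "\<exists>x\<in>sphere 0 1. \<exists>t. f x = t *\<^sub>R x"
proof (rule ccontr)
  assume "\<not> ?thesis"
  then have ne: "f x \<noteq> t *\<^sub>R x" if "x \<in> sphere 0 1" for x t
    using that by blast
  note seg = zero_notin_closed_segment_scaleR[OF _ ne]
  have *: "homotopic_with_canon (\<lambda>_. True) (sphere 0 1) (sphere 0 1) (sgn \<circ> (\<lambda>x. c *\<^sub>R x)) (sgn \<circ> f)"
    if "c \<noteq> 0" for c
    using that by (intro homotopic_sgn_compose f seg) (auto intro!: continuous_intros)
  have "homotopic_with_canon (\<lambda>_. True) (sphere 0 1) (sphere 0 1)
      (sgn \<circ> (\<lambda>x. 1 *\<^sub>R x)) (sgn \<circ> (\<lambda>x::'e. (-1) *\<^sub>R x))"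
    using homotopic_with_trans[OF *[of 1] homotopic_with_symD[OF *[of "-1"]]] by simp
  then have "homotopic_with_canon (\<lambda>_. True) (sphere 0 1) (sphere 0 1) id (uminus :: 'e \<Rightarrow> 'e)"
    by (rule homotopic_with_eq) (auto simp: sgn_div_norm)
  then show False
    using not_homotopic_id_uminus_sphere[OF assms(1)] by blast
qed

text \<open>The homogeneous extension \<open>?F\<close> of the normalized map trades the equator for
  a hyperplane and the sphere for the whole space. It is differentiable away from 0, so it maps the
  hyperplane to a null set; if the equator covered the sphere, that set together with 0 would be
  everything.\<close>

lemma sphere_not_subset_sgn_image_hyperplane:
  fixes p :: "'e::euclidean_space \<Rightarrow> 'e"
  assumes e: "e \<in> Basis" and p: "\<And>x. p differentiable (at x)"
    and nz: "\<And>x. x \<in> sphere 0 1 \<Longrightarrow> p x \<noteq> 0"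
  obtains q where "q \<in> sphere 0 1" "\<And>x. x \<in> sphere 0 1 \<Longrightarrow> x \<bullet> e = 0 \<Longrightarrow> sgn (p x) \<noteq> q"
proof -
  let ?H = "{x. e \<bullet> x = 0} - {0}"
  let ?F = "\<lambda>x. norm x *\<^sub>R ((1 / norm (p ((1 / norm x) *\<^sub>R x))) *\<^sub>R p ((1 / norm x) *\<^sub>R x))"
  have dn: "(\<lambda>x::'e. 1 / norm x) differentiable (at x)" if "x \<noteq> 0" for x
    by (rule differentiable_divide) (use that in \<open>auto intro: differentiable_norm_at\<close>)
  have ds: "(\<lambda>x::'e. (1 / norm x) *\<^sub>R x) differentiable (at x)" if "x \<noteq> 0" for x
    using dn[OF that] by (intro differentiable_scaleR) auto
  have dF: "?F differentiable (at x)" if x: "x \<noteq> 0" for x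
  proof -
    have s: "(1 / norm x) *\<^sub>R x \<in> sphere 0 1"
      using x by simp
    have dp: "(\<lambda>x. p ((1 / norm x) *\<^sub>R x)) differentiable (at x)"
      using differentiable_chain_at[OF ds[OF x] p] by (simp add: o_def)
    have "(\<lambda>x. 1 / norm (p ((1 / norm x) *\<^sub>R x))) differentiable (at x)"
      using differentiable_chain_at[OF dp dn[OF nz[OF s]]] by (simp add: o_def)
    then show ?thesis
      by (intro differentiable_scaleR dp differentiable_norm_at x)
  qed
  have "negligible (?F ` ?H)"
  proof (rule negligible_differentiable_image_negligible)
    show "negligible ?H"
      by (rule negligible_subset[OF negligible_standard_hyperplane[OF e, of 0]]) (auto simp: inner_commute)
    show "?F differentiable_on ?H"
      unfolding differentiable_on_def
    proof
      fix x :: 'e assume "x \<in> ?H"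
      then have "x \<noteq> 0" by blast
      then show "?F differentiable (at x within ?H)"
        by (rule differentiable_at_withinI[OF dF])
    qed
  qed auto
  then have neg: "negligible (insert 0 (?F ` ?H))"
    by simp
  have "\<exists>q\<in>sphere 0 1. \<forall>x\<in>sphere 0 1. x \<bullet> e = 0 \<longrightarrow> sgn (p x) \<noteq> q"
  proof (rule ccontr)
    assume "\<not> ?thesis"
    then have *: "\<exists>x\<in>sphere 0 1. x \<bullet> e = 0 \<and> sgn (p x) = q" if "q \<in> sphere 0 1" for q
      using that by blast
    have "y \<in> insert 0 (?F ` ?H)" for y
    proof (cases "y = 0")
      case False
      then obtain x where x: "x \<in> sphere 0 1" "x \<bullet> e = 0" "sgn (p x) = sgn y"
        using *[of "sgn y"] by (auto simp: norm_sgn)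
      have "?F (norm y *\<^sub>R x) = norm y *\<^sub>R sgn (p x)"
        using x(1) False by (simp add: sgn_div_norm divide_inverse_commute)
      also have "\<dots> = y"
        using x(3) False by (simp add: sgn_div_norm)
      finally have "y = ?F (norm y *\<^sub>R x)" ..
      moreover have "norm y *\<^sub>R x \<in> ?H"
        using x False by (auto simp: inner_commute)
      ultimately show ?thesis by blast
    qed simp
    then have "insert 0 (?F ` ?H) = UNIV" by blast
    with neg have "negligible (UNIV :: 'e set)" by (simp only:)
    then show False using non_negligible_UNIV by blast
  qed
  then show thesis using that by blast
qed

text \<open>Deforming the identity of the sphere so that everything away from \<open>- q\<close> is sent to \<open>q\<close>.\<close>

lemma push_to_point_homotopic:
  fixes q :: "'e::euclidean_space" and g :: "'e \<Rightarrow> 'e"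
  assumes q: "norm q = 1" and c: "- 1 < c1" "c1 < c0" "c0 < 1"
    and g: "continuous_on S g" "g \<in> S \<rightarrow> sphere 0 1"
  shows "homotopic_with_canon (\<lambda>_. True) S (sphere 0 1) (sgn \<circ> g)
    (sgn \<circ> (\<lambda>x. max 0 (c0 - g x \<bullet> q) *\<^sub>R (g x - (g x \<bullet> q) *\<^sub>R q) + (g x \<bullet> q - c1) *\<^sub>R q))"
proof (rule homotopic_sgn_compose)
  fix x assume x: "x \<in> S"
  \<comment> \<open>Write \<open>y = z + a q\<close> with \<open>z\<close> orthogonal to
    \<open>q\<close>; the target is then max 0 (c0 - a) z + (a - c1) q. For \<open>a\<close> at
    least \<open>c0\<close> it is a positive multiple of \<open>q\<close>, as
    \<open>c1 < c0\<close>, and at y = q and y = -q it is a positive multiple of \<open>y\<close>,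
    as c1 lies strictly between -1 and 1.\<close>
  define y where "y = g x"
  define a where "a = y \<bullet> q"
  define z where "z = y - a *\<^sub>R q"
  have y: "norm y = 1" using g(2) x by (auto simp: y_def)
  have yz: "y = z + a *\<^sub>R q" and zq: "z \<bullet> q = 0"
    using q by (simp_all add: z_def a_def inner_diff_left dot_square_norm)
  show "0 \<notin> closed_segment (g x) (max 0 (c0 - g x \<bullet> q) *\<^sub>R (g x - (g x \<bullet> q) *\<^sub>R q) + (g x \<bullet> q - c1) *\<^sub>R q)"
  proof
    assume "0 \<in> closed_segment (g x) (max 0 (c0 - g x \<bullet> q) *\<^sub>R (g x - (g x \<bullet> q) *\<^sub>R q) + (g x \<bullet> q - c1) *\<^sub>R q)"
    then obtain u where u: "0 \<le> u" "u \<le> 1"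
      and eq: "0 = (1 - u) *\<^sub>R y + u *\<^sub>R (max 0 (c0 - a) *\<^sub>R z + (a - c1) *\<^sub>R q)"
      by (auto simp: in_segment y_def a_def z_def)
    have eq1: "0 = ((1 - u) + u * max 0 (c0 - a)) *\<^sub>R z + ((1 - u) * a + u * (a - c1)) *\<^sub>R q"
      using eq by (subst (asm) yz) (simp add: algebra_simps)
    have q1: "(1 - u) * a + u * (a - c1) = 0"
      using arg_cong[OF eq1, of "\<lambda>v. v \<bullet> q"] q zq by (simp add: inner_add_left dot_square_norm)
    then have "((1 - u) + u * max 0 (c0 - a)) *\<^sub>R z = 0"
      using eq1 by simp
    then consider "z = 0" | "(1 - u) + u * max 0 (c0 - a) = 0"
      by auto
    \<comment> \<open>If \<open>z = 0\<close>, the segment stays on one side of 0. Otherwise the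
      coefficient of \<open>z\<close> can vanish only for \<open>u = 1\<close> and \<open>a\<close>
      at least \<open>c0\<close>, where the coefficient of \<open>q\<close> is positive.\<close>
    then show False
    proof cases
      case 1
      then have "\<bar>a\<bar> = 1" using y q by (simp add: yz)
      then consider "a = 1" | "a = -1" by linarith
      then show False
      proof cases
        case 1
        with q1 have "(1 - u) + u * (1 - c1) = 0" by simp
        moreover have "0 \<le> u * (1 - c1)" using u c by simp
        ultimately have "u = 1" "u * (1 - c1) = 0" using u by linarith+
        then show False using c by simp
      next
        case 2
        with q1 have "(1 - u) + u * (1 + c1) = 0" by (simp add: algebra_simps)
        moreover have "0 \<le> u * (1 + c1)" using u c by simp
        ultimately have "u = 1" "u * (1 + c1) = 0" using u by linarith+
        then show False using c by simp
      qed
    next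
      case 2
      moreover have "0 \<le> u * max 0 (c0 - a)"
        using u by simp
      ultimately have "u = 1" "u * max 0 (c0 - a) = 0"
        using u by linarith+
      then show False using q1 c by (auto simp: max_def split: if_splits)
    qed
  qed
qed (use g in \<open>auto intro!: continuous_intros\<close>)

lemma norm_diff_projection_le:
  fixes w x :: "'e::real_inner"
  assumes "norm x = 1"
  shows "norm (w - (w \<bullet> x) *\<^sub>R x) \<le> norm w"
proof -
  have xx: "x \<bullet> x = 1"
    using assms by (simp add: dot_square_norm)
  have "(norm (w - (w \<bullet> x) *\<^sub>R x))\<^sup>2 = (norm w)\<^sup>2 - (w \<bullet> x)\<^sup>2"
    unfolding power2_norm_eq_inner
    by (simp add: inner_diff_left inner_diff_right xx inner_commute[of x w] power2_eq_square)
  then show ?thesis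
    by (rule_tac power2_le_imp_le) auto
qed

text \<open>The component \<open>h x\<close> of \<open>f x\<close> orthogonal to \<open>x\<close>
  never vanishes, so by compactness its norm has a positive minimum. An approximation closer than
  this minimum cannot be collinear with \<open>x\<close>, and averaging over \<open>x\<close> and
  \<open>- x\<close> makes it even without increasing the error.\<close>

lemma even_polynomial_approx_sphere:
  fixes f :: "'e::euclidean_space \<Rightarrow> 'e"
  assumes f: "continuous_on (sphere 0 1) f"
    and even: "\<And>x. x \<in> sphere 0 1 \<Longrightarrow> f (- x) = f x"
    and ne: "\<And>x t. x \<in> sphere 0 1 \<Longrightarrow> f x \<noteq> t *\<^sub>R x"
  obtains p :: "'e::euclidean_space \<Rightarrow> 'e" where "polynomial_function p" "\<And>x. p (- x) = p x"
    "\<And>x t. x \<in> sphere 0 1 \<Longrightarrow> p x \<noteq> t *\<^sub>R x"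
proof -
  define h where "h = (\<lambda>x. f x - (f x \<bullet> x) *\<^sub>R x)"
  have "continuous_on (sphere 0 1) (\<lambda>x. norm (h x))"
    unfolding h_def by (intro continuous_intros f)
  then obtain x0 where x0: "x0 \<in> sphere 0 1" "\<And>x. x \<in> sphere 0 1 \<Longrightarrow> norm (h x0) \<le> norm (h x)"
    using continuous_attains_inf[of "sphere 0 1" "\<lambda>x. norm (h x)"] by auto
  have "0 < norm (h x0)"
    using ne[OF x0(1), of "f x0 \<bullet> x0"] by (simp add: h_def)
  from Stone_Weierstrass_polynomial_function[OF compact_sphere f this]
  obtain p0 where p0: "polynomial_function p0"
      "\<And>x. x \<in> sphere 0 1 \<Longrightarrow> norm (f x - p0 x) < norm (h x0)"
    by auto
  define p where "p = (\<lambda>x. (1/2) *\<^sub>R (p0 x + p0 (- x)))"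
  have close: "norm (f x - p x) < norm (h x0)" if x: "x \<in> sphere 0 1" for x
  proof -
    have "f x - p x = (1/2) *\<^sub>R ((f x - p0 x) + (f (- x) - p0 (- x)))"
      using even[OF x] by (simp add: p_def algebra_simps flip: scaleR_add_left)
    also have "norm \<dots> \<le> (1/2) * (norm (f x - p0 x) + norm (f (- x) - p0 (- x)))"
      by (simp add: norm_triangle_ineq)
    also have "\<dots> < norm (h x0)"
      using p0(2)[OF x] p0(2)[of "- x"] x by simp
    finally show ?thesis .
  qed
  show thesis
  proof (rule that)
    have "polynomial_function (p0 \<circ> uminus)"
      by (intro polynomial_function_compose p0) (rule polynomial_function_minus[OF polynomial_function_id])
    then show "polynomial_function p"
      unfolding p_def using p0(1)
      by (intro polynomial_function_cmul polynomial_function_add) (simp_all add: o_def)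
    show "p (- x) = p x" for x
      by (simp add: p_def add.commute)
    fix x :: 'e and t assume x: "x \<in> sphere 0 1"
    show "p x \<noteq> t *\<^sub>R x"
    proof
      assume "p x = t *\<^sub>R x"
      \<comment> \<open>A multiple of \<open>x\<close> has no orthogonal component, so that of
        \<open>f x\<close> is that of the error, hence no longer than the error.\<close>
      then have "h x = (f x - p x) - ((f x - p x) \<bullet> x) *\<^sub>R x"
        using x by (simp add: h_def inner_diff_left dot_square_norm algebra_simps)
      then have "norm (h x) \<le> norm (f x - p x)"
        using norm_diff_projection_le[of x "f x - p x"] x by simp
      then show False
        using close[OF x] x0(2)[OF x] by simp
    qed
  qed
qed

lemma exists_collinear_even:
  fixes f :: "'e::euclidean_space \<Rightarrow> 'e"
  assumes f: "continuous_on (sphere 0 1) f"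
    and even: "\<And>x. x \<in> sphere 0 1 \<Longrightarrow> f (- x) = f x"
  shows "\<exists>x\<in>sphere 0 1. \<exists>t. f x = t *\<^sub>R x"
proof (cases "DIM('e) = 1")
  \<comment> \<open>On a line any two vectors are collinear; the degree argument covers the
    remaining dimensions.\<close>
  case True
  then obtain b :: 'e where b: "Basis = {b}"
    by (rule card_1_singletonE)
  then have "norm b = 1" using norm_Basis by blast
  moreover have "f b = (f b \<bullet> b) *\<^sub>R b"
    using euclidean_representation[of "f b"] unfolding b by simp
  ultimately show ?thesis by fastforce
next
  case False
  then have dim: "1 < DIM('e)"
    using DIM_positive[where 'a = 'e] by linarith
  show ?thesis
  proof (rule ccontr)
    assume "\<not> ?thesis"
    then have "f x \<noteq> t *\<^sub>R x" if "x \<in> sphere 0 1" for x t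
      using that by blast
    from even_polynomial_approx_sphere[OF f even this]
    obtain p :: "'e \<Rightarrow> 'e" where p: "polynomial_function p" and p_even: "\<And>x. p (- x) = p x"
      and ne: "\<And>x t. x \<in> sphere 0 1 \<Longrightarrow> p x \<noteq> t *\<^sub>R x"
      by metis
    have p0: "p x \<noteq> 0" if "x \<in> sphere 0 1" for x
      using ne[OF that, of 0] by simp
    have cont_p: "continuous_on X p" for X
      by (rule continuous_on_polymonial_function[OF p])
    define g where "g = sgn \<circ> p"
    have cont_g: "continuous_on (sphere 0 1) g"
      unfolding g_def o_def by (intro continuous_on_sgn cont_p) (use p0 in auto)
    have g1: "norm (g x) = 1" if "x \<in> sphere 0 1" for x
      using p0[OF that] by (simp add: g_def norm_sgn)
    obtain e :: 'e where e: "e \<in> Basis"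
      and no: "\<And>(f :: 'e \<Rightarrow> 'e) d a. (\<And>x. f (- x) = f x) \<Longrightarrow> 0 < d \<Longrightarrow> a \<in> sphere 0 1 \<Longrightarrow>
         (\<And>x. x \<in> sphere 0 1 \<Longrightarrow> \<bar>x \<bullet> e\<bar> < d \<Longrightarrow> f x = a) \<Longrightarrow>
         \<not> homotopic_with_canon (\<lambda>_. True) (sphere 0 1) (sphere 0 1) id f"
      using even_map_not_homotopic_id_sphere[OF dim] by metis
    obtain q0 where q0: "q0 \<in> sphere 0 1"
      "\<And>x. x \<in> sphere 0 1 \<Longrightarrow> x \<bullet> e = 0 \<Longrightarrow> sgn (p x) \<noteq> q0"
      using sphere_not_subset_sgn_image_hyperplane[OF e differentiable_at_polynomial_function[OF p] p0] by metis
    \<comment> \<open>The equator avoids \<open>q0 = - q\<close>, which is exactly the point that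
      cannot be pushed to \<open>q\<close>.\<close>
    define q where "q = - q0"
    have q: "norm q = 1" using q0 by (simp add: q_def)
    have gq: "- 1 < g x \<bullet> q" if x: "x \<in> sphere 0 1" "x \<bullet> e = 0" for x
    proof -
      have "- 1 \<le> g x \<bullet> q"
        using Cauchy_Schwarz_ineq2[of "g x" q] g1[OF x(1)] q by (simp add: abs_le_iff)
      moreover have "g x \<bullet> q \<noteq> - 1"
      proof
        assume "g x \<bullet> q = - 1"
        then have "g x \<bullet> q0 = norm (g x) * norm q0"
          using g1[OF x(1)] q0(1) by (simp add: q_def)
        then have "g x = q0"
          using norm_cauchy_schwarz_eq[of "g x" q0] g1[OF x(1)] q0(1) by simp
        then show False using q0(2)[OF x] by (simp add: g_def)
      qed
      ultimately show ?thesis by simp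
    qed
    let ?K = "sphere 0 1 \<inter> {x. x \<bullet> e = 0}"
    have "compact ?K"
      by (intro compact_Int_closed compact_sphere closed_Collect_eq continuous_intros)
    have cgq: "continuous_on (sphere 0 1) (\<lambda>x. g x \<bullet> q)"
      by (intro continuous_intros cont_g)
    \<comment> \<open>By compactness \<open>g x \<bullet> q\<close> has a minimum above -1 on the
      equator; \<open>c0\<close> is halfway between -1 and this minimum, so the equator lies
      strictly in the part that gets pushed to \<open>q\<close>.\<close>
    obtain c0 where c0: "- 1 < c0" "c0 < 1" "\<And>x. x \<in> ?K \<Longrightarrow> c0 < g x \<bullet> q"
    proof (cases "?K = {}")
      case True
      then show thesis using that[of 0] by auto
    next
      case False
      have "continuous_on ?K (\<lambda>x. g x \<bullet> q)"
        by (rule continuous_on_subset[OF cgq]) auto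
      then obtain x1 where x1: "x1 \<in> ?K" "\<And>x. x \<in> ?K \<Longrightarrow> g x1 \<bullet> q \<le> g x \<bullet> q"
        using continuous_attains_inf[OF \<open>compact ?K\<close> False] by blast
      have "- 1 < g x1 \<bullet> q" using gq x1(1) by blast
      moreover have "g x1 \<bullet> q \<le> 1"
        using Cauchy_Schwarz_ineq2[of "g x1" q] g1[of x1] x1(1) q by simp
      ultimately show thesis
        using x1(2) by (intro that[of "(g x1 \<bullet> q - 1) / 2"]) (auto, fastforce)
    qed
    let ?C = "sphere 0 1 \<inter> {x. g x \<bullet> q \<le> c0}"
    have "closedin (top_of_set (sphere 0 1)) (sphere 0 1 \<inter> (\<lambda>x. g x \<bullet> q) -` {..c0})"
      by (rule continuous_closedin_preimage[OF cgq]) auto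
    then have "compact ?C"
      by (intro closedin_compact[OF compact_sphere]) (simp add: vimage_def)
    \<comment> \<open>The points of \<open>?C\<close> are those not pushed to \<open>q\<close>. They
      form a compact set disjoint from the equator, so a whole band of width \<open>d\<close> around
      the equator misses it.\<close>
    obtain d where d: "0 < d" "\<And>x. x \<in> ?C \<Longrightarrow> d \<le> \<bar>x \<bullet> e\<bar>"
    proof (cases "?C = {}")
      case True
      then show thesis using that[of 1] by auto
    next
      case False
      have "continuous_on ?C (\<lambda>x. \<bar>x \<bullet> e\<bar>)"
        by (intro continuous_intros)
      then obtain x1 where x1: "x1 \<in> ?C" "\<And>x. x \<in> ?C \<Longrightarrow> \<bar>x1 \<bullet> e\<bar> \<le> \<bar>x \<bullet> e\<bar>"
        using continuous_attains_inf[OF \<open>compact ?C\<close> False] by blast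
      have "x1 \<bullet> e \<noteq> 0" using c0(3)[of x1] x1(1) by auto
      then show thesis using x1(2) that[of "\<bar>x1 \<bullet> e\<bar>"] by auto
    qed
    define c1 where "c1 = (c0 - 1) / 2"
    have c1: "- 1 < c1" "c1 < c0" using c0 by (auto simp: c1_def)
    define w where
      "w = (\<lambda>x. max 0 (c0 - g x \<bullet> q) *\<^sub>R (g x - (g x \<bullet> q) *\<^sub>R q) + (g x \<bullet> q - c1) *\<^sub>R q)"
    have "homotopic_with_canon (\<lambda>_. True) (sphere 0 1) (sphere 0 1) (sgn \<circ> (\<lambda>x. 1 *\<^sub>R x)) (sgn \<circ> p)"
    proof (rule homotopic_sgn_compose)
      show "0 \<notin> closed_segment (1 *\<^sub>R x) (p x)" if "x \<in> sphere 0 1" for x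
        by (rule zero_notin_closed_segment_scaleR) (use ne[OF that] that in auto)
    qed (auto intro!: continuous_intros cont_p)
    then have h1: "homotopic_with_canon (\<lambda>_. True) (sphere 0 1) (sphere 0 1) id g"
      by (rule homotopic_with_eq) (auto simp: sgn_div_norm g_def)
    have "homotopic_with_canon (\<lambda>_. True) (sphere 0 1) (sphere 0 1) (sgn \<circ> g) (sgn \<circ> w)"
      unfolding w_def
      using c0 c1 g1 by (intro push_to_point_homotopic q cont_g) auto
    then have h2: "homotopic_with_canon (\<lambda>_. True) (sphere 0 1) (sphere 0 1) g (sgn \<circ> w)"
      by (rule homotopic_with_eq) (auto simp: sgn_div_norm g1)
    have "\<not> homotopic_with_canon (\<lambda>_. True) (sphere 0 1) (sphere 0 1) id (sgn \<circ> w)"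
    proof (rule no)
      show "(sgn \<circ> w) (- x) = (sgn \<circ> w) x" for x
        by (simp add: w_def g_def p_even)
      show "q \<in> sphere 0 1" using q by simp
      fix x assume x: "x \<in> sphere 0 1" "\<bar>x \<bullet> e\<bar> < d"
      then have "c0 < g x \<bullet> q" using d(2)[of x] by fastforce
      then have "w x = (g x \<bullet> q - c1) *\<^sub>R q" "0 < g x \<bullet> q - c1"
        using c1 by (auto simp: w_def)
      then show "(sgn \<circ> w) x = q"
        using q by (simp add: sgn_scaleR) (simp add: sgn_div_norm)
    qed (rule d)
    then show False
      using homotopic_with_trans[OF h1 h2] by blast
  qed
qed

section \<open>Functions of class \<open>C\<^sup>k\<close>\<close>

lemma Ck_on_SucI:
  assumes "\<And>x. x \<in> S \<Longrightarrow> (f has_derivative f' x) (at x)"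
    and "\<And>v. Ck_on k S (\<lambda>x. frechet_derivative f (at x) v)"
  shows "Ck_on (Suc k) S f"
  using assms by (auto simp: differentiable_on_def differentiable_def intro: has_derivative_at_withinI)

text \<open>On an open set, agreement on \<open>S\<close> passes to the two-sided derivatives, hence
  inductively to all of them.\<close>

lemma Ck_on_cong:
  assumes "open S" "\<And>x. x \<in> S \<Longrightarrow> f x = g x"
  shows "Ck_on k S f \<longleftrightarrow> Ck_on k S g"
proof -
  have *: "Ck_on k S f \<Longrightarrow> (\<And>x. x \<in> S \<Longrightarrow> f x = g x) \<Longrightarrow> Ck_on k S g" for f g :: "'a \<Rightarrow> 'b"
  proof (induction k arbitrary: f g)
    case 0
    then show ?case using continuous_on_cong[of S S f g] by simp
  next
    case (Suc k)
    have d: "(f has_derivative frechet_derivative f (at x)) (at x)" if "x \<in> S" for x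
      using Suc.prems(1) that differentiable_on_eq_differentiable_at[OF assms(1), of f]
      by (simp flip: frechet_derivative_works)
    then have g: "(g has_derivative frechet_derivative f (at x)) (at x)" if "x \<in> S" for x
      using that assms(1) Suc.prems(2) by (metis has_derivative_transform_within_open)
    then have "frechet_derivative g (at x) = frechet_derivative f (at x)" if "x \<in> S" for x
      using that frechet_derivative_at by metis
    then have "Ck_on k S (\<lambda>x. frechet_derivative g (at x) v)" for v
      using Suc.prems(1) by (rule_tac Suc.IH[of "\<lambda>x. frechet_derivative f (at x) v"]) auto
    with g show ?case
      by (rule Ck_on_SucI)
  qed
  show ?thesis
    using *[of f g] *[of g f] assms(2) by auto
qed

lemma Ck_on_has_derivative:
  assumes "Ck_on (Suc k) S f" "open S" "x \<in> S"
  shows "(f has_derivative frechet_derivative f (at x)) (at x)"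
  using assms differentiable_on_eq_differentiable_at[OF assms(2), of f]
  by (simp flip: frechet_derivative_works)

text \<open>Allows the induction on \<open>k\<close> to work with any explicit formula for the
  derivative in place of \<open>frechet_derivative\<close>.\<close>

lemma Ck_on_Suc_intro:
  assumes "open S" "\<And>x. x \<in> S \<Longrightarrow> (f has_derivative f' x) (at x)"
    and "\<And>v. Ck_on k S (\<lambda>x. f' x v)"
  shows "Ck_on (Suc k) S f"
proof (rule Ck_on_SucI[OF assms(2)])
  fix v
  have "frechet_derivative f (at x) v = f' x v" if "x \<in> S" for x
    using assms(2)[OF that] frechet_derivative_at by metis
  then show "Ck_on k S (\<lambda>x. frechet_derivative f (at x) v)"
    using Ck_on_cong[OF assms(1), of "\<lambda>x. frechet_derivative f (at x) v" "\<lambda>x. f' x v"] assms(3) by simp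
qed

lemma Ck_on_continuous: "Ck_on k S f \<Longrightarrow> continuous_on S f"
  by (cases k) (auto intro: differentiable_imp_continuous_on)

lemma Ck_on_Suc_imp: "Ck_on (Suc k) S f \<Longrightarrow> Ck_on k S f"
proof (induction k arbitrary: f)
  case 0
  then show ?case using Ck_on_continuous[of 1 S f] by simp
next
  case (Suc k)
  from Suc.prems have "f differentiable_on S" "\<And>v. Ck_on k S (\<lambda>x. frechet_derivative f (at x) v)"
    by (auto intro: Suc.IH)
  then show ?case by simp
qed

lemma Ck_on_const: "Ck_on k S (\<lambda>x. c)"
proof (induction k arbitrary: c)
  case (Suc k)
  show ?case
    by (rule Ck_on_SucI[where f' = "\<lambda>x v. 0"]) (auto simp: Suc)
qed simp

lemma Ck_on_add:
  assumes "open S" "Ck_on k S f" "Ck_on k S g"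
  shows "Ck_on k S (\<lambda>x. f x + g x)"
  using assms(2,3)
proof (induction k arbitrary: f g)
  case (Suc k)
  show ?case
  proof (rule Ck_on_Suc_intro[OF assms(1)])
    show "((\<lambda>x. f x + g x) has_derivative
        (\<lambda>v. frechet_derivative f (at x) v + frechet_derivative g (at x) v)) (at x)" if "x \<in> S" for x
      using that Suc.prems by (intro has_derivative_add Ck_on_has_derivative[OF _ assms(1)])
  qed (use Suc in simp)
qed (auto intro: continuous_intros)

lemma Ck_on_sum:
  assumes "open S" "\<And>i. i \<in> I \<Longrightarrow> Ck_on k S (f i)"
  shows "Ck_on k S (\<lambda>x. \<Sum>i\<in>I. f i x)"
  using assms(2)
  by (induction I rule: infinite_finite_induct) (auto intro: Ck_on_const Ck_on_add assms(1))

lemma Ck_on_bounded_linear: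
  assumes "open S" "bounded_linear h" "Ck_on k S f"
  shows "Ck_on k S (\<lambda>x. h (f x))"
  using assms(3)
proof (induction k arbitrary: f)
  case 0
  then show ?case using assms(2) by (simp add: linear_continuous_on_compose bounded_linear.continuous_on)
next
  case (Suc k)
  show ?case
  proof (rule Ck_on_Suc_intro[OF assms(1)])
    show "((\<lambda>x. h (f x)) has_derivative (\<lambda>v. h (frechet_derivative f (at x) v))) (at x)" if "x \<in> S" for x
      using that Suc.prems by (intro bounded_linear.has_derivative[OF assms(2)] Ck_on_has_derivative[OF _ assms(1)])
  qed (use Suc in simp)
qed

lemma Ck_on_scaleR:
  fixes f :: "'a::euclidean_space \<Rightarrow> 'b::euclidean_space"
  assumes "open S" "Ck_on k S r" "Ck_on k S f"
  shows "Ck_on k S (\<lambda>x. r x *\<^sub>R f x)"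
  using assms(2,3)
proof (induction k arbitrary: r f)
  case (Suc k)
  show ?case
  proof (rule Ck_on_Suc_intro[OF assms(1)])
    show "((\<lambda>x. r x *\<^sub>R f x) has_derivative
       (\<lambda>v. r x *\<^sub>R frechet_derivative f (at x) v + frechet_derivative r (at x) v *\<^sub>R f x)) (at x)"
      if "x \<in> S" for x
      using that Suc.prems by (intro has_derivative_scaleR Ck_on_has_derivative[OF _ assms(1)])
    show "Ck_on k S (\<lambda>x. r x *\<^sub>R frechet_derivative f (at x) v + frechet_derivative r (at x) v *\<^sub>R f x)" for v
      using Suc.prems by (intro Ck_on_add assms Suc.IH Ck_on_Suc_imp[of k S f] Ck_on_Suc_imp[of k S r]) auto
  qed
qed (auto intro: continuous_intros)

text \<open>The derivative g'(f x) (f' x v) depends on \<open>x\<close> in two places. Expanding f'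
  x v in the basis separates them: the induction hypothesis applies to g' in a fixed direction
  \<open>b\<close>, composed with the same \<open>f\<close>, and the coefficients are scalar
  factors.\<close>

lemma Ck_on_compose:
  fixes f :: "'a::euclidean_space \<Rightarrow> 'b::euclidean_space" and g :: "'b \<Rightarrow> 'c::euclidean_space"
  assumes "open S" "open T" "Ck_on k S f" "Ck_on k T g" "f ` S \<subseteq> T"
  shows "Ck_on k S (\<lambda>x. g (f x))"
  using assms(3,4)
proof (induction k arbitrary: g)
  case 0
  then show ?case using assms(5) by (auto intro: continuous_on_compose2)
next
  case (Suc k)
  let ?f' = "\<lambda>x. frechet_derivative f (at x)" and ?g' = "\<lambda>y. frechet_derivative g (at y)"
  have g': "(g has_derivative ?g' (f x)) (at (f x))" if "x \<in> S" for x
    using that assms(5) by (intro Ck_on_has_derivative[OF Suc.prems(2) assms(2)]) auto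
  show ?case
  proof (rule Ck_on_Suc_intro[OF assms(1)])
    fix x assume x: "x \<in> S"
    have "(g \<circ> f has_derivative ?g' (f x) \<circ> ?f' x) (at x)"
      using x by (intro diff_chain_at g' Ck_on_has_derivative[OF Suc.prems(1) assms(1)])
    moreover have "?g' (f x) (?f' x v) = (\<Sum>b\<in>Basis. (?f' x v \<bullet> b) *\<^sub>R ?g' (f x) b)" for v
    proof -
      have "linear (?g' (f x))"
        using g'[OF x] has_derivative_linear by blast
      then have "?g' (f x) (\<Sum>b\<in>Basis. (?f' x v \<bullet> b) *\<^sub>R b) = (\<Sum>b\<in>Basis. (?f' x v \<bullet> b) *\<^sub>R ?g' (f x) b)"
        by (simp add: linear_sum linear_scale)
      then show ?thesis by (simp add: euclidean_representation)
    qed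
    ultimately show "((\<lambda>x. g (f x)) has_derivative (\<lambda>v. \<Sum>b\<in>Basis. (?f' x v \<bullet> b) *\<^sub>R ?g' (f x) b)) (at x)"
      by (simp add: o_def)
  next
    fix v
    have f: "Ck_on k S f" and f': "Ck_on k S (\<lambda>x. ?f' x v)"
      using Suc.prems(1) Ck_on_Suc_imp by auto
    have "Ck_on k S (\<lambda>x. ?g' (f x) b)" for b
      using Suc.prems(2) by (intro Suc.IH f) auto
    then show "Ck_on k S (\<lambda>x. \<Sum>b\<in>Basis. (?f' x v \<bullet> b) *\<^sub>R ?g' (f x) b)"
      by (intro Ck_on_sum Ck_on_scaleR assms(1)
          Ck_on_bounded_linear[OF assms(1) bounded_linear_inner_left f'])
  qed
qed

lemma Ck_on_Pair:
  fixes f :: "'a::euclidean_space \<Rightarrow> 'b::euclidean_space" and g :: "'a \<Rightarrow> 'c::euclidean_space"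
  assumes "open S" "Ck_on k S f" "Ck_on k S g"
  shows "Ck_on k S (\<lambda>x. (f x, g x))"
proof -
  have "bounded_linear (\<lambda>a::'b. (a, 0::'c))" "bounded_linear (\<lambda>b::'c. (0::'b, b))"
    by (intro bounded_linear_Pair bounded_linear_ident bounded_linear_zero)+
  from Ck_on_add[OF assms(1) Ck_on_bounded_linear[OF assms(1) this(1) assms(2)]
      Ck_on_bounded_linear[OF assms(1) this(2) assms(3)]]
  show ?thesis by simp
qed

lemma Ck_on_ident: "Ck_on k S (\<lambda>x. x)"
proof (cases k)
  case (Suc j)
  have "Ck_on (Suc j) S (\<lambda>x. x)"
    by (rule Ck_on_SucI[where f' = "\<lambda>x v. v"]) (auto simp: frechet_derivative_ident Ck_on_const)
  then show ?thesis using Suc by simp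
qed simp

lemma smooth_on_cong: "open S \<Longrightarrow> (\<And>x. x \<in> S \<Longrightarrow> f x = g x) \<Longrightarrow> smooth_on S f \<longleftrightarrow> smooth_on S g"
  using Ck_on_cong[of S f g] by (simp add: smooth_on_def)

lemma smooth_on_continuous: "smooth_on S f \<Longrightarrow> continuous_on S f"
  by (auto simp: smooth_on_def intro: Ck_on_continuous)

lemma smooth_on_has_derivative:
  assumes "smooth_on S f" "open S" "x \<in> S"
  shows "(f has_derivative frechet_derivative f (at x)) (at x)"
  using assms by (auto simp: smooth_on_def simp del: Ck_on.simps intro: Ck_on_has_derivative[of 0])

lemma smooth_on_derivative: "smooth_on S f \<Longrightarrow> smooth_on S (\<lambda>x. frechet_derivative f (at x) v)"
  unfolding smooth_on_def using Ck_on.simps(2) by blast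

lemma smooth_on_const: "smooth_on S (\<lambda>x. c)"
  and smooth_on_ident: "smooth_on S (\<lambda>x. x)"
  by (auto simp: smooth_on_def Ck_on_const Ck_on_ident)

lemma smooth_on_compose:
  "open S \<Longrightarrow> open T \<Longrightarrow> smooth_on S f \<Longrightarrow> smooth_on T g \<Longrightarrow> f ` S \<subseteq> T \<Longrightarrow> smooth_on S (\<lambda>x. g (f x))"
  unfolding smooth_on_def by (blast intro: Ck_on_compose)

lemma smooth_on_Pair:
  "open S \<Longrightarrow> smooth_on S f \<Longrightarrow> smooth_on S g \<Longrightarrow> smooth_on S (\<lambda>x. (f x, g x))"
  unfolding smooth_on_def by (blast intro: Ck_on_Pair)

section \<open>Ordinary differential equations\<close>

text \<open>Smoothness gives continuity of the derivative in each fixed direction only. On a compact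
  ball this bounds the derivative on every basis vector, and the sum of these bounds controls the
  operator norm.\<close>

lemma smooth_on_locally_lipschitz:
  fixes X :: "'e::euclidean_space \<Rightarrow> 'f::euclidean_space"
  assumes X: "smooth_on W X" and W: "open W" "x0 \<in> W"
  obtains r K where "0 < r" "0 \<le> K" "cball x0 r \<subseteq> W" "K-lipschitz_on (cball x0 r) X"
proof -
  obtain r where r: "0 < r" "cball x0 r \<subseteq> W"
    using W open_contains_cball by blast
  let ?X' = "\<lambda>x. frechet_derivative X (at x)"
  have "\<exists>B. \<forall>x\<in>cball x0 r. norm (?X' x b) \<le> B" for b
  proof -
    have "continuous_on (cball x0 r) (\<lambda>x. ?X' x b)"
      using continuous_on_subset[OF smooth_on_continuous[OF smooth_on_derivative[OF X]] r(2)] .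
    then have "bounded ((\<lambda>x. ?X' x b) ` cball x0 r)"
      using compact_imp_bounded compact_continuous_image compact_cball by blast
    then show ?thesis by (auto simp: bounded_iff)
  qed
  then obtain B where B: "\<And>b x. x \<in> cball x0 r \<Longrightarrow> norm (?X' x b) \<le> B b"
    by metis
  have D: "(X has_derivative ?X' x) (at x)" if "x \<in> cball x0 r" for x
    by (rule smooth_on_has_derivative[OF X W(1)]) (use that r in auto)
  have "0 \<le> B b" for b
    using order_trans[OF norm_ge_zero B[of x0 b]] r(1) by simp
  define K where "K = (\<Sum>b\<in>Basis. B b)"
  have K: "0 \<le> K" unfolding K_def by (rule sum_nonneg) (rule \<open>0 \<le> B _\<close>)
  have on: "onorm (?X' x) \<le> K" if x: "x \<in> cball x0 r" for x
  proof (rule onorm_le)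
    fix v
    have lin: "linear (?X' x)"
      using D[OF x] has_derivative_linear by blast
    have "?X' x v = ?X' x (\<Sum>b\<in>Basis. (v \<bullet> b) *\<^sub>R b)"
      by (simp only: euclidean_representation)
    also have "\<dots> = (\<Sum>b\<in>Basis. (v \<bullet> b) *\<^sub>R ?X' x b)"
      by (simp only: linear_sum[OF lin] linear_scale[OF lin])
    also have "norm \<dots> \<le> (\<Sum>b\<in>Basis. norm v * B b)"
      by (rule sum_norm_le) (auto intro!: mult_mono Basis_le_norm B[OF x])
    finally show "norm (?X' x v) \<le> K * norm v"
      by (simp add: K_def sum_distrib_left mult.commute)
  qed
  have "K-lipschitz_on (cball x0 r) X"
  proof (rule lipschitz_onI)
    fix x y assume xy: "x \<in> cball x0 r" "y \<in> cball x0 r"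
    have "norm (X x - X y) \<le> K * norm (x - y)"
    proof (rule differentiable_bound[where f' = ?X' and S = "cball x0 r"])
      show "(X has_derivative ?X' x) (at x within cball x0 r)" if "x \<in> cball x0 r" for x
        using D[OF that] by (rule has_derivative_at_withinI)
    qed (use xy on in auto)
    then show "dist (X x) (X y) \<le> K * dist x y"
      by (simp add: dist_norm)
  qed (rule K)
  with r K show thesis by (rule_tac that)
qed

text \<open>Picard iteration on the Banach space of bounded continuous functions on the whole line.
  Projecting to the ball makes the field globally Lipschitz and clamping the time makes the iterates
  bounded, so no invariant subset has to be cut out; only the fixed point is shown to stay in the
  ball, where \<open>Y = X\<close>.\<close>

lemma picard_local_existence:
  fixes X :: "'e::euclidean_space \<Rightarrow> 'e"
  assumes r: "0 < r" and K: "0 \<le> K" and lip: "K-lipschitz_on (cball x0 r) X"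
  obtains e :: real and x where "0 < e" "x 0 = x0"
    "\<And>t. \<bar>t\<bar> < e \<Longrightarrow> x t \<in> cball x0 r"
    "\<And>t. \<bar>t\<bar> < e \<Longrightarrow> (x has_vector_derivative X (x t)) (at t)"
proof -
  have ne: "cball x0 r \<noteq> {}" using r by simp
  define Y where "Y = (\<lambda>x. X (closest_point (cball x0 r) x))"
  have cp: "closest_point (cball x0 r) x \<in> cball x0 r" for x
    by (rule closest_point_in_set[OF closed_cball ne])
  have Y: "dist (Y x) (Y y) \<le> K * dist x y" for x y
    unfolding Y_def
    using lipschitz_onD[OF lip cp cp, of x y]
      mult_left_mono[OF closest_point_lipschitz[OF convex_cball closed_cball ne, of x y] K]
    by linarith
  have contY: "continuous_on S Y" for S
    by (rule lipschitz_on_continuous_on[of K]) (use Y K in \<open>auto intro!: lipschitz_onI\<close>)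
  have "bounded (X ` cball x0 r)"
    by (intro compact_imp_bounded compact_continuous_image lipschitz_on_continuous_on[OF lip] compact_cball)
  then have "\<exists>M0. \<forall>x\<in>cball x0 r. norm (X x) \<le> M0"
    by (simp add: bounded_iff)
  then obtain M0 where M0: "\<And>x. x \<in> cball x0 r \<Longrightarrow> norm (X x) \<le> M0"
    by blast
  define M where "M = max M0 1"
  have M: "norm (Y x) \<le> M" "0 < M" for x
    unfolding Y_def M_def using M0[OF cp[of x]] by auto
  \<comment> \<open>The first bound keeps the fixed point within \<open>r\<close> of
    \<open>x0\<close>, the second makes the operator contract by the factor 1/2. \<open>M\<close> is
    at least 1 and \<open>K + 1\<close> is positive, so both quotients are safe.\<close>
  define e where "e = min (r / (2 * M)) (1 / (4 * (K + 1)))"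
  have e0: "0 < e"
    using r M K by (simp add: e_def)
  have "2 * M * e \<le> 2 * M * (r / (2 * M))"
    unfolding e_def using M by (intro mult_left_mono) auto
  then have eM: "2 * M * e \<le> r" using M by simp
  have "e \<le> 1 / (4 * (K + 1))"
    by (simp add: e_def)
  then have eK: "2 * (K + 1) * e \<le> 1 / 2"
    using K by (simp add: field_simps)
  let ?J = "{- e .. e}"
  \<comment> \<open>Only differences \<open>I u t - I u 0\<close> are used; they are the oriented
    integrals from 0 to \<open>t\<close> for either sign of \<open>t\<close>.\<close>
  define I where "I = (\<lambda>(u :: real \<Rightarrow>\<^sub>C 'e) t. integral {- e .. t} (\<lambda>s. Y (u s)))"
  have cYu: "continuous_on S (\<lambda>s. Y (apply_bcontfun u s))" for u S
    by (rule continuous_on_compose2[OF contY[of UNIV]]) auto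
  have cI: "continuous_on ?J (I u)" for u
    unfolding I_def
    by (rule indefinite_integral_continuous_1) (rule integrable_continuous_real[OF cYu])
  have "\<exists>v :: real \<Rightarrow>\<^sub>C 'e. \<forall>t. v t = x0 + I u (clamp (- e) e t) - I u 0" for u
  proof -
    have "continuous_on (cbox (- e) e) (\<lambda>t. x0 + I u t - I u 0)"
      using cI by (auto intro!: continuous_intros)
    from continuous_on_cbox_bcontfunE[OF this] show ?thesis by metis
  qed
  then obtain P :: "(real \<Rightarrow>\<^sub>C 'e) \<Rightarrow> (real \<Rightarrow>\<^sub>C 'e)"
    where P: "\<And>u t. P u t = x0 + I u (clamp (- e) e t) - I u 0"
    by metis
  have clamp: "clamp (- e) e t \<in> ?J" for t
    using clamp_in_interval[of "- e" e t] e0 by simp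
  have Idiff: "I u t - I u 0 = (if 0 \<le> t then integral {0..t} (\<lambda>s. Y (u s)) else - integral {t..0} (\<lambda>s. Y (u s)))"
    if "t \<in> ?J" for u t
  proof (cases "0 \<le> t")
    case True
    then have "integral {- e..0} (\<lambda>s. Y (u s)) + integral {0..t} (\<lambda>s. Y (u s)) = integral {- e..t} (\<lambda>s. Y (u s))"
      using e0 by (intro Henstock_Kurzweil_Integration.integral_combine integrable_continuous_real cYu) auto
    then show ?thesis using True by (simp add: I_def algebra_simps)
  next
    case False
    then have "integral {- e..t} (\<lambda>s. Y (u s)) + integral {t..0} (\<lambda>s. Y (u s)) = integral {- e..0} (\<lambda>s. Y (u s))"
      using that by (intro Henstock_Kurzweil_Integration.integral_combine integrable_continuous_real cYu) auto
    then show ?thesis using False by (simp add: I_def algebra_simps)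
  qed
  have "dist (P u) (P v) \<le> 1 / 2 * dist u v" for u v
  proof (rule dist_bound)
    fix t
    let ?c = "clamp (- e) e t"
    have bd: "norm (integral {a..b} (\<lambda>s. Y (u s)) - integral {a..b} (\<lambda>s. Y (v s))) \<le> K * dist u v * e"
      if "a \<le> b" "b - a \<le> e" for a b
    proof -
      have "norm (integral {a..b} (\<lambda>s. Y (u s) - Y (v s))) \<le> (K * dist u v) * (b - a)"
      proof (rule integral_bound[OF that(1)])
        fix s
        show "norm (Y (u s) - Y (v s)) \<le> K * dist u v"
          using Y[of "u s" "v s"] mult_left_mono[OF dist_bounded[of u s v] K]
          by (simp add: dist_norm)
      qed (intro continuous_intros cYu)
      also have "\<dots> \<le> K * dist u v * e"
        using that K by (intro mult_left_mono) auto
      finally show ?thesis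
        by (simp add: Henstock_Kurzweil_Integration.integral_diff integrable_continuous_real cYu)
    qed
    have "dist (P u t) (P v t) = norm ((I u ?c - I u 0) - (I v ?c - I v 0))"
      by (simp add: P dist_norm algebra_simps)
    also have "\<dots> \<le> K * dist u v * e"
      using bd[of 0 ?c] bd[of ?c 0] clamp[of t]
      by (auto simp: Idiff[OF clamp] norm_minus_commute)
    also have "\<dots> = (K * e) * dist u v" by simp
    also have "\<dots> \<le> 1 / 2 * dist u v"
      using eK e0 K by (intro mult_right_mono) (auto simp: algebra_simps)
    finally show "dist (P u t) (P v t) \<le> 1 / 2 * dist u v" .
  qed
  then obtain u where u: "P u = u"
    using banach_fix_type[of "1/2" P] by auto
  have ut: "u t = x0 + I u t - I u 0" if "t \<in> ?J" for t
    using P[of u t] u clamp_cancel_cbox[of t "- e" e] that by simp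
  have in_ball: "u t \<in> cball x0 r" if t: "t \<in> ?J" for t
  proof -
    have bd: "norm (integral {a..b} (\<lambda>s. Y (u s))) \<le> M * e" if "a \<le> b" "b - a \<le> e" for a b
    proof -
      have "norm (integral {a..b} (\<lambda>s. Y (u s))) \<le> M * (b - a)"
        by (rule integral_bound[OF that(1) cYu]) (rule M)
      also have "\<dots> \<le> M * e" using that M by (intro mult_left_mono) (auto simp: less_imp_le)
      finally show ?thesis .
    qed
    have "norm (I u t - I u 0) \<le> M * e"
      using bd[of 0 t] bd[of t 0] t by (auto simp: Idiff[OF t])
    also have "\<dots> \<le> r" using eM mult_pos_pos[OF M(2) e0] by linarith
    finally show ?thesis by (simp add: ut[OF t] dist_norm norm_minus_commute)
  qed
  show thesis
  proof (rule that[OF e0, of u])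
    show "u 0 = x0" using ut[of 0] e0 by simp
    fix t assume t: "\<bar>t\<bar> < e"
    then have tJ: "t \<in> ?J" by auto
    show "u t \<in> cball x0 r" by (rule in_ball[OF tJ])
    have "(I u has_vector_derivative Y (u t)) (at t within ?J)"
      unfolding I_def by (rule integral_has_vector_derivative[OF cYu tJ])
    moreover have "at t within ?J = at t"
      by (rule at_within_interior) (use t in \<open>auto simp: interior_atLeastAtMost_real\<close>)
    ultimately have "((\<lambda>t. x0 + I u t - I u 0) has_vector_derivative Y (u t)) (at t)"
      by (auto intro!: derivative_eq_intros)
    moreover have "Y (u t) = X (u t)"
      using in_ball[OF tJ] by (simp add: Y_def closest_point_self)
    ultimately have "((\<lambda>t. x0 + I u t - I u 0) has_vector_derivative X (u t)) (at t)"
      by simp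
    then show "(u has_vector_derivative X (u t)) (at t)"
    proof (rule has_vector_derivative_transform_within_open)
      show "open {- e <..< e}" "t \<in> {- e <..< e}" using t by auto
      show "x0 + I u s - I u 0 = u s" if "s \<in> {- e <..< e}" for s
        using ut[of s] that by simp
    qed
  qed
qed

lemma ode_unique_nonneg:
  fixes x y :: "real \<Rightarrow> 'e::euclidean_space"
  assumes lip: "K-lipschitz_on B X"
    and x: "\<And>t. 0 \<le> t \<Longrightarrow> t < e \<Longrightarrow> x t \<in> B \<and> (x has_vector_derivative X (x t)) (at t)"
    and y: "\<And>t. 0 \<le> t \<Longrightarrow> t < e \<Longrightarrow> y t \<in> B \<and> (y has_vector_derivative X (y t)) (at t)"
    and eq: "x 0 = y 0" and t: "0 \<le> t" "t < e"
  shows "x t = y t"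
proof -
  \<comment> \<open>Gronwall: the squared distance grows at rate at most 2K, and the exponential
    factor absorbs this growth.\<close>
  define u where "u = (\<lambda>t. ((x t - y t) \<bullet> (x t - y t)) * exp (- 2 * K * t))"
  have "u t \<le> u 0"
  proof (rule DERIV_nonpos_imp_nonincreasing[OF t(1)])
    fix s assume s: "0 \<le> s" "s \<le> t"
    then have "s < e" using t by simp
    note xs = x[OF s(1) this] and ys = y[OF s(1) this]
    let ?d = "x s - y s" and ?D = "X (x s) - X (y s)"
    have "((\<lambda>t. x t - y t) has_vector_derivative ?D) (at s)"
      using xs ys by (auto intro!: derivative_eq_intros)
    then have "((\<lambda>t. (x t - y t) \<bullet> (x t - y t)) has_vector_derivative (?d \<bullet> ?D + ?D \<bullet> ?d)) (at s)"
      by (intro bounded_bilinear.has_vector_derivative[OF bounded_bilinear_inner])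
    then have "((\<lambda>t. (x t - y t) \<bullet> (x t - y t)) has_field_derivative 2 * (?D \<bullet> ?d)) (at s)"
      by (simp add: has_real_derivative_iff_has_vector_derivative inner_commute)
    then have "(u has_field_derivative
        (2 * (?D \<bullet> ?d)) * exp (- 2 * K * s) + (?d \<bullet> ?d) * (exp (- 2 * K * s) * (- 2 * K))) (at s)"
      unfolding u_def by (auto intro!: derivative_eq_intros)
    moreover have "?D \<bullet> ?d \<le> K * (?d \<bullet> ?d)"
    proof -
      have "?D \<bullet> ?d \<le> norm ?D * norm ?d" by (rule norm_cauchy_schwarz)
      also have "\<dots> \<le> (K * norm ?d) * norm ?d"
        using lipschitz_onD[OF lip, of "x s" "y s"] xs ys
        by (intro mult_right_mono) (auto simp: dist_norm)
      finally show ?thesis by (simp add: power2_norm_eq_inner[symmetric] power2_eq_square)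
    qed
    then have "(?D \<bullet> ?d) * exp (- 2 * K * s) \<le> (K * (?d \<bullet> ?d)) * exp (- 2 * K * s)"
      by (rule mult_right_mono) simp
    then have "(2 * (?D \<bullet> ?d)) * exp (- 2 * K * s) + (?d \<bullet> ?d) * (exp (- 2 * K * s) * (- 2 * K)) \<le> 0"
      by (simp add: algebra_simps)
    ultimately show "\<exists>z. (u has_real_derivative z) (at s) \<and> z \<le> 0" by blast
  qed
  moreover have "u 0 = 0" by (simp add: u_def eq)
  ultimately have "(x t - y t) \<bullet> (x t - y t) \<le> 0"
    by (simp add: u_def mult_le_0_iff)
  then have "(x t - y t) \<bullet> (x t - y t) = 0"
    by (intro antisym inner_ge_zero)
  then show ?thesis by simp
qed

lemma ode_unique:
  fixes x y :: "real \<Rightarrow> 'e::euclidean_space"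
  assumes lip: "K-lipschitz_on B X"
    and x: "\<And>t. \<bar>t\<bar> < e \<Longrightarrow> x t \<in> B \<and> (x has_vector_derivative X (x t)) (at t)"
    and y: "\<And>t. \<bar>t\<bar> < e \<Longrightarrow> y t \<in> B \<and> (y has_vector_derivative X (y t)) (at t)"
    and eq: "x 0 = y 0" and t: "\<bar>t\<bar> < e"
  shows "x t = y t"
proof (cases "0 \<le> t")
  case True
  show ?thesis
    by (rule ode_unique_nonneg[OF lip, of e x y]) (use x y eq t True in auto)
next
  case False
  have rev: "((\<lambda>s. z (- s)) has_vector_derivative - X (z (- s))) (at s)"
    if "(z has_vector_derivative X (z (- s))) (at (- s))" for z :: "real \<Rightarrow> 'e" and s
  proof -
    have "(uminus has_vector_derivative - 1) (at s)"
      by (auto intro!: derivative_eq_intros)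
    from vector_diff_chain_at[OF this that] show ?thesis
      by (simp add: o_def)
  qed
  have "(\<lambda>s. x (- s)) (- t) = (\<lambda>s. y (- s)) (- t)"
  proof (rule ode_unique_nonneg[where B = B and e = e and K = K and X = "\<lambda>z. - X z"
        and x = "\<lambda>s. x (- s)" and y = "\<lambda>s. y (- s)"])
    show "K-lipschitz_on B (\<lambda>z. - X z)"
      using lip by (simp add: lipschitz_on_def dist_minus)
  qed (use x y eq t False rev in auto)
  then show ?thesis by simp
qed

text \<open>Bootstrapping: if \<open>y\<close> is of class C^k, so is its derivative X(y t), and
  \<open>y\<close> is of class C^(k+1).\<close>

lemma ode_solution_smooth:
  fixes y :: "real \<Rightarrow> 'e::euclidean_space"
  assumes "open \<Omega>" "open W" "smooth_on W X"
    and y: "\<And>t. t \<in> \<Omega> \<Longrightarrow> y t \<in> W \<and> (y has_vector_derivative X (y t)) (at t)"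
  shows "smooth_on \<Omega> y"
  unfolding smooth_on_def
proof
  fix k show "Ck_on k \<Omega> y"
  proof (induction k)
    case 0
    show ?case
      using y by (auto intro!: continuous_at_imp_continuous_on has_vector_derivative_continuous)
  next
    case (Suc k)
    show ?case
    proof (rule Ck_on_Suc_intro[OF assms(1)])
      show "(y has_derivative (\<lambda>h. h *\<^sub>R X (y t))) (at t)" if "t \<in> \<Omega>" for t
        using y[OF that] by (simp add: has_vector_derivative_def)
      have "Ck_on k \<Omega> (\<lambda>t. X (y t))"
        by (rule Ck_on_compose[OF assms(1,2) Suc]) (use assms(3) y in \<open>auto simp: smooth_on_def\<close>)
      then show "Ck_on k \<Omega> (\<lambda>t. v *\<^sub>R X (y t))" for v
        by (rule Ck_on_scaleR[OF assms(1) Ck_on_const])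
    qed
  qed
qed

section \<open>Charts of a Lie group\<close>

abbreviation chart_inv :: "('a, 'e) chart \<Rightarrow> 'e \<Rightarrow> 'a" where
  "chart_inv c \<equiv> inv_into (fst c) (snd c)"

lemma
  assumes "is_chart X c"
  shows is_chart_openin: "openin X (fst c)"
    and is_chart_open: "open (snd c ` fst c)"
    and is_chart_inj: "inj_on (snd c) (fst c)"
    and is_chart_continuous: "continuous_map (subtopology X (fst c)) euclidean (snd c)"
    and is_chart_inv_continuous: "continuous_map (top_of_set (snd c ` fst c)) X (chart_inv c)"
proof -
  show o: "openin X (fst c)" "open (snd c ` fst c)"
    using assms by (auto simp: is_chart_def)
  have ts: "topspace (subtopology X (fst c)) = fst c"
    using openin_subset[OF o(1)] by auto
  have h: "homeomorphic_map (subtopology X (fst c)) (top_of_set (snd c ` fst c)) (snd c)"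
    using assms by (simp add: is_chart_def)
  show inj: "inj_on (snd c) (fst c)"
    using homeomorphic_imp_injective_map[OF h] ts by simp
  show "continuous_map (subtopology X (fst c)) euclidean (snd c)"
    using homeomorphic_imp_continuous_map[OF h] continuous_map_into_fulltopology by blast
  obtain g where g: "homeomorphic_maps (subtopology X (fst c)) (top_of_set (snd c ` fst c)) (snd c) g"
    using h homeomorphic_map_maps by blast
  have "continuous_map (top_of_set (snd c ` fst c)) (subtopology X (fst c)) g"
    using g by (simp add: homeomorphic_maps_def)
  moreover have "g y = chart_inv c y" if "y \<in> topspace (top_of_set (snd c ` fst c))" for y
    using g that inj ts by (auto simp: homeomorphic_maps_def)
  ultimately have "continuous_map (top_of_set (snd c ` fst c)) (subtopology X (fst c)) (chart_inv c)"
    by (rule continuous_map_eq)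
  then show "continuous_map (top_of_set (snd c ` fst c)) X (chart_inv c)"
    using continuous_map_into_fulltopology by blast
qed

lemma open_chart_inv_preimage:
  assumes "is_chart X c" "openin X W"
  shows "open {y \<in> snd c ` fst c. chart_inv c y \<in> W}"
  using openin_continuous_map_preimage[OF is_chart_inv_continuous[OF assms(1)] assms(2)]
    openin_open_eq[OF is_chart_open[OF assms(1)]] by simp

locale lie_group_chart = lie_group G T A
  for G :: "('a, 'm) monoid_scheme" (structure)
    and T and A :: "('a, 'e::euclidean_space) chart set" +
  fixes c :: "('a, 'e) chart"
  assumes c: "c \<in> A" "\<one> \<in> fst c"
begin

lemma chart: "d \<in> A \<Longrightarrow> is_chart T d"
  using manifold by (auto simp: smooth_manifold_def smooth_atlas_def)

lemma chart_subset: "d \<in> A \<Longrightarrow> fst d \<subseteq> carrier G"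
  using openin_subset[OF is_chart_openin[OF chart]] topspace_eq by simp

lemma chart_inv_in: "d \<in> A \<Longrightarrow> y \<in> snd d ` fst d \<Longrightarrow> chart_inv d y \<in> fst d"
  by (rule inv_into_into)

lemma chart_chart_inv: "y \<in> snd d ` fst d \<Longrightarrow> snd d (chart_inv d y) = y"
  by (rule f_inv_into_f)

lemma chart_inv_chart: "d \<in> A \<Longrightarrow> p \<in> fst d \<Longrightarrow> chart_inv d (snd d p) = p"
  by (rule inv_into_f_f[OF is_chart_inj[OF chart]])

lemma continuous_mult: "continuous_map (prod_topology T T) T (\<lambda>(x, y). x \<otimes> y)"
  using smooth_mult by (simp add: smooth_map_def)

lemma continuous_mult':
  assumes "continuous_map X T f" "continuous_map X T g"
  shows "continuous_map X T (\<lambda>x. f x \<otimes> g x)"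
  using continuous_map_compose[OF continuous_map_pairedI[OF assms] continuous_mult] by (simp add: o_def)

lemma continuous_left_mult: "p \<in> carrier G \<Longrightarrow> continuous_map T T (\<lambda>x. p \<otimes> x)"
  by (rule continuous_mult') (auto simp: topspace_eq)

abbreviation E :: 'e where "E \<equiv> snd c \<one>"

definition mult_dom :: "('a, 'e) chart \<Rightarrow> ('a, 'e) chart \<Rightarrow> ('a, 'e) chart \<Rightarrow> ('e \<times> 'e) set" where
  "mult_dom d e f = {(a, b). a \<in> snd d ` fst d \<and> b \<in> snd e ` fst e \<and> chart_inv d a \<otimes> chart_inv e b \<in> fst f}"

definition mult_chart :: "('a, 'e) chart \<Rightarrow> ('a, 'e) chart \<Rightarrow> ('a, 'e) chart \<Rightarrow> 'e \<times> 'e \<Rightarrow> 'e" where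
  "mult_chart d e f = (\<lambda>(a, b). snd f (chart_inv d a \<otimes> chart_inv e b))"

lemma open_mult_dom:
  assumes "d \<in> A" "e \<in> A" "f \<in> A"
  shows "open (mult_dom d e f)"
proof -
  let ?P = "snd d ` fst d \<times> snd e ` fst e"
  have P: "open ?P"
    by (rule open_Times[OF is_chart_open[OF chart[OF assms(1)]] is_chart_open[OF chart[OF assms(2)]]])
  have "continuous_map (top_of_set ?P) (top_of_set (snd d ` fst d)) fst"
    by (auto intro!: continuous_intros)
  from continuous_map_compose[OF this is_chart_inv_continuous[OF chart[OF assms(1)]]]
  have 1: "continuous_map (top_of_set ?P) T (\<lambda>z. chart_inv d (fst z))"
    by (simp add: o_def)
  have "continuous_map (top_of_set ?P) (top_of_set (snd e ` fst e)) snd"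
    by (auto intro!: continuous_intros)
  from continuous_map_compose[OF this is_chart_inv_continuous[OF chart[OF assms(2)]]]
  have 2: "continuous_map (top_of_set ?P) T (\<lambda>z. chart_inv e (snd z))"
    by (simp add: o_def)
  have "open {z \<in> ?P. chart_inv d (fst z) \<otimes> chart_inv e (snd z) \<in> fst f}"
    using openin_continuous_map_preimage[OF continuous_mult'[OF 1 2] is_chart_openin[OF chart[OF assms(3)]]]
      openin_open_eq[OF P] by simp
  also have "{z \<in> ?P. chart_inv d (fst z) \<otimes> chart_inv e (snd z) \<in> fst f} = mult_dom d e f"
    by (auto simp: mult_dom_def)
  finally show ?thesis .
qed

text \<open>The inverse of a product chart is the pair of inverses only on the image of the chart;
  \<open>mult_dom\<close> is an open set on which the two expressions agree.\<close>

lemma smooth_mult_chart: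
  assumes "d \<in> A" "e \<in> A" "f \<in> A"
  shows "smooth_on (mult_dom d e f) (mult_chart d e f)"
proof -
  let ?d = "(fst d \<times> fst e, map_prod (snd d) (snd e))"
  have "?d \<in> prod_atlas A A"
    using assms unfolding prod_atlas_def by blast
  then have s: "smooth_on (snd ?d ` (fst ?d \<inter> (\<lambda>(x, y). x \<otimes> y) -` fst f))
      (snd f \<circ> (\<lambda>(x, y). x \<otimes> y) \<circ> inv_into (fst ?d) (snd ?d))"
    using smooth_mult assms unfolding smooth_map_def by blast
  have inj: "inj_on (map_prod (snd d) (snd e)) (fst d \<times> fst e)"
    using is_chart_inj[OF chart] assms by (intro map_prod_inj_on) auto
  have inv: "inv_into (fst d \<times> fst e) (map_prod (snd d) (snd e)) (a, b) = (chart_inv d a, chart_inv e b)"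
    if "a \<in> snd d ` fst d" "b \<in> snd e ` fst e" for a b
    by (rule inv_into_f_eq[OF inj]) (use that assms in \<open>auto simp: chart_inv_in chart_chart_inv\<close>)
  have dom: "snd ?d ` (fst ?d \<inter> (\<lambda>(x, y). x \<otimes> y) -` fst f) = mult_dom d e f"
  proof (rule equalityI; rule subsetI)
    fix z assume "z \<in> snd ?d ` (fst ?d \<inter> (\<lambda>(x, y). x \<otimes> y) -` fst f)"
    then show "z \<in> mult_dom d e f"
      using assms by (auto simp: mult_dom_def chart_inv_chart)
  next
    fix z assume "z \<in> mult_dom d e f"
    then obtain a b where z: "z = (a, b)" "a \<in> snd d ` fst d" "b \<in> snd e ` fst e"
      "chart_inv d a \<otimes> chart_inv e b \<in> fst f"
      by (auto simp: mult_dom_def)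
    then have "z = snd ?d (chart_inv d a, chart_inv e b)"
      by (simp add: chart_chart_inv)
    moreover have "(chart_inv d a, chart_inv e b) \<in> fst ?d \<inter> (\<lambda>(x, y). x \<otimes> y) -` fst f"
      using z assms by (auto simp: chart_inv_in)
    ultimately show "z \<in> snd ?d ` (fst ?d \<inter> (\<lambda>(x, y). x \<otimes> y) -` fst f)" by blast
  qed
  have "smooth_on (mult_dom d e f) (snd f \<circ> (\<lambda>(x, y). x \<otimes> y) \<circ> inv_into (fst ?d) (snd ?d))"
    using s unfolding dom .
  moreover have "(snd f \<circ> (\<lambda>(x, y). x \<otimes> y) \<circ> inv_into (fst ?d) (snd ?d)) z = mult_chart d e f z"
    if "z \<in> mult_dom d e f" for z
    using that inv by (auto simp: mult_dom_def mult_chart_def)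
  ultimately show ?thesis
    using smooth_on_cong[OF open_mult_dom[OF assms]] by blast
qed

lemma mult_chart_has_derivative:
  assumes "d \<in> A" "e \<in> A" "f \<in> A" "z \<in> mult_dom d e f"
  shows "(mult_chart d e f has_derivative frechet_derivative (mult_chart d e f) (at z)) (at z)"
  by (rule smooth_on_has_derivative[OF smooth_mult_chart open_mult_dom]) (use assms in auto)

text \<open>The left invariant vector field with value \<open>v\<close> (in the chart \<open>c\<close>) at the identity,
  expressed in the chart \<open>d\<close>.\<close>

definition invariant_field :: "'e \<Rightarrow> ('a, 'e) chart \<Rightarrow> 'e \<Rightarrow> 'e" where
  "invariant_field v d y = frechet_derivative (mult_chart d c d) (at (y, E)) (0, v)"

lemma E_in: "E \<in> snd c ` fst c" "chart_inv c E = \<one>"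
  using c chart_inv_chart by auto

lemma mult_dom_one: "d \<in> A \<Longrightarrow> y \<in> snd d ` fst d \<Longrightarrow> (y, E) \<in> mult_dom d c d"
  and mult_chart_one: "d \<in> A \<Longrightarrow> y \<in> snd d ` fst d \<Longrightarrow> mult_chart d c d (y, E) = y"
proof -
  assume d: "d \<in> A" "y \<in> snd d ` fst d"
  then have "chart_inv d y \<in> carrier G"
    using chart_inv_in chart_subset by blast
  then show "(y, E) \<in> mult_dom d c d" "mult_chart d c d (y, E) = y"
    using d E_in by (simp_all add: mult_dom_def mult_chart_def chart_inv_in chart_chart_inv)
qed

lemma smooth_invariant_field:
  assumes d: "d \<in> A"
  shows "smooth_on (snd d ` fst d) (invariant_field v d)"
proof -
  have o: "open (snd d ` fst d)"
    by (rule is_chart_open[OF chart[OF d]])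
  show ?thesis
    unfolding invariant_field_def
    by (rule smooth_on_compose[OF o open_mult_dom[OF d c(1) d]
          smooth_on_Pair[OF o smooth_on_ident smooth_on_const]
          smooth_on_derivative[OF smooth_mult_chart[OF d c(1) d]]])
       (use mult_dom_one[OF d] in auto)
qed

text \<open>Any curve \<kappa> through the identity with velocity \<open>v\<close> computes the
  field, by the chain rule. This freedom allows coordinate lines as well as the one-parameter
  subgroups themselves.\<close>

lemma invariant_field_derivative:
  assumes d: "d \<in> A" and p: "p \<in> fst d" and \<kappa>: "\<kappa> 0 = \<one>"
    and N: "open N" "0 \<in> N" "\<And>h. h \<in> N \<Longrightarrow> \<kappa> h \<in> fst c"
    and v: "((\<lambda>h. snd c (\<kappa> h)) has_vector_derivative v) (at 0)"
  shows "((\<lambda>h. snd d (p \<otimes> \<kappa> h)) has_vector_derivative invariant_field v d (snd d p)) (at 0)"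
proof -
  let ?y = "snd d p"
  have "((\<lambda>h. (?y, snd c (\<kappa> h))) has_vector_derivative (0, v)) (at 0)"
    by (intro has_vector_derivative_Pair has_vector_derivative_const v)
  moreover have "(mult_chart d c d has_derivative frechet_derivative (mult_chart d c d) (at (?y, E))) (at (?y, E))"
    by (rule mult_chart_has_derivative[OF d c(1) d]) (use p d mult_dom_one in auto)
  ultimately have "((\<lambda>h. mult_chart d c d (?y, snd c (\<kappa> h))) has_vector_derivative invariant_field v d ?y) (at 0)"
    unfolding invariant_field_def
    using vector_derivative_diff_chain_within[of "\<lambda>h. (?y, snd c (\<kappa> h))" "(0, v)" 0 UNIV "mult_chart d c d"]
    by (auto simp: o_def \<kappa> intro: has_derivative_at_withinI)
  then show ?thesis
  proof (rule has_vector_derivative_transform_within_open[OF _ N(1,2)])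
    show "mult_chart d c d (?y, snd c (\<kappa> h)) = snd d (p \<otimes> \<kappa> h)" if "h \<in> N" for h
      using N(3)[OF that] d p c by (simp add: mult_chart_def chart_inv_chart)
  qed
qed

text \<open>Left invariance, an infinitesimal form of associativity.\<close>

lemma invariant_field_left_invariant:
  assumes ab: "(a, b) \<in> mult_dom c c c"
  shows "frechet_derivative (mult_chart c c c) (at (a, b)) (0, invariant_field v c b) = invariant_field v c (mult_chart c c c (a, b))"
proof -
  define p where "p = chart_inv c a"
  define q where "q = chart_inv c b"
  \<comment> \<open>A coordinate line serves as a curve with velocity \<open>v\<close>;
    \<open>N1\<close> is the set of times at which it is inside the chart.\<close>
  define \<kappa> where "\<kappa> = (\<lambda>h. chart_inv c (E + h *\<^sub>R v))"
  let ?W = "snd c ` fst c"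
  have W: "open ?W" by (rule is_chart_open[OF chart[OF c(1)]])
  have pq: "p \<in> fst c" "q \<in> fst c" "p \<otimes> q \<in> fst c" "snd c p = a" "snd c q = b"
    using ab c by (auto simp: mult_dom_def p_def q_def chart_inv_in chart_chart_inv)
  then have G: "p \<in> carrier G" "q \<in> carrier G"
    using chart_subset[OF c(1)] by blast+
  define N1 where "N1 = {h. E + h *\<^sub>R v \<in> ?W}"
  have N1: "open N1"
    unfolding N1_def using open_vimage[OF W, of "\<lambda>h::real. E + h *\<^sub>R v"]
    by (simp add: vimage_def continuous_intros)
  have \<kappa>: "\<kappa> 0 = \<one>" "0 \<in> N1" "\<kappa> h \<in> fst c" "snd c (\<kappa> h) = E + h *\<^sub>R v" if "h \<in> N1" for h
    using that E_in c by (auto simp: N1_def \<kappa>_def chart_inv_in chart_chart_inv)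
  have "0 \<in> N1" using E_in by (simp add: N1_def)
  note \<kappa> = \<kappa>(1)[OF this] this \<kappa>(3,4)
  have "((\<lambda>h. E + h *\<^sub>R v) has_vector_derivative v) (at 0)"
    by (auto intro!: derivative_eq_intros)
  then have \<kappa>v: "((\<lambda>h. snd c (\<kappa> h)) has_vector_derivative v) (at 0)"
    by (rule has_vector_derivative_transform_within_open[OF _ N1]) (use \<kappa> in auto)
  note fd = invariant_field_derivative[OF c(1) _ \<kappa>(1) N1 \<kappa>(2,3) \<kappa>v]
  define N2 where "N2 = {h. (b, E + h *\<^sub>R v) \<in> mult_dom c c c}"
  have N2: "open N2"
    unfolding N2_def using open_vimage[OF open_mult_dom[OF c(1) c(1) c(1)], of "\<lambda>h::real. (b, E + h *\<^sub>R v)"]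
    by (simp add: vimage_def continuous_intros)
  have "0 \<in> N2"
    using mult_dom_one[OF c(1), of b] pq by (auto simp: N2_def)
  have N2_in: "h \<in> N1 \<and> q \<otimes> \<kappa> h \<in> fst c" if "h \<in> N2" for h
    using that by (auto simp: N2_def N1_def mult_dom_def q_def \<kappa>_def)
  \<comment> \<open>The curve p q \<kappa>(h) is differentiated in two ways: as \<open>p\<close>
    acting on the curve q \<kappa>(h), and as the translate of \<kappa> by the product p q.\<close>
  have "((\<lambda>h. (a, snd c (q \<otimes> \<kappa> h))) has_vector_derivative (0, invariant_field v c b)) (at 0)"
    using fd[OF pq(2)] pq by (intro has_vector_derivative_Pair has_vector_derivative_const) auto
  moreover have "(mult_chart c c c has_derivative frechet_derivative (mult_chart c c c) (at (a, b))) (at (a, b))"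
    by (rule mult_chart_has_derivative[OF c(1) c(1) c(1) ab])
  ultimately have "((\<lambda>h. mult_chart c c c (a, snd c (q \<otimes> \<kappa> h))) has_vector_derivative
      frechet_derivative (mult_chart c c c) (at (a, b)) (0, invariant_field v c b)) (at 0)"
    using vector_derivative_diff_chain_within[of "\<lambda>h. (a, snd c (q \<otimes> \<kappa> h))" "(0, invariant_field v c b)" 0 UNIV "mult_chart c c c"]
    using pq G by (auto simp: o_def \<kappa>(1) intro: has_derivative_at_withinI)
  then have 1: "((\<lambda>h. snd c ((p \<otimes> q) \<otimes> \<kappa> h)) has_vector_derivative
      frechet_derivative (mult_chart c c c) (at (a, b)) (0, invariant_field v c b)) (at 0)"
  proof (rule has_vector_derivative_transform_within_open[OF _ N2 \<open>0 \<in> N2\<close>])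
    fix h assume "h \<in> N2"
    note h = N2_in[OF this]
    then have "\<kappa> h \<in> carrier G"
      using \<kappa>(3)[of h] chart_subset c by blast
    then show "mult_chart c c c (a, snd c (q \<otimes> \<kappa> h)) = snd c ((p \<otimes> q) \<otimes> \<kappa> h)"
      using h G c by (simp add: mult_chart_def p_def[symmetric] chart_inv_chart m_assoc)
  qed
  have "mult_chart c c c (a, b) = snd c (p \<otimes> q)"
    by (simp add: mult_chart_def p_def q_def)
  then show ?thesis
    using vector_derivative_unique_at[OF 1 fd[OF pq(3)]] by simp
qed

end

section \<open>One-parameter subgroups\<close>

lemma abs_divide_nat_ceiling_less:
  fixes t e :: real
  assumes "0 < e"
  shows "\<bar>t / real (nat \<lceil>\<bar>t\<bar> / e\<rceil> + 1)\<bar> < e"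
proof -
  \<comment> \<open>Adding 1 makes the estimate strict and keeps \<open>n\<close> positive for
    \<open>t = 0\<close>.\<close>
  define n where "n = nat \<lceil>\<bar>t\<bar> / e\<rceil> + 1"
  have "\<bar>t\<bar> / e < real n" "0 < real n"
    unfolding n_def by linarith+
  then have "\<bar>t\<bar> / real n < e"
    using assms by (simp add: pos_divide_less_eq mult.commute)
  then show ?thesis
    by (simp add: n_def)
qed

context lie_group_chart
begin

lemma mult_chart_near_one:
  assumes "0 < r"
  obtains s where "0 < s"
    "\<And>a b. a \<in> ball E s \<Longrightarrow> b \<in> ball E s \<Longrightarrow> (a, b) \<in> mult_dom c c c \<and> mult_chart c c c (a, b) \<in> cball E r"
proof -
  let ?D = "mult_dom c c c"
  have D: "open ?D" by (rule open_mult_dom[OF c(1) c(1) c(1)])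
  have "continuous_on ?D (mult_chart c c c)"
    by (rule smooth_on_continuous[OF smooth_mult_chart[OF c(1) c(1) c(1)]])
  then have o: "open (?D \<inter> mult_chart c c c -` ball E r)"
    by (rule continuous_open_preimage[OF _ D open_ball])
  moreover have "(E, E) \<in> ?D \<inter> mult_chart c c c -` ball E r"
    using mult_dom_one[OF c(1) E_in(1)] mult_chart_one[OF c(1) E_in(1)] assms by simp
  ultimately obtain S S' where S: "open S" "open S'" "(E, E) \<in> S \<times> S'" "S \<times> S' \<subseteq> ?D \<inter> mult_chart c c c -` ball E r"
    by (rule open_prod_elim)
  then have "open (S \<inter> S')" "E \<in> S \<inter> S'" by auto
  then obtain s where s: "0 < s" "ball E s \<subseteq> S \<inter> S'"
    using open_contains_ball by blast
  show thesis
  proof (rule that[OF s(1)])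
    fix a b assume "a \<in> ball E s" "b \<in> ball E s"
    then have "(a, b) \<in> S \<times> S'" using s by blast
    then have "(a, b) \<in> ?D" "mult_chart c c c (a, b) \<in> ball E r" using S(4) by blast+
    then show "(a, b) \<in> ?D \<and> mult_chart c c c (a, b) \<in> cball E r" by auto
  qed
qed

text \<open>Let \<open>x\<close> be the integral curve of the left invariant field through the
  identity. For fixed \<open>s\<close>, both x(s + t) and the product of x(s) and x(t) are integral
  curves in \<open>t\<close> starting at x(s), the latter by left invariance, so uniqueness makes
  \<open>x\<close> a local homomorphism.\<close>

lemma local_hom_exists:
  obtains e :: real and \<gamma> where "0 < e" "\<gamma> 0 = \<one>" "\<And>t. \<bar>t\<bar> < e \<Longrightarrow> \<gamma> t \<in> fst c"
    "\<And>s t. \<bar>s\<bar> < e \<Longrightarrow> \<bar>t\<bar> < e \<Longrightarrow> \<gamma> (s + t) = \<gamma> s \<otimes> \<gamma> t"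
    "((\<lambda>t. snd c (\<gamma> t)) has_vector_derivative v) (at 0)"
proof -
  let ?W = "snd c ` fst c" and ?X = "invariant_field v c"
  have W: "open ?W" by (rule is_chart_open[OF chart[OF c(1)]])
  obtain r K where r: "0 < r" "0 \<le> K" "cball E r \<subseteq> ?W" and lip: "K-lipschitz_on (cball E r) ?X"
    by (rule smooth_on_locally_lipschitz[OF smooth_invariant_field[OF c(1)] W E_in(1)])
  obtain e0 x where e0: "(0::real) < e0" and x0: "x 0 = E"
    and xb: "\<And>t. \<bar>t\<bar> < e0 \<Longrightarrow> x t \<in> cball E r"
    and xd: "\<And>t. \<bar>t\<bar> < e0 \<Longrightarrow> (x has_vector_derivative ?X (x t)) (at t)"
    by (rule picard_local_existence[OF r(1,2) lip]) blast
  obtain r2 where r2: "0 < r2"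
    "\<And>a b. a \<in> ball E r2 \<Longrightarrow> b \<in> ball E r2 \<Longrightarrow> (a, b) \<in> mult_dom c c c \<and> mult_chart c c c (a, b) \<in> cball E r"
    by (rule mult_chart_near_one[OF r(1)]) blast
  have "continuous (at 0) x"
    using xd[of 0] e0 by (auto intro: has_vector_derivative_continuous)
  then obtain d where d: "0 < d" "\<And>t. \<bar>t\<bar> < d \<Longrightarrow> x t \<in> ball E r2"
    using r2(1) x0 unfolding continuous_at_eps_delta by (force simp: dist_commute)
  \<comment> \<open>Half of \<open>e0\<close> keeps \<open>s + t\<close> in the interval of
    existence; \<open>d\<close> keeps x(s) and x(t) so close to \<open>E\<close> that their product
    stays in the ball with the Lipschitz bound.\<close>
  define e where "e = min d (e0 / 2)"
  have e: "0 < e" "\<And>t. \<bar>t\<bar> < e \<Longrightarrow> x t \<in> ball E r2" "\<And>s t. \<bar>s\<bar> < e \<Longrightarrow> \<bar>t\<bar> < e \<Longrightarrow> \<bar>s + t\<bar> < e0"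
    using d e0 by (auto simp: e_def)
  have ee0: "\<bar>t\<bar> < e0" if "\<bar>t\<bar> < e" for t
    using that e0 by (auto simp: e_def)
  define \<gamma> where "\<gamma> = (\<lambda>t. chart_inv c (x t))"
  have xW: "x t \<in> ?W" if "\<bar>t\<bar> < e0" for t
    using xb[OF that] r(3) by blast
  have xsum: "x (s + t) = mult_chart c c c (x s, x t)" if s: "\<bar>s\<bar> < e" and t: "\<bar>t\<bar> < e" for s t
  proof -
    have "(\<lambda>t. x (s + t)) t = (\<lambda>t. mult_chart c c c (x s, x t)) t"
    proof (rule ode_unique[OF lip _ _ _ t])
      fix t assume t: "\<bar>t\<bar> < e"
      have "((\<lambda>t. s + t) has_vector_derivative 1) (at t)"
        by (auto intro!: derivative_eq_intros)
      from vector_diff_chain_at[OF this, of x "?X (x (s + t))"] xd[OF e(3)[OF s t]]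
      show "x (s + t) \<in> cball E r \<and> ((\<lambda>t. x (s + t)) has_vector_derivative ?X (x (s + t))) (at t)"
        using xb[OF e(3)[OF s t]] by (simp add: o_def)
      note D = r2(2)[OF e(2)[OF s] e(2)[OF t]]
      have "((\<lambda>t. (x s, x t)) has_vector_derivative (0, ?X (x t))) (at t)"
        by (intro has_vector_derivative_Pair has_vector_derivative_const xd ee0 t)
      moreover have "(mult_chart c c c has_derivative frechet_derivative (mult_chart c c c) (at (x s, x t))) (at (x s, x t))"
        by (rule mult_chart_has_derivative[OF c(1) c(1) c(1)]) (use D in simp)
      ultimately have "((\<lambda>t. mult_chart c c c (x s, x t)) has_vector_derivative
          frechet_derivative (mult_chart c c c) (at (x s, x t)) (0, ?X (x t))) (at t)"
        using vector_derivative_diff_chain_within[of "\<lambda>t. (x s, x t)" "(0, ?X (x t))" t UNIV "mult_chart c c c"]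
        by (auto simp: o_def intro: has_derivative_at_withinI)
      then show "mult_chart c c c (x s, x t) \<in> cball E r \<and>
          ((\<lambda>t. mult_chart c c c (x s, x t)) has_vector_derivative ?X (mult_chart c c c (x s, x t))) (at t)"
        using D invariant_field_left_invariant[of "x s" "x t" v] by simp
    qed (use x0 mult_chart_one[OF c(1), of "x s"] xW[OF ee0[OF s]] in simp)
    then show ?thesis by simp
  qed
  have \<gamma>in: "\<gamma> t \<in> fst c" "snd c (\<gamma> t) = x t" if "\<bar>t\<bar> < e0" for t
    using xW[OF that] c by (auto simp: \<gamma>_def chart_inv_in chart_chart_inv)
  show thesis
  proof (rule that[OF e(1), of \<gamma>])
    show "\<gamma> 0 = \<one>" by (simp add: \<gamma>_def x0 E_in)
    show "\<gamma> t \<in> fst c" if "\<bar>t\<bar> < e" for t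
      by (rule \<gamma>in(1)[OF ee0[OF that]])
    show "\<gamma> (s + t) = \<gamma> s \<otimes> \<gamma> t" if "\<bar>s\<bar> < e" "\<bar>t\<bar> < e" for s t
    proof -
      have "\<gamma> s \<otimes> \<gamma> t \<in> fst c"
        using r2(2)[OF e(2)[OF that(1)] e(2)[OF that(2)]] by (simp add: mult_dom_def \<gamma>_def)
      then have "chart_inv c (snd c (\<gamma> s \<otimes> \<gamma> t)) = \<gamma> s \<otimes> \<gamma> t"
        by (rule chart_inv_chart[OF c(1)])
      moreover have "snd c (\<gamma> s \<otimes> \<gamma> t) = x (s + t)"
        using xsum[OF that] by (simp add: mult_chart_def \<gamma>_def)
      ultimately show ?thesis by (simp add: \<gamma>_def)
    qed
    \<comment> \<open>Translating by the identity leaves a curve unchanged, so its velocity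
      \<open>v\<close> is the value of the field there.\<close>
    have "invariant_field v c E = v"
    proof -
      define \<kappa> where "\<kappa> = (\<lambda>h. chart_inv c (E + h *\<^sub>R v))"
      define N where "N = {h. E + h *\<^sub>R v \<in> ?W}"
      have N: "open N"
        unfolding N_def using open_vimage[OF W, of "\<lambda>h::real. E + h *\<^sub>R v"]
        by (simp add: vimage_def continuous_intros)
      have 0: "0 \<in> N" using E_in by (simp add: N_def)
      have \<kappa>: "\<kappa> h \<in> fst c" "snd c (\<kappa> h) = E + h *\<^sub>R v" if "h \<in> N" for h
        using that c by (auto simp: N_def \<kappa>_def chart_inv_in chart_chart_inv)
      have "((\<lambda>h. E + h *\<^sub>R v) has_vector_derivative v) (at 0)"
        by (auto intro!: derivative_eq_intros)
      then have \<kappa>v: "((\<lambda>h. snd c (\<kappa> h)) has_vector_derivative v) (at 0)"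
        by (rule has_vector_derivative_transform_within_open[OF _ N 0]) (use \<kappa> in auto)
      have "\<kappa> 0 = \<one>" by (simp add: \<kappa>_def E_in)
      from invariant_field_derivative[OF c(1) c(2) this N 0 \<kappa>(1) \<kappa>v]
      have "((\<lambda>h. snd c (\<one> \<otimes> \<kappa> h)) has_vector_derivative invariant_field v c E) (at 0)" .
      then have "((\<lambda>h. snd c (\<kappa> h)) has_vector_derivative invariant_field v c E) (at 0)"
      proof (rule has_vector_derivative_transform_within_open[OF _ N 0])
        fix h assume "h \<in> N"
        then have "\<kappa> h \<in> carrier G" using \<kappa>(1) chart_subset[OF c(1)] by blast
        then show "snd c (\<one> \<otimes> \<kappa> h) = snd c (\<kappa> h)" by simp
      qed
      from vector_derivative_unique_at[OF this \<kappa>v] show ?thesis .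
    qed
    then have "(x has_vector_derivative v) (at 0)"
      using xd[of 0] e0 x0 by simp
    then show "((\<lambda>t. snd c (\<gamma> t)) has_vector_derivative v) (at 0)"
      by (rule has_vector_derivative_transform_within_open[where S = "{- e0 <..< e0}"])
         (use e0 \<gamma>in in auto)
  qed
qed

text \<open>One-parameter subgroups, with the smoothness reduced to differentiability at \<open>0\<close>.\<close>

definition hom_curve :: "(real \<Rightarrow> 'a) \<Rightarrow> 'e \<Rightarrow> bool" where
  "hom_curve \<gamma> v \<longleftrightarrow> (\<forall>t. \<gamma> t \<in> carrier G) \<and> (\<forall>s t. \<gamma> (s + t) = \<gamma> s \<otimes> \<gamma> t) \<and>
     (\<exists>d>0. \<forall>t. \<bar>t\<bar> < d \<longrightarrow> \<gamma> t \<in> fst c) \<and> ((\<lambda>t. snd c (\<gamma> t)) has_vector_derivative v) (at 0)"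

text \<open>The local homomorphism \<open>g\<close> extends to all times as g(t/n)^n for any
  \<open>n\<close> with |t/n| < e.\<close>

lemma hom_curve_exists: "\<exists>\<gamma>. hom_curve \<gamma> v"
proof -
  obtain e :: real and g where e: "0 < e" and g0: "g 0 = \<one>" and gc: "\<And>t. \<bar>t\<bar> < e \<Longrightarrow> g t \<in> fst c"
    and add: "\<And>s t. \<bar>s\<bar> < e \<Longrightarrow> \<bar>t\<bar> < e \<Longrightarrow> g (s + t) = g s \<otimes> g t"
    and gd: "((\<lambda>t. snd c (g t)) has_vector_derivative v) (at 0)"
    by (rule local_hom_exists) blast
  have gG: "g t \<in> carrier G" if "\<bar>t\<bar> < e" for t
    using gc[OF that] chart_subset[OF c(1)] by blast
  have pow: "g (real n * s) = g s [^] n" if "\<bar>real n * s\<bar> < e" "\<bar>s\<bar> < e" for n s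
    using that(1)
  proof (induction n)
    case 0
    then show ?case by (simp add: g0)
  next
    case (Suc n)
    have "\<bar>real n * s\<bar> \<le> \<bar>real (Suc n) * s\<bar>"
      unfolding abs_mult by (rule mult_right_mono) auto
    then have n: "\<bar>real n * s\<bar> < e" using Suc.prems by simp
    have "g (real (Suc n) * s) = g (real n * s + s)"
      by (simp add: algebra_simps)
    also have "\<dots> = g s [^] n \<otimes> g s"
      using add[OF n that(2)] Suc.IH[OF n] by simp
    finally show ?case by simp
  qed
  define \<gamma> where "\<gamma> = (\<lambda>t. let n = nat \<lceil>\<bar>t\<bar> / e\<rceil> + 1 in g (t / real n) [^] n)"
  have \<gamma>: "\<gamma> t = g (t / real n) [^] n" if n: "0 < n" "\<bar>t / real n\<bar> < e" for t n
  proof -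
    \<comment> \<open>Refining \<open>n\<close> to a multiple changes nothing; two admissible
      numbers are compared through their product.\<close>
    have *: "g (t / real n) [^] n = g (t / real (n * k)) [^] (n * k)"
      if n: "0 < n" "0 < k" "\<bar>t / real n\<bar> < e" for n k :: nat
    proof -
      have t: "real k * (t / real (n * k)) = t / real n" using n by simp
      have "1 \<le> real k" using n(2) by simp
      then have "\<bar>t / real (n * k)\<bar> \<le> real k * \<bar>t / real (n * k)\<bar>"
        using mult_right_mono[of 1 "real k" "\<bar>t / real (n * k)\<bar>"] by simp
      also have "\<dots> = \<bar>real k * (t / real (n * k))\<bar>"
        unfolding abs_mult by simp
      also have "\<dots> = \<bar>t / real n\<bar>"
        unfolding t ..
      finally have s: "\<bar>t / real (n * k)\<bar> < e" using n by simp
      have "g (t / real n) = g (t / real (n * k)) [^] k"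
        using pow[of k "t / real (n * k)"] s n unfolding t by simp
      then show ?thesis
        using gG[OF s] by (simp add: nat_pow_pow mult.commute)
    qed
    define m where "m = nat \<lceil>\<bar>t\<bar> / e\<rceil> + 1"
    have m: "0 < m" "\<bar>t / real m\<bar> < e"
      unfolding m_def by (simp, rule abs_divide_nat_ceiling_less[OF e])
    have "\<gamma> t = g (t / real m) [^] m" by (simp add: \<gamma>_def m_def Let_def)
    also have "\<dots> = g (t / real n) [^] n"
      using *[OF m(1) n(1) m(2)] *[OF n(1) m(1) n(2)] by (simp add: mult.commute)
    finally show ?thesis .
  qed
  have "\<gamma> t \<in> carrier G \<and> \<gamma> (s + t) = \<gamma> s \<otimes> \<gamma> t" for s t
  proof -
    \<comment> \<open>One \<open>n\<close> serves \<open>s\<close>, \<open>t\<close> and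
      \<open>s + t\<close>. The values of \<open>g\<close> at \<open>s / n\<close> and
      \<open>t / n\<close> commute since addition of times does, so the power distributes over their
      product.\<close>
    define n where "n = nat \<lceil>(\<bar>s\<bar> + \<bar>t\<bar>) / e\<rceil> + 1"
    have "(\<bar>s\<bar> + \<bar>t\<bar>) / e < real n" unfolding n_def by linarith
    then have n: "0 < n" and lt: "\<bar>s\<bar> + \<bar>t\<bar> < e * real n"
      using e by (auto simp: n_def field_simps)
    have s: "\<bar>s / real n\<bar> < e" and t: "\<bar>t / real n\<bar> < e" and st: "\<bar>(s + t) / real n\<bar> < e"
      using lt n by (auto simp: field_simps)
    have "g (s / real n) \<otimes> g (t / real n) = g (t / real n) \<otimes> g (s / real n)"
      using add[OF s t] add[OF t s] by (simp add: add.commute)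
    then have "(g (s / real n) \<otimes> g (t / real n)) [^] n = g (s / real n) [^] n \<otimes> g (t / real n) [^] n"
      by (rule pow_mult_distrib[OF _ gG[OF s] gG[OF t]])
    then have "\<gamma> (s + t) = \<gamma> s \<otimes> \<gamma> t"
      using \<gamma>[OF n s] \<gamma>[OF n t] \<gamma>[OF n st] add[OF s t] by (simp add: add_divide_distrib)
    then show ?thesis
      using \<gamma>[OF n t] gG[OF t] by simp
  qed
  moreover have near: "\<gamma> t = g t" if "\<bar>t\<bar> < e" for t
    using \<gamma>[of 1 t] gG[OF that] that by simp
  moreover have "((\<lambda>t. snd c (\<gamma> t)) has_vector_derivative v) (at 0)"
    by (rule has_vector_derivative_transform_within_open[OF gd, of "{- e <..< e}"])
       (use e near in auto)
  ultimately have "hom_curve \<gamma> v"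
    unfolding hom_curve_def using gc e by auto
  then show ?thesis by blast
qed

lemma hom_curve_zero: "hom_curve \<gamma> v \<Longrightarrow> \<gamma> 0 = \<one>"
proof -
  assume h: "hom_curve \<gamma> v"
  then have "\<gamma> 0 \<otimes> \<gamma> 0 = \<gamma> 0" "\<gamma> 0 \<in> carrier G"
    unfolding hom_curve_def by (metis add_0)+
  then show ?thesis using l_cancel_one' by metis
qed

lemma hom_curve_pow:
  assumes "hom_curve \<gamma> v"
  shows "\<gamma> (real n * s) = \<gamma> s [^] n"
proof (induction n)
  case 0
  then show ?case by (simp add: hom_curve_zero[OF assms])
next
  case (Suc n)
  have "\<gamma> (real (Suc n) * s) = \<gamma> (real n * s + s)"
    by (simp add: algebra_simps)
  also have "\<dots> = \<gamma> (real n * s) \<otimes> \<gamma> s"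
    using assms unfolding hom_curve_def by blast
  finally show ?case using Suc by simp
qed

lemma hom_curve_scale:
  assumes h: "hom_curve \<gamma> v"
  shows "hom_curve (\<lambda>s. \<gamma> (r * s)) (r *\<^sub>R v)"
proof -
  obtain d where d: "0 < d" "\<And>t. \<bar>t\<bar> < d \<Longrightarrow> \<gamma> t \<in> fst c"
    using h unfolding hom_curve_def by blast
  have "\<exists>d>0. \<forall>t. \<bar>t\<bar> < d \<longrightarrow> \<gamma> (r * t) \<in> fst c"
  proof (intro exI conjI allI impI)
    show "0 < d / (\<bar>r\<bar> + 1)" using d by simp
    fix t assume "\<bar>t\<bar> < d / (\<bar>r\<bar> + 1)"
    then have "\<bar>t\<bar> * (\<bar>r\<bar> + 1) < d" by (simp add: pos_less_divide_eq)
    then have "\<bar>r * t\<bar> < d" by (simp add: abs_mult algebra_simps)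
    then show "\<gamma> (r * t) \<in> fst c" by (rule d(2))
  qed
  moreover have "((\<lambda>t. snd c (\<gamma> (r * t))) has_vector_derivative r *\<^sub>R v) (at 0)"
  proof -
    have "((\<lambda>t. r * t) has_vector_derivative r) (at 0)"
      by (auto intro!: derivative_eq_intros)
    moreover have "((\<lambda>t. snd c (\<gamma> t)) has_vector_derivative v) (at (r * 0))"
      using h by (simp add: hom_curve_def)
    ultimately show ?thesis
      using vector_diff_chain_at[of "\<lambda>t. r * t" r 0 "\<lambda>t. snd c (\<gamma> t)" v] by (simp add: o_def)
  qed
  ultimately show ?thesis
    using h unfolding hom_curve_def by (simp add: distrib_left)
qed

text \<open>The homomorphism law turns differentiability at 0 into an ODE at every time and in every
  chart.\<close>

lemma hom_curve_derivative:
  assumes h: "hom_curve \<gamma> v" and d: "d \<in> A" and t: "\<gamma> t \<in> fst d"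
  shows "((\<lambda>t. snd d (\<gamma> t)) has_vector_derivative invariant_field v d (snd d (\<gamma> t))) (at t)"
proof -
  obtain \<delta> where \<delta>: "0 < \<delta>" "\<And>t. \<bar>t\<bar> < \<delta> \<Longrightarrow> \<gamma> t \<in> fst c"
    using h unfolding hom_curve_def by blast
  have "((\<lambda>h. snd d (\<gamma> t \<otimes> \<gamma> h)) has_vector_derivative invariant_field v d (snd d (\<gamma> t))) (at 0)"
    by (rule invariant_field_derivative[where \<kappa> = \<gamma> and N = "{- \<delta> <..< \<delta>}", OF d t hom_curve_zero[OF h]])
       (use h \<delta> in \<open>auto simp: hom_curve_def\<close>)
  moreover have "\<gamma> t \<otimes> \<gamma> h = \<gamma> (t + h)" for h
    using h by (simp add: hom_curve_def)
  ultimately have "((\<lambda>h. snd d (\<gamma> (t + h))) has_vector_derivative invariant_field v d (snd d (\<gamma> t))) (at (t - t))"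
    by simp
  moreover have "((\<lambda>s. s - t) has_vector_derivative 1) (at t)"
    by (auto intro!: derivative_eq_intros)
  ultimately show ?thesis
    using vector_diff_chain_at[of "\<lambda>s. s - t" 1 t "\<lambda>h. snd d (\<gamma> (t + h))" "invariant_field v d (snd d (\<gamma> t))"]
    by (simp add: o_def)
qed

text \<open>Near 0 both curves solve the same ODE in the chart; any \<open>t\<close> is a multiple
  of a small time, and powers carry the equality there.\<close>

lemma hom_curve_unique:
  assumes h: "hom_curve \<gamma> v" "hom_curve \<delta> v"
  shows "\<gamma> = \<delta>"
proof
  let ?W = "snd c ` fst c"
  have W: "open ?W" by (rule is_chart_open[OF chart[OF c(1)]])
  obtain r K where r: "0 < r" "0 \<le> K" "cball E r \<subseteq> ?W" and lip: "K-lipschitz_on (cball E r) (invariant_field v c)"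
    by (rule smooth_on_locally_lipschitz[OF smooth_invariant_field[OF c(1)] W E_in(1)])
  have near: "\<exists>e>0. \<forall>t. \<bar>t\<bar> < e \<longrightarrow> \<alpha> t \<in> fst c \<and> snd c (\<alpha> t) \<in> cball E r" if \<alpha>: "hom_curve \<alpha> v" for \<alpha>
  proof -
    obtain d where d: "0 < d" "\<And>t. \<bar>t\<bar> < d \<Longrightarrow> \<alpha> t \<in> fst c"
      using \<alpha> unfolding hom_curve_def by blast
    have "((\<lambda>t. snd c (\<alpha> t)) has_vector_derivative v) (at 0)"
      using \<alpha> by (simp add: hom_curve_def)
    then have "continuous (at 0) (\<lambda>t. snd c (\<alpha> t))"
      by (rule has_vector_derivative_continuous)
    then obtain d' where d': "0 < d'" "\<And>t. \<bar>t\<bar> < d' \<Longrightarrow> dist (snd c (\<alpha> t)) E < r"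
      using r(1) hom_curve_zero[OF \<alpha>] unfolding continuous_at_eps_delta by (force simp: dist_real_def)
    show ?thesis
    proof (intro exI conjI allI impI)
      show "0 < min d d'" using d d' by simp
      fix t assume "\<bar>t\<bar> < min d d'"
      then show "\<alpha> t \<in> fst c" "snd c (\<alpha> t) \<in> cball E r"
        using d(2)[of t] d'(2)[of t] by (auto simp: dist_commute)
    qed
  qed
  obtain e1 e2 where e12: "0 < e1" "\<And>t. \<bar>t\<bar> < e1 \<Longrightarrow> \<gamma> t \<in> fst c \<and> snd c (\<gamma> t) \<in> cball E r"
    "0 < e2" "\<And>t. \<bar>t\<bar> < e2 \<Longrightarrow> \<delta> t \<in> fst c \<and> snd c (\<delta> t) \<in> cball E r"
    using near[OF h(1)] near[OF h(2)] by blast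
  define e where "e = min e1 e2"
  have e: "0 < e" using e12 by (simp add: e_def)
  have eq: "\<gamma> t = \<delta> t" if t: "\<bar>t\<bar> < e" for t
  proof -
    have "(\<lambda>t. snd c (\<gamma> t)) t = (\<lambda>t. snd c (\<delta> t)) t"
    proof (rule ode_unique[OF lip _ _ _ t])
      fix t assume t: "\<bar>t\<bar> < e"
      show "snd c (\<gamma> t) \<in> cball E r \<and>
          ((\<lambda>t. snd c (\<gamma> t)) has_vector_derivative invariant_field v c (snd c (\<gamma> t))) (at t)"
        using e12(2)[of t] t hom_curve_derivative[OF h(1) c(1), of t] by (simp add: e_def)
      show "snd c (\<delta> t) \<in> cball E r \<and>
          ((\<lambda>t. snd c (\<delta> t)) has_vector_derivative invariant_field v c (snd c (\<delta> t))) (at t)"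
        using e12(4)[of t] t hom_curve_derivative[OF h(2) c(1), of t] by (simp add: e_def)
    qed (simp add: hom_curve_zero[OF h(1)] hom_curve_zero[OF h(2)])
    moreover have "\<gamma> t \<in> fst c" "\<delta> t \<in> fst c"
      using e12 t by (auto simp: e_def)
    ultimately show ?thesis
      using is_chart_inj[OF chart[OF c(1)]] by (simp add: inj_on_eq_iff)
  qed
  fix t
  define n where "n = nat \<lceil>\<bar>t\<bar> / e\<rceil> + 1"
  have n: "0 < n" "\<bar>t / real n\<bar> < e"
    unfolding n_def by (simp, rule abs_divide_nat_ceiling_less[OF e])
  show "\<gamma> t = \<delta> t"
    using hom_curve_pow[OF h(1), of n "t / real n"] hom_curve_pow[OF h(2), of n "t / real n"] n
    by (simp add: eq)
qed

text \<open>The chart gives continuity at 0 only. At \<open>t\<close> the open set \<open>W\<close>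
  is pulled back by left multiplication with \<gamma>(t) to a neighborhood of the identity.\<close>

lemma hom_curve_continuous:
  assumes h: "hom_curve \<gamma> v"
  shows "continuous_map euclidean T \<gamma>"
proof -
  have "open {t. \<gamma> t \<in> W}" if W: "openin T W" for W
    unfolding open_dist
  proof (intro ballI)
    fix t assume "t \<in> {t. \<gamma> t \<in> W}"
    then have t: "\<gamma> t \<in> W" by simp
    have \<gamma>t: "\<gamma> t \<in> carrier G" using h by (simp add: hom_curve_def)
    have "openin T {p \<in> topspace T. \<gamma> t \<otimes> p \<in> W}"
      by (rule openin_continuous_map_preimage[OF continuous_left_mult[OF \<gamma>t] W])
    then have "open {y \<in> snd c ` fst c. chart_inv c y \<in> {p \<in> topspace T. \<gamma> t \<otimes> p \<in> W}}" (is "open ?V")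
      by (rule open_chart_inv_preimage[OF chart[OF c(1)]])
    moreover have "E \<in> ?V"
      using E_in t \<gamma>t by (simp add: topspace_eq)
    ultimately obtain r where r: "0 < r" "ball E r \<subseteq> ?V"
      using open_contains_ball by blast
    obtain d where d: "0 < d" "\<And>s. \<bar>s\<bar> < d \<Longrightarrow> \<gamma> s \<in> fst c"
      using h unfolding hom_curve_def by blast
    have "((\<lambda>t. snd c (\<gamma> t)) has_vector_derivative v) (at 0)"
      using h by (simp add: hom_curve_def)
    then have "continuous (at 0) (\<lambda>t. snd c (\<gamma> t))"
      by (rule has_vector_derivative_continuous)
    then obtain d' where d': "0 < d'" "\<And>s. \<bar>s\<bar> < d' \<Longrightarrow> dist (snd c (\<gamma> s)) E < r"
      using r(1) hom_curve_zero[OF h] unfolding continuous_at_eps_delta by (force simp: dist_real_def)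
    show "\<exists>e>0. \<forall>y. dist y t < e \<longrightarrow> y \<in> {t. \<gamma> t \<in> W}"
    proof (intro exI conjI allI impI)
      show "0 < min d d'" using d d' by simp
      fix y assume "dist y t < min d d'"
      then have y: "\<bar>y - t\<bar> < d" "\<bar>y - t\<bar> < d'" by (auto simp: dist_real_def)
      have "snd c (\<gamma> (y - t)) \<in> ball E r"
        using d'(2)[OF y(2)] by (simp add: dist_commute)
      then have "snd c (\<gamma> (y - t)) \<in> ?V"
        using r(2) by blast
      then have "\<gamma> t \<otimes> \<gamma> (y - t) \<in> W"
        using d(2)[OF y(1)] chart_inv_chart[OF c(1)] by simp
      moreover have "\<gamma> (t + (y - t)) = \<gamma> t \<otimes> \<gamma> (y - t)"
        using h unfolding hom_curve_def by blast
      ultimately show "y \<in> {t. \<gamma> t \<in> W}" by simp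
    qed
  qed
  moreover have "\<gamma> t \<in> carrier G" for t
    using h unfolding hom_curve_def by blast
  ultimately show ?thesis
    unfolding continuous_map_def topspace_eq by simp
qed

lemma hom_curve_one_parameter_subgroup:
  assumes h: "hom_curve \<gamma> v"
  shows "one_parameter_subgroup G T A \<gamma>"
proof -
  note cont = hom_curve_continuous[OF h]
  have "smooth_on (\<gamma> -` fst d) (\<lambda>t. snd d (\<gamma> t))" if d: "d \<in> A" for d
  proof (rule ode_solution_smooth)
    show "open (\<gamma> -` fst d)"
      using openin_continuous_map_preimage[OF cont is_chart_openin[OF chart[OF d]]]
      by (simp add: vimage_def)
    show "open (snd d ` fst d)" by (rule is_chart_open[OF chart[OF d]])
    show "smooth_on (snd d ` fst d) (invariant_field v d)" by (rule smooth_invariant_field[OF d])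
    show "snd d (\<gamma> t) \<in> snd d ` fst d \<and>
        ((\<lambda>t. snd d (\<gamma> t)) has_vector_derivative invariant_field v d (snd d (\<gamma> t))) (at t)"
      if "t \<in> \<gamma> -` fst d" for t
      using hom_curve_derivative[OF h d] that by simp
  qed
  moreover have "inv_into UNIV (\<lambda>x::real. x) = (\<lambda>x. x)"
    by (simp add: fun_eq_iff inv_into_f_eq)
  ultimately have "smooth_map euclidean standard_atlas T A \<gamma>"
    unfolding smooth_map_def standard_atlas_def using cont by (simp add: o_def)
  then show ?thesis
    using h by (simp add: one_parameter_subgroup_def hom_curve_def)
qed

text \<open>Brings every competitor in the definite description of \<open>lie_exp\<close> under the
  uniqueness of \<open>hom_curve\<close>.\<close>

lemma one_parameter_subgroup_hom_curve:
  assumes "one_parameter_subgroup G T A \<gamma>"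
  shows "hom_curve \<gamma> (velocity A \<gamma> c)"
proof -
  have cont: "continuous_map euclidean T \<gamma>" and hom: "\<And>s t. \<gamma> (s + t) = \<gamma> s \<otimes> \<gamma> t"
    and sm: "smooth_map euclidean standard_atlas T A \<gamma>"
    using assms by (auto simp: one_parameter_subgroup_def smooth_map_def)
  have G: "\<gamma> t \<in> carrier G" for t
    using cont by (simp add: continuous_map_def topspace_eq Pi_iff)
  have "\<gamma> 0 \<otimes> \<gamma> 0 = \<gamma> 0" using hom[of 0 0] by simp
  then have 0: "\<gamma> 0 = \<one>" using G l_cancel_one' by metis
  have o: "open (\<gamma> -` fst c)"
    using openin_continuous_map_preimage[OF cont is_chart_openin[OF chart[OF c(1)]]]
    by (simp add: vimage_def)
  moreover have "0 \<in> \<gamma> -` fst c" using 0 c by simp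
  ultimately have near: "\<exists>d>0. \<forall>t. \<bar>t\<bar> < d \<longrightarrow> \<gamma> t \<in> fst c"
    unfolding open_dist by (force simp: dist_real_def)
  have "inv_into UNIV (\<lambda>x::real. x) = (\<lambda>x. x)"
    by (simp add: fun_eq_iff inv_into_f_eq)
  then have "smooth_on (\<gamma> -` fst c) (\<lambda>t. snd c (\<gamma> t))"
    using sm c unfolding smooth_map_def standard_atlas_def by (simp add: o_def)
  from smooth_on_has_derivative[OF this o \<open>0 \<in> _\<close>]
  have "(\<lambda>t. snd c (\<gamma> t)) differentiable (at 0)"
    unfolding differentiable_def by blast
  then have "((\<lambda>t. snd c (\<gamma> t)) has_vector_derivative velocity A \<gamma> c) (at 0)"
    using c 0 by (simp add: velocity_def o_def flip: vector_derivative_works)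
  then show ?thesis
    using G hom near by (simp add: hom_curve_def)
qed

text \<open>The inverse of the evaluation at \<open>c\<close>.\<close>

definition lift :: "'e \<Rightarrow> ('a, 'e) chart \<Rightarrow> 'e" where
  "lift w = (\<lambda>d. if d \<in> A \<and> \<one> \<in> fst d then frechet_derivative (transition c d) (at E) w else 0)"

section \<open>Linear identification of the Lie algebra with the model space\<close>

lemma transition_has_derivative:
  assumes "d \<in> A" "e \<in> A" "p \<in> fst d" "p \<in> fst e"
  shows "(transition d e has_derivative frechet_derivative (transition d e) (at (snd d p))) (at (snd d p))"
proof -
  have s: "smooth_on (snd d ` (fst d \<inter> fst e)) (transition d e)"
    using manifold assms by (simp add: smooth_manifold_def smooth_atlas_def)
  have "snd d ` (fst d \<inter> fst e) = {y \<in> snd d ` fst d. chart_inv d y \<in> fst e}"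
    using assms chart_inv_chart[OF assms(1)] by auto
  then have "open (snd d ` (fst d \<inter> fst e))"
    using open_chart_inv_preimage[OF chart[OF assms(1)] is_chart_openin[OF chart[OF assms(2)]]] by simp
  then show ?thesis
    using smooth_on_has_derivative[OF s] assms by simp
qed

lemma transition_compose_near:
  assumes "d \<in> A" "e \<in> A" "\<one> \<in> fst d" "\<one> \<in> fst e"
  obtains N where "open N" "E \<in> N" "\<And>y. y \<in> N \<Longrightarrow> transition d e (transition c d y) = transition c e y"
proof
  let ?N = "{y \<in> snd c ` fst c. chart_inv c y \<in> fst d}"
  show "open ?N"
    by (rule open_chart_inv_preimage[OF chart[OF c(1)] is_chart_openin[OF chart[OF assms(1)]]])
  show "E \<in> ?N" using E_in assms by simp
  show "transition d e (transition c d y) = transition c e y" if "y \<in> ?N" for y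
    using that chart_inv_chart[OF assms(1)] by (simp add: transition_def)
qed

lemma lift_at: "lift w c = w"
proof -
  have "((\<lambda>y. y) has_derivative (\<lambda>v. v)) (at E)"
    by (rule has_derivative_ident)
  then have "(transition c c has_derivative (\<lambda>v. v)) (at E)"
    by (rule has_derivative_transform_within_open[OF _ is_chart_open[OF chart[OF c(1)]] E_in(1)])
       (simp add: transition_def chart_chart_inv)
  then have "frechet_derivative (transition c c) (at E) = (\<lambda>v. v)"
    using frechet_derivative_at by metis
  then show ?thesis using c by (simp add: lift_def)
qed

text \<open>Compatibility over all pairs of charts is the chain rule for the cocycle identity of the
  transition maps near the identity.\<close>

lemma lift_in: "lift w \<in> lie_algebra G A"
proof -
  have "lift w e = frechet_derivative (transition d e) (at (snd d \<one>)) (lift w d)"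
    if de: "d \<in> A" "e \<in> A" "\<one> \<in> fst d" "\<one> \<in> fst e" for d e
  proof -
    obtain N where N: "open N" "E \<in> N" "\<And>y. y \<in> N \<Longrightarrow> transition d e (transition c d y) = transition c e y"
      using transition_compose_near[OF de] by blast
    have "transition c d E = snd d \<one>"
      by (simp add: transition_def E_in)
    then have "(transition d e has_derivative frechet_derivative (transition d e) (at (snd d \<one>))) (at (transition c d E))"
      using transition_has_derivative[OF de] by simp
    from diff_chain_at[OF transition_has_derivative[OF c(1) de(1) c(2) de(3)] this]
    have "((\<lambda>y. transition d e (transition c d y)) has_derivative
        frechet_derivative (transition d e) (at (snd d \<one>)) \<circ> frechet_derivative (transition c d) (at E)) (at E)"
      by (simp add: o_def)
    then have "(transition c e has_derivative
        frechet_derivative (transition d e) (at (snd d \<one>)) \<circ> frechet_derivative (transition c d) (at E)) (at E)"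
      by (rule has_derivative_transform_within_open[OF _ N])
    then have "frechet_derivative (transition c e) (at E) =
        frechet_derivative (transition d e) (at (snd d \<one>)) \<circ> frechet_derivative (transition c d) (at E)"
      using frechet_derivative_at by metis
    then show ?thesis using de by (simp add: lift_def)
  qed
  moreover have "lift w d = 0" if "\<not> (d \<in> A \<and> \<one> \<in> fst d)" for d
    using that by (auto simp: lift_def)
  ultimately show ?thesis
    unfolding lie_algebra_def tangent_space_def by blast
qed

lemma lift_eval:
  assumes "v \<in> lie_algebra G A"
  shows "lift (v c) = v"
proof
  fix d
  show "lift (v c) d = v d"
  proof (cases "d \<in> A \<and> \<one> \<in> fst d")
    case True
    then have "v d = frechet_derivative (transition c d) (at E) (v c)"
      using assms c unfolding lie_algebra_def tangent_space_def by blast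
    then show ?thesis using True by (simp add: lift_def)
  next
    case False
    then have "v d = 0"
      using assms unfolding lie_algebra_def tangent_space_def by blast
    then show ?thesis using False by (auto simp: lift_def)
  qed
qed

lemma lift_eq_iff: "lift x = lift y \<longleftrightarrow> x = y"
  using lift_at by metis

lemma linear_lift_coordinate: "linear (\<lambda>w. lift w d)"
proof (cases "d \<in> A \<and> \<one> \<in> fst d")
  case True
  then have "linear (frechet_derivative (transition c d) (at E))"
    using transition_has_derivative[OF c(1) _ c(2)] has_derivative_linear by blast
  then show ?thesis using True by (simp add: lift_def)
qed (auto simp: lift_def linear_iff)

lemma lift_scaleR: "lift (r *\<^sub>R w) = (\<lambda>i. r *\<^sub>R lift w i)"
  using linear_scale[OF linear_lift_coordinate] by (simp add: fun_eq_iff)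

lemma lift_add: "lift (w + w') = (\<lambda>i. lift w i + lift w' i)"
  using linear_add[OF linear_lift_coordinate] by (simp add: fun_eq_iff)

lemma lift_zero: "lift 0 = (\<lambda>i. 0)"
  using linear_0[OF linear_lift_coordinate] by (simp add: fun_eq_iff)

lemma continuous_on_lift: "continuous_on S lift"
  by (rule continuous_on_coordinatewise_then_product)
     (simp add: linear_continuous_on linear_lift_coordinate flip: linear_conv_bounded_linear)

lemma line_through_lift: "line_through (lift x) = lift ` range (\<lambda>t. t *\<^sub>R x)"
  unfolding line_through_def by (simp add: image_image lift_scaleR)

section \<open>The exponential map\<close>

lemma velocity_hom_curve:
  assumes h: "hom_curve \<gamma> v"
  shows "velocity A \<gamma> = lift v"
proof
  fix d
  have 0: "\<gamma> 0 = \<one>" by (rule hom_curve_zero[OF h])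
  show "velocity A \<gamma> d = lift v d"
  proof (cases "d \<in> A \<and> \<one> \<in> fst d")
    case True
    then have d: "d \<in> A" "\<one> \<in> fst d" by auto
    obtain \<delta> where \<delta>: "0 < \<delta>" "\<And>t. \<bar>t\<bar> < \<delta> \<Longrightarrow> \<gamma> t \<in> fst c"
      using h unfolding hom_curve_def by blast
    have "((\<lambda>t. snd c (\<gamma> t)) has_vector_derivative v) (at 0)"
      using h by (simp add: hom_curve_def)
    moreover have "(transition c d has_derivative frechet_derivative (transition c d) (at E)) (at (snd c (\<gamma> 0)))"
      using transition_has_derivative[OF c(1) d(1) c(2) d(2)] 0 by simp
    ultimately have "((\<lambda>t. transition c d (snd c (\<gamma> t))) has_vector_derivative
        frechet_derivative (transition c d) (at E) v) (at 0)"
      using vector_derivative_diff_chain_within[of "\<lambda>t. snd c (\<gamma> t)" v 0 UNIV "transition c d"]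
      by (auto simp: o_def intro: has_derivative_at_withinI)
    then have "((\<lambda>t. snd d (\<gamma> t)) has_vector_derivative
        frechet_derivative (transition c d) (at E) v) (at 0)"
      by (rule has_vector_derivative_transform_within_open[where S = "{- \<delta> <..< \<delta>}"])
         (use \<delta> chart_inv_chart[OF c(1)] in \<open>auto simp: transition_def\<close>)
    then show ?thesis
      using d 0 by (simp add: velocity_def lift_def o_def vector_derivative_at)
  qed (use 0 in \<open>auto simp: velocity_def lift_def\<close>)
qed

text \<open>This resolves the definite description: the rescaled curve has initial velocity
  \<open>t *\<^sub>R v\<close>, and no other one-parameter subgroup does. Its value at time 1 is
  \<gamma>(t).\<close>

lemma lie_exp_hom_curve:
  assumes h: "hom_curve \<gamma> v"
  shows "lie_exp G T A (lift (t *\<^sub>R v)) = \<gamma> t"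
proof -
  let ?\<delta> = "\<lambda>s. \<gamma> (t * s)"
  have \<delta>: "hom_curve ?\<delta> (t *\<^sub>R v)" by (rule hom_curve_scale[OF h])
  have "(THE \<delta>. one_parameter_subgroup G T A \<delta> \<and> velocity A \<delta> = lift (t *\<^sub>R v)) = ?\<delta>"
  proof (rule the_equality)
    show "one_parameter_subgroup G T A ?\<delta> \<and> velocity A ?\<delta> = lift (t *\<^sub>R v)"
      using hom_curve_one_parameter_subgroup[OF \<delta>] velocity_hom_curve[OF \<delta>] by simp
    fix \<delta>' assume "one_parameter_subgroup G T A \<delta>' \<and> velocity A \<delta>' = lift (t *\<^sub>R v)"
    then have "hom_curve \<delta>' (t *\<^sub>R v)"
      using one_parameter_subgroup_hom_curve[of \<delta>'] by (simp add: lift_at)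
    then show "\<delta>' = ?\<delta>" by (rule hom_curve_unique[OF _ \<delta>])
  qed
  then show ?thesis by (simp add: lie_exp_def)
qed

abbreviation Exp :: "'e \<Rightarrow> 'a" where "Exp w \<equiv> lie_exp G T A (lift w)"

lemma Exp_closed: "Exp w \<in> carrier G"
proof -
  obtain \<gamma> where h: "hom_curve \<gamma> w" using hom_curve_exists by blast
  then show ?thesis
    using lie_exp_hom_curve[OF h, of 1] by (simp add: hom_curve_def)
qed

lemma Exp_mult_Exp_minus: "Exp w \<otimes> Exp (- w) = \<one>"
proof -
  obtain \<gamma> where h: "hom_curve \<gamma> w" using hom_curve_exists by blast
  have "\<gamma> 1 \<otimes> \<gamma> (- 1) = \<gamma> (1 + - 1)"
    using h unfolding hom_curve_def by metis
  then show ?thesis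
    using lie_exp_hom_curve[OF h, of 1] lie_exp_hom_curve[OF h, of "- 1"] hom_curve_zero[OF h] by simp
qed

lemma Exp_pow: "Exp (real n *\<^sub>R w) = Exp w [^] n"
proof -
  obtain \<gamma> where h: "hom_curve \<gamma> w" using hom_curve_exists by blast
  show ?thesis
    using lie_exp_hom_curve[OF h, of "real n"] lie_exp_hom_curve[OF h, of 1]
      hom_curve_pow[OF h, of n 1] by simp
qed

end

section \<open>Kakeya line configurations\<close>

lemma topspace_proj_topology: "topspace (proj_topology V) = proj_space V"
proof
  show "topspace (proj_topology V) \<subseteq> proj_space V"
    unfolding topspace_def by (auto simp: openin_proj_topology)
  have "{v \<in> V - {\<lambda>i. 0}. line_through v \<in> proj_space V} = V - {\<lambda>i. 0}"
    by (auto simp: proj_space_def)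
  then have "openin (proj_topology V) (proj_space V)"
    by (simp add: openin_proj_topology)
  then show "proj_space V \<subseteq> topspace (proj_topology V)"
    by (rule openin_subset)
qed

lemma line_through_scaleR:
  assumes "r \<noteq> 0"
  shows "line_through (\<lambda>i. r *\<^sub>R v i) = line_through v"
proof -
  have "line_through (\<lambda>i. r *\<^sub>R v i) = (\<lambda>t i. t *\<^sub>R v i) ` range (\<lambda>t. t * r)"
    by (simp add: line_through_def image_image)
  also have "range (\<lambda>t. t * r) = UNIV"
    using assms by (auto simp: surj_def intro!: exI[of _ "_ / r"])
  finally show ?thesis by (simp add: line_through_def)
qed

section \<open>Haar measure of open and compact sets\<close>

context lie_group
begin

lemma Hausdorff: "Hausdorff_space T"
  using manifold by (simp add: smooth_manifold_def)

lemma openin_left_translate: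
  assumes g: "g \<in> carrier G" and W: "openin T W"
  shows "openin T (g <# W)"
proof -
  have sub: "W \<subseteq> carrier G" using openin_subset[OF W] topspace_eq by simp
  have cm: "continuous_map (prod_topology T T) T (\<lambda>(x, y). x \<otimes> y)"
    using smooth_mult by (simp add: smooth_map_def)
  have "continuous_map T (prod_topology T T) (\<lambda>x. (inv g, x))"
    using g by (intro continuous_map_pairedI) (auto simp: topspace_eq)
  from continuous_map_compose[OF this cm]
  have "continuous_map T T (\<lambda>x. inv g \<otimes> x)" by (simp add: o_def)
  from openin_continuous_map_preimage[OF this W]
  have "openin T {x \<in> topspace T. inv g \<otimes> x \<in> W}" .
  also have "{x \<in> topspace T. inv g \<otimes> x \<in> W} = g <# W"
  proof (rule equalityI; rule subsetI)
    fix x assume "x \<in> {x \<in> topspace T. inv g \<otimes> x \<in> W}"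
    then have x: "x \<in> carrier G" "inv g \<otimes> x \<in> W" by (auto simp: topspace_eq)
    then have "x = g \<otimes> (inv g \<otimes> x)" using g by (simp flip: m_assoc)
    then show "x \<in> g <# W" using x(2) unfolding l_coset_def by blast
  next
    fix x assume "x \<in> g <# W"
    then obtain w where w: "w \<in> W" "x = g \<otimes> w" unfolding l_coset_def by blast
    then have "w \<in> carrier G" using sub by blast
    then show "x \<in> {x \<in> topspace T. inv g \<otimes> x \<in> W}"
      using w g by (simp add: topspace_eq flip: m_assoc)
  qed
  finally show ?thesis .
qed

lemma openin_sets_haar: "left_haar_measure G T M \<Longrightarrow> openin T W \<Longrightarrow> W \<in> sets M"
  by (auto simp: left_haar_measure_def intro: sigma_sets.Basic)

lemma compactin_sets_haar:
  assumes M: "left_haar_measure G T M" and K: "compactin T K"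
  shows "K \<in> sets M"
proof -
  have "closedin T K" by (rule compactin_imp_closedin[OF Hausdorff K])
  then have K: "topspace T - (topspace T - K) = K" "openin T (topspace T - K)"
    by (auto dest: closedin_subset simp: closedin_def)
  have "topspace T - (topspace T - K) \<in> sigma_sets (topspace T) {U. openin T U}"
    by (rule sigma_sets.Compl, rule sigma_sets.Basic) (use K in simp)
  then show ?thesis using M K by (simp add: left_haar_measure_def)
qed

text \<open>If \<open>W\<close> were null, so would be all its translates. Finitely many of them
  cover a compact set, hence compact sets would be null, and inner regularity on the open set of all
  points would make the total measure 0.\<close>

lemma haar_measure_open_pos:
  assumes M: "left_haar_measure G T M" and W: "openin T W" "\<one> \<in> W"
  shows "0 < emeasure M W"
proof (rule ccontr)
  assume "\<not> 0 < emeasure M W"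
  then have 0: "emeasure M W = 0" by simp
  have tr: "g <# W \<in> null_sets M" if g: "g \<in> carrier G" for g
  proof -
    have "emeasure M (g <# W) = emeasure M W"
      using M g openin_sets_haar[OF M W(1)] unfolding left_haar_measure_def by blast
    then show ?thesis
      using 0 openin_sets_haar[OF M openin_left_translate[OF g W(1)]] by (simp add: null_sets_def)
  qed
  have null: "emeasure M K = 0" if K: "compactin T K" for K
  proof -
    have KG: "K \<subseteq> carrier G" using compactin_subset_topspace[OF K] topspace_eq by simp
    have "K \<subseteq> \<Union> ((\<lambda>g. g <# W) ` carrier G)"
    proof
      fix k assume "k \<in> K"
      then have k: "k \<in> carrier G" using KG by blast
      then have "k \<in> k <# W" using W(2) unfolding l_coset_def by force
      then show "k \<in> \<Union> ((\<lambda>g. g <# W) ` carrier G)" using k by blast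
    qed
    moreover have "openin T U" if "U \<in> (\<lambda>g. g <# W) ` carrier G" for U
      using that openin_left_translate W by auto
    ultimately obtain \<F> where \<F>: "finite \<F>" "\<F> \<subseteq> (\<lambda>g. g <# W) ` carrier G" "K \<subseteq> \<Union>\<F>"
      using compactinD[OF K, of "(\<lambda>g. g <# W) ` carrier G"] by metis
    have "\<Union>\<F> \<in> null_sets M"
      using \<F>(1,2)
    proof (induction \<F> rule: finite_induct)
      case (insert F \<F>)
      then have "F \<in> null_sets M" "\<Union>\<F> \<in> null_sets M" using tr by auto
      then show ?case by (simp add: null_sets.Un)
    qed simp
    then have "K \<in> null_sets M"
      by (rule null_sets_subset) (use \<F>(3) compactin_sets_haar[OF M K] in auto)
    then show ?thesis by (rule null_setsD1)
  qed
  have "emeasure M (topspace T) = (SUP K\<in>{K. compactin T K \<and> K \<subseteq> topspace T}. emeasure M K)"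
    using M openin_topspace unfolding left_haar_measure_def by blast
  also have "\<dots> \<le> 0"
    by (rule SUP_least) (simp add: null)
  finally have "emeasure M (topspace T) \<le> 0" .
  moreover have "space M = topspace T"
    using M unfolding left_haar_measure_def by (elim conjE)
  moreover have "emeasure M (space M) \<noteq> 0"
    using M unfolding left_haar_measure_def by (elim conjE)
  ultimately show False by simp
qed

end

section \<open>Linear and taut configurations over an abstract domain\<close>

context lie_group_chart
begin

text \<open>\<open>P\<close> parametrizes the domain \<open>D\<close> by the Euclidean sphere and
  \<L> gives the direction of each Kakeya line. The topological theorem enters as
  \<open>coll\<close>, which concerns functions factoring through \<open>P\<close>: on projective
  space these are even, on the sphere of an odd-dimensional space arbitrary.\<close>

lemma one_in_space_if_collinear:
  fixes D :: "'d topology" and P :: "'e \<Rightarrow> 'd" and \<L> :: "'d \<Rightarrow> (('a, 'e) chart \<Rightarrow> 'e) set"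
  assumes P: "continuous_map (top_of_set (sphere 0 1)) D P"
    and \<L>: "\<And>x. x \<in> sphere 0 1 \<Longrightarrow> \<L> (P x) = line_through (lift x)"
    and coll: "\<And>f :: 'd \<Rightarrow> 'e. continuous_on (sphere 0 1) (\<lambda>x. f (P x)) \<Longrightarrow> \<exists>x\<in>sphere 0 1. \<exists>t. f (P x) = t *\<^sub>R x"
    and lin: "linear_config G T A D \<sigma>"
  shows "\<one> \<in> (\<Union>d\<in>topspace D. \<sigma> d <# (lie_exp G T A ` \<L> d))"
proof -
  obtain \<mu> where \<mu>: "continuous_map D (lie_algebra_topology G A) \<mu>"
    "\<And>d. d \<in> topspace D \<Longrightarrow> lie_exp G T A (\<mu> d) = \<sigma> d"
    using lin unfolding linear_config_def by blast
  have "continuous_map (top_of_set (sphere 0 1)) euclidean (\<mu> \<circ> P)"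
    using continuous_map_compose[OF P \<mu>(1)]
    unfolding lie_algebra_topology_def by (rule continuous_map_into_fulltopology)
  then have "continuous_on (sphere 0 1) (\<lambda>x. \<mu> (P x))" by (simp add: o_def)
  then have "continuous_on (sphere 0 1) (\<lambda>x. \<mu> (P x) c)"
    by (rule continuous_on_product_then_coordinatewise)
  from coll[OF this] obtain x t where x: "x \<in> sphere 0 1" "\<mu> (P x) c = t *\<^sub>R x" by blast
  have Px: "P x \<in> topspace D"
    using P x(1) by (auto simp: continuous_map_def)
  then have "\<mu> (P x) \<in> lie_algebra G A"
    using \<mu>(1) by (auto simp: continuous_map_def lie_algebra_topology_def)
  then have "\<mu> (P x) = lift (t *\<^sub>R x)"
    using lift_eval x(2) by metis
  then have "\<sigma> (P x) = Exp (t *\<^sub>R x)"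
    using \<mu>(2)[OF Px] by simp
  then have "\<sigma> (P x) \<otimes> Exp (- (t *\<^sub>R x)) = \<one>"
    by (simp add: Exp_mult_Exp_minus)
  moreover have "lift (- (t *\<^sub>R x)) \<in> \<L> (P x)"
    unfolding \<L>[OF x(1)] line_through_lift by (rule imageI) (auto intro!: range_eqI[of _ _ "- t"])
  ultimately have "\<one> \<in> \<sigma> (P x) <# (lie_exp G T A ` \<L> (P x))"
    unfolding l_coset_def by force
  then show ?thesis using Px by blast
qed

lemma continuous_pow:
  assumes "continuous_map X T f"
  shows "continuous_map X T (\<lambda>x. f x [^] (n::nat))"
proof (induction n)
  case 0
  then show ?case by (simp add: topspace_eq)
next
  case (Suc n)
  from continuous_mult'[OF this assms] show ?case by simp
qed

text \<open>Continuity on a ball of radius \<open>r\<close> spreads to the ball of radius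
  \<open>n r\<close>, since exp(x) = exp(x/n)^n and powers are continuous; these balls exhaust the
  space.\<close>

lemma continuous_Exp:
  assumes V: "openin (lie_algebra_topology G A) V" "(\<lambda>d. 0) \<in> V"
    and exp: "continuous_map (subtopology (lie_algebra_topology G A) V) T (lie_exp G T A)"
  shows "continuous_map (top_of_set S) T Exp"
proof -
  have lift: "continuous_map euclidean (lie_algebra_topology G A) lift"
    unfolding lie_algebra_topology_def
    by (simp add: continuous_map_in_subtopology continuous_on_lift lift_in image_subset_iff Pi_iff)
  have "open {x. lift x \<in> V}"
    using openin_continuous_map_preimage[OF lift V(1)] by simp
  moreover have "0 \<in> {x. lift x \<in> V}"
    using V(2) by (simp add: lift_zero)
  ultimately obtain r where r: "0 < r" "ball 0 r \<subseteq> {x. lift x \<in> V}"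
    using open_contains_ball by blast
  have "continuous_map (top_of_set (ball 0 r)) (subtopology (lie_algebra_topology G A) V) lift"
    unfolding continuous_map_in_subtopology
    using continuous_map_from_subtopology[OF lift] r(2) by auto
  from continuous_map_compose[OF this exp]
  have near: "continuous_map (top_of_set (ball 0 r)) T Exp" by (simp add: o_def)
  have ball: "continuous_map (top_of_set (ball 0 (real n * r))) T Exp" if n: "0 < n" for n
  proof -
    have "continuous_map (top_of_set (ball 0 (real n * r))) (top_of_set (ball 0 r)) (\<lambda>x::'e. (1 / real n) *\<^sub>R x)"
    proof -
      have "norm x / real n < r" if "norm x < real n * r" for x :: 'e
        using that n by (simp add: pos_divide_less_eq mult.commute)
      then have "(\<lambda>x. (1 / real n) *\<^sub>R x) \<in> ball 0 (real n * r) \<rightarrow> (ball 0 r :: 'e set)"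
        by auto
      moreover have "continuous_on (ball 0 (real n * r)) (\<lambda>x::'e. (1 / real n) *\<^sub>R x)"
        by (intro continuous_intros)
      ultimately show ?thesis
        unfolding continuous_map_subtopology_eu by (intro conjI)
    qed
    from continuous_pow[OF continuous_map_compose[OF this near], of n]
    have "continuous_map (top_of_set (ball 0 (real n * r))) T (\<lambda>x. Exp ((1 / real n) *\<^sub>R x) [^] n)"
      by (simp add: o_def)
    moreover have "Exp ((1 / real n) *\<^sub>R x) [^] n = Exp x" for x
      using Exp_pow[of n "(1 / real n) *\<^sub>R x"] n by simp
    ultimately show ?thesis by simp
  qed
  have "openin euclidean {x. Exp x \<in> W}" if W: "openin T W" for W
  proof -
    have "open {x. x \<in> ball 0 (real (Suc n) * r) \<and> Exp x \<in> W}" for n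
      using openin_open_trans[OF openin_continuous_map_preimage[OF ball[of "Suc n"] W] open_ball]
      by simp
    then have "open (\<Union>n. {x. x \<in> ball 0 (real (Suc n) * r) \<and> Exp x \<in> W})"
      by blast
    also have "(\<Union>n. {x. x \<in> ball 0 (real (Suc n) * r) \<and> Exp x \<in> W}) = {x. Exp x \<in> W}"
    proof (rule equalityI; rule subsetI)
      fix x assume x: "x \<in> {x. Exp x \<in> W}"
      obtain n where "norm x / r < real n" using reals_Archimedean2 by blast
      then have "norm x < real n * r" using r by (simp add: pos_divide_less_eq)
      also have "\<dots> \<le> real (Suc n) * r" using r by simp
      finally show "x \<in> (\<Union>n. {x. x \<in> ball 0 (real (Suc n) * r) \<and> Exp x \<in> W})"
        using x by auto
    qed auto
    finally show ?thesis by simp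
  qed
  then have "continuous_map euclidean T Exp"
    unfolding continuous_map_def by (simp add: topspace_eq Exp_closed)
  then show ?thesis by (rule continuous_map_from_subtopology)
qed

lemma taut_space:
  fixes D :: "'d topology" and P :: "'e \<Rightarrow> 'd" and \<L> :: "'d \<Rightarrow> (('a, 'e) chart \<Rightarrow> 'e) set"
  assumes P: "continuous_map (top_of_set (sphere 0 1)) D P" "P ` sphere 0 1 = topspace D"
    and \<L>: "\<And>x. x \<in> sphere 0 1 \<Longrightarrow> \<L> (P x) = line_through (lift x)"
    and coll: "\<And>f :: 'd \<Rightarrow> 'e. continuous_on (sphere 0 1) (\<lambda>x. f (P x)) \<Longrightarrow> \<exists>x\<in>sphere 0 1. \<exists>t. f (P x) = t *\<^sub>R x"
    and \<sigma>: "continuous_map D T \<sigma>"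
    and taut: "taut_config G T A D \<sigma>"
  defines "S \<equiv> (\<Union>d\<in>topspace D. \<sigma> d <# (lie_exp G T A ` \<L> d))"
  shows "contains_nbhd_of_one G T S \<and>
    (\<forall>M. left_haar_measure G T M \<longrightarrow> S \<in> sets M \<and> 0 < emeasure M S)"
proof -
  let ?g = "lie_algebra_topology G A"
  obtain U V where U: "openin T U" "\<one> \<in> U" and V: "openin ?g V" "(\<lambda>c. 0) \<in> V"
    and diff: "diffeomorphism (subtopology ?g V) (restrict_atlas V (lie_algebra_atlas G A))
          (subtopology T U) (restrict_atlas U A) (lie_exp G T A)"
    and \<sigma>U: "\<sigma> ` topspace D \<subseteq> U"
    using taut unfolding taut_config_def by blast
  \<comment> \<open>\<open>l\<close> is the logarithm on \<open>U\<close>.\<close>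
  obtain l where exp: "continuous_map (subtopology ?g V) (subtopology T U) (lie_exp G T A)"
    and l: "continuous_map (subtopology T U) (subtopology ?g V) l"
    and exp_l: "\<And>y. y \<in> topspace (subtopology T U) \<Longrightarrow> lie_exp G T A (l y) = y"
    using diff unfolding diffeomorphism_def smooth_map_def by blast
  have UT: "U \<subseteq> topspace T" using openin_subset[OF U(1)] .
  have \<tau>: "continuous_map (top_of_set (sphere 0 1)) T (\<lambda>x. \<sigma> (P x))"
    using continuous_map_compose[OF P(1) \<sigma>] by (simp add: o_def)
  have "compactin (top_of_set (sphere 0 1)) (sphere 0 1 :: 'e set)"
    by (simp add: compactin_subtopology)
  from image_compactin[OF this \<tau>] have "compactin T ((\<lambda>x. \<sigma> (P x)) ` sphere 0 1)" .
  also have "(\<lambda>x. \<sigma> (P x)) ` sphere 0 1 = \<sigma> ` topspace D"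
    by (simp add: image_image flip: P(2))
  finally have K: "compactin T (\<sigma> ` topspace D)" .
  have S_alt: "S = (\<Union>x\<in>sphere 0 1. (\<lambda>t. \<sigma> (P x) \<otimes> Exp (t *\<^sub>R x)) ` UNIV)"
    unfolding S_def P(2)[symmetric] by (auto simp: \<L> line_through_lift l_coset_def)
  have \<sigma>G: "\<sigma> d \<in> carrier G" if "d \<in> topspace D" for d
    using \<sigma> that by (auto simp: continuous_map_def topspace_eq)
  have nbhd: "\<exists>W. openin T W \<and> \<one> \<in> W \<and> W \<subseteq> S"
  proof -
    have ci: "continuous_map T T (\<lambda>x. inv x)"
      using smooth_inv by (simp add: smooth_map_def)
    have cm: "continuous_map (prod_topology T T) T (\<lambda>z. inv (fst z) \<otimes> snd z)"
      by (intro continuous_mult' continuous_map_compose[OF continuous_map_fst ci, unfolded o_def] continuous_map_snd)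
    \<comment> \<open>Since the image of \<sigma> is compact, the tube lemma finds one neighborhood
      \<open>W\<close> of the identity with h^(-1) \<sigma>(d) in \<open>U\<close> for all
      \<open>h\<close> in \<open>W\<close> and all \<open>d\<close> at once; applying
      \<open>l\<close> then makes each translated configuration linear.\<close>
    let ?O = "{z \<in> topspace (prod_topology T T). inv (fst z) \<otimes> snd z \<in> U}"
    have O: "openin (prod_topology T T) ?O"
      by (rule openin_continuous_map_preimage[OF cm U(1)])
    have "{\<one>} \<times> \<sigma> ` topspace D \<subseteq> ?O"
      using \<sigma>U \<sigma>G by (auto simp: topspace_eq)
    from tube_lemma_right[OF O K _ this]
    obtain W W' where W: "openin T W" "\<one> \<in> W" "\<sigma> ` topspace D \<subseteq> W'" "W \<times> W' \<subseteq> ?O"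
      by (auto simp: topspace_eq)
    have "W \<subseteq> S"
    proof
      fix h assume h: "h \<in> W"
      then have hG: "h \<in> carrier G" using openin_subset[OF W(1)] topspace_eq by auto
      define \<sigma>h where "\<sigma>h = (\<lambda>d. inv h \<otimes> \<sigma> d)"
      have \<sigma>hU: "\<sigma>h d \<in> U" if "d \<in> topspace D" for d
      proof -
        have "(h, \<sigma> d) \<in> W \<times> W'" using h W(3) that by blast
        then have "(h, \<sigma> d) \<in> ?O" using W(4) by blast
        then show ?thesis by (simp add: \<sigma>h_def)
      qed
      have "continuous_map D T \<sigma>h"
        unfolding \<sigma>h_def
        using continuous_map_compose[OF \<sigma> continuous_left_mult[of "inv h"]] hG by (simp add: o_def)
      then have "continuous_map D (subtopology T U) \<sigma>h"
        using \<sigma>hU by (auto simp: continuous_map_in_subtopology)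
      from continuous_map_compose[OF this l]
      have "continuous_map D ?g (\<lambda>d. l (\<sigma>h d))"
        by (simp add: o_def continuous_map_in_subtopology)
      moreover have "lie_exp G T A (l (\<sigma>h d)) = \<sigma>h d" if "d \<in> topspace D" for d
        using exp_l[of "\<sigma>h d"] \<sigma>hU[OF that] UT by auto
      ultimately have "linear_config G T A D \<sigma>h"
        unfolding linear_config_def by blast
      from one_in_space_if_collinear[OF P(1) \<L> coll this]
      obtain d where d: "d \<in> topspace D" "\<one> \<in> \<sigma>h d <# (lie_exp G T A ` \<L> d)"
        by blast
      then obtain x where x: "x \<in> sphere 0 1" "d = P x"
        using P(2) by blast
      then obtain t where t: "\<one> = \<sigma>h d \<otimes> Exp (t *\<^sub>R x)"
        using d(2) \<L>[OF x(1)] by (auto simp: line_through_lift l_coset_def)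
      have "h = h \<otimes> \<sigma>h d \<otimes> Exp (t *\<^sub>R x)"
        using t[symmetric] hG \<sigma>G[OF d(1)] Exp_closed by (simp add: \<sigma>h_def m_assoc)
      also have "\<dots> = \<sigma> d \<otimes> Exp (t *\<^sub>R x)"
        using hG \<sigma>G[OF d(1)] by (simp add: \<sigma>h_def flip: m_assoc)
      finally show "h \<in> S"
        unfolding S_alt using x by blast
    qed
    with W show ?thesis by blast
  qed
  have "continuous_map (subtopology ?g V) T (lie_exp G T A)"
    using exp by (simp add: continuous_map_in_subtopology)
  then have cE: "continuous_map (top_of_set X) T Exp" for X
    by (rule continuous_Exp[OF V])
  \<comment> \<open>Restricting the line parameter to |t| \<le> n cuts the space into compact
    pieces. Their union \<open>S\<close> need not be closed, but it is measurable.\<close>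
  define C where "C = (\<lambda>n::nat. (\<lambda>z. \<sigma> (P (fst z)) \<otimes> Exp (snd z *\<^sub>R fst z)) ` (sphere 0 1 \<times> {- real n .. real n}))"
  have C: "compactin T (C n)" for n
  proof -
    let ?X = "sphere 0 (1::real) \<times> {- real n .. real n} :: ('e \<times> real) set"
    have 1: "continuous_map (top_of_set ?X) (top_of_set (sphere 0 1)) fst"
      and 2: "continuous_map (top_of_set ?X) (top_of_set UNIV) (\<lambda>z. snd z *\<^sub>R fst z)"
      by (auto intro!: continuous_intros)
    have "continuous_map (top_of_set ?X) T (\<lambda>z. \<sigma> (P (fst z)) \<otimes> Exp (snd z *\<^sub>R fst z))"
      using continuous_mult'[OF continuous_map_compose[OF 1 \<tau>] continuous_map_compose[OF 2 cE]]
      by (simp add: o_def)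
    moreover have "compactin (top_of_set ?X) ?X"
      by (simp add: compactin_subtopology compact_Times)
    ultimately show ?thesis
      unfolding C_def by (rule image_compactin[rotated])
  qed
  have SC: "S = (\<Union>n. C n)"
  proof (rule equalityI; rule subsetI)
    fix y assume "y \<in> S"
    then obtain x t where x: "x \<in> sphere 0 1" "y = \<sigma> (P x) \<otimes> Exp (t *\<^sub>R x)"
      unfolding S_alt by blast
    obtain n where "\<bar>t\<bar> < real n" using reals_Archimedean2 by blast
    then have "(x, t) \<in> sphere 0 1 \<times> {- real n .. real n}" using x by auto
    then have "y \<in> C n" unfolding C_def using x(2) by force
    then show "y \<in> (\<Union>n. C n)" by blast
  next
    fix y assume "y \<in> (\<Union>n. C n)"
    then show "y \<in> S" unfolding S_alt C_def by force
  qed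
  have "S \<in> sets M \<and> 0 < emeasure M S" if M: "left_haar_measure G T M" for M
  proof
    show S: "S \<in> sets M"
      unfolding SC using compactin_sets_haar[OF M C] by blast
    obtain W where W: "openin T W" "\<one> \<in> W" "W \<subseteq> S" using nbhd by blast
    show "0 < emeasure M S"
      using haar_measure_open_pos[OF M W(1,2)] emeasure_mono[OF W(3) S] by (rule less_le_trans)
  qed
  then show ?thesis
    using nbhd by (simp add: contains_nbhd_of_one_def)
qed

section \<open>Projective space and the unit sphere as images of the Euclidean unit sphere\<close>

lemma lift_nonzero: "x \<noteq> 0 \<Longrightarrow> lift x \<noteq> (\<lambda>i. 0)"
  using lift_eq_iff[of x 0] by (simp add: lift_zero)

lemma lie_algebra_eq_range_lift: "lie_algebra G A = range lift"
  using lift_in lift_eval by (auto simp: image_iff) metis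

lemma line_through_lift_continuous:
  "continuous_map (top_of_set (sphere 0 1)) (proj_topology (lie_algebra G A)) (\<lambda>x. line_through (lift x))"
proof -
  let ?V = "lie_algebra G A" and ?S = "sphere 0 1 :: 'e set"
  have lS: "lift x \<in> ?V - {\<lambda>i. 0}" if "x \<in> ?S" for x
  proof -
    have "x \<noteq> 0" using that by force
    then show ?thesis using lift_in lift_nonzero by blast
  qed
  then have lift: "continuous_map (top_of_set ?S) (top_of_set (?V - {\<lambda>i. 0})) lift"
    unfolding continuous_map_subtopology_eu by (intro conjI continuous_on_lift Pi_I)
  have "openin (top_of_set ?S) {x \<in> ?S. line_through (lift x) \<in> W}"
    if W: "openin (proj_topology ?V) W" for W
  proof -
    have "openin (top_of_set (?V - {\<lambda>i. 0})) {v \<in> ?V - {\<lambda>i. 0}. line_through v \<in> W}"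
      using W by (simp add: openin_proj_topology)
    from openin_continuous_map_preimage[OF lift this]
    have "openin (top_of_set ?S) {x \<in> ?S. lift x \<in> {v \<in> ?V - {\<lambda>i. 0}. line_through v \<in> W}}"
      by simp
    also have "{x \<in> ?S. lift x \<in> {v \<in> ?V - {\<lambda>i. 0}. line_through v \<in> W}} = {x \<in> ?S. line_through (lift x) \<in> W}"
      using lS by blast
    finally show ?thesis .
  qed
  moreover have "line_through (lift x) \<in> proj_space ?V" if "x \<in> ?S" for x
    unfolding proj_space_def using lS[OF that] by blast
  ultimately show ?thesis
    unfolding continuous_map_def topspace_proj_topology by auto
qed

lemma line_through_lift_sphere:
  "(\<lambda>x. line_through (lift x)) ` sphere 0 1 = topspace (proj_topology (lie_algebra G A))"
proof (rule equalityI; rule subsetI)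
  fix L assume "L \<in> (\<lambda>x. line_through (lift x)) ` sphere 0 1"
  then show "L \<in> topspace (proj_topology (lie_algebra G A))"
    using line_through_lift_continuous by (auto simp: continuous_map_def)
next
  fix L assume "L \<in> topspace (proj_topology (lie_algebra G A))"
  then obtain v where v: "v \<in> lie_algebra G A" "v \<noteq> (\<lambda>i. 0)" "L = line_through v"
    unfolding topspace_proj_topology proj_space_def by blast
  then obtain w where w: "v = lift w" using lie_algebra_eq_range_lift by blast
  then have "w \<noteq> 0" using v(2) lift_zero by blast
  then have "L = line_through (lift (sgn w))" "sgn w \<in> sphere 0 1"
    using v(3) w line_through_scaleR[of "inverse (norm w)" "lift w"]
    by (simp_all add: sgn_div_norm lift_scaleR)
  then show "L \<in> (\<lambda>x. line_through (lift x)) ` sphere 0 1" by blast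
qed

text \<open>A function of lines becomes an even function on the sphere, because antipodal points
  span the same line.\<close>

lemma unoriented_collinear:
  assumes "continuous_on (sphere 0 1) (\<lambda>x. f (line_through (lift x)))"
  shows "\<exists>x\<in>sphere 0 1. \<exists>t. f (line_through (lift x)) = t *\<^sub>R (x :: 'e)"
proof (rule exists_collinear_even[OF assms])
  fix x :: 'e
  show "f (line_through (lift (- x))) = f (line_through (lift x))"
    using line_through_scaleR[of "- 1" "lift x"] lift_scaleR[of "- 1" x] by simp
qed

text \<open>The given inner product need not come from the model space, whereas degrees are computed
  on the Euclidean sphere; this radial map relates the two unit spheres.\<close>

definition ip_normalize :: "((('a, 'e) chart \<Rightarrow> 'e) \<Rightarrow> (('a, 'e) chart \<Rightarrow> 'e) \<Rightarrow> real) \<Rightarrow> 'e \<Rightarrow> ('a, 'e) chart \<Rightarrow> 'e" where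
  "ip_normalize ip x = lift ((1 / sqrt (ip (lift x) (lift x))) *\<^sub>R x)"

context
  fixes ip
  assumes ip: "inner_product_on (lie_algebra G A) ip"
begin

lemma ip_scale: "ip (lift (r *\<^sub>R x)) (lift (s *\<^sub>R y)) = r * s * ip (lift x) (lift y)"
proof -
  have "ip (lift (r *\<^sub>R x)) (lift (s *\<^sub>R y)) = r * ip (lift x) (lift (s *\<^sub>R y))"
    using ip lift_in unfolding inner_product_on_def lift_scaleR[of r] by blast
  also have "ip (lift x) (lift (s *\<^sub>R y)) = ip (lift (s *\<^sub>R y)) (lift x)"
    using ip lift_in unfolding inner_product_on_def by blast
  also have "\<dots> = s * ip (lift y) (lift x)"
    using ip lift_in unfolding inner_product_on_def lift_scaleR[of s] by blast
  also have "ip (lift y) (lift x) = ip (lift x) (lift y)"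
    using ip lift_in unfolding inner_product_on_def by blast
  finally show ?thesis by simp
qed

lemma ip_pos: "x \<noteq> 0 \<Longrightarrow> 0 < ip (lift x) (lift x)"
  using ip lift_in lift_nonzero unfolding inner_product_on_def by blast

text \<open>\<open>ip\<close> is given only algebraically, but pulled back along \<open>lift\<close>
  it is a bilinear form on a finite-dimensional space.\<close>

lemma continuous_ip: "continuous_on S (\<lambda>x. ip (lift x) (lift x))"
proof -
  have sym: "ip (lift x) (lift y) = ip (lift y) (lift x)" for x y
    using ip lift_in unfolding inner_product_on_def by blast
  have add: "ip (lift (x + x')) (lift y) = ip (lift x) (lift y) + ip (lift x') (lift y)" for x x' y
    using ip lift_in unfolding inner_product_on_def lift_add by blast
  have lin: "linear (\<lambda>x. ip (lift x) (lift y))" for y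
    using ip_scale[of _ _ 1 y] by (intro linearI) (simp_all add: add)
  then have "bilinear (\<lambda>x y. ip (lift x) (lift y))"
    unfolding bilinear_def using sym by simp
  then have "bounded_bilinear (\<lambda>x y. ip (lift x) (lift y))"
    by (simp add: bilinear_conv_bounded_bilinear)
  from bounded_bilinear.continuous_on[OF this continuous_on_id continuous_on_id]
  show ?thesis by simp
qed

lemma line_through_ip_normalize:
  assumes "x \<in> sphere 0 1"
  shows "line_through (ip_normalize ip x) = line_through (lift x)"
proof -
  have "0 < ip (lift x) (lift x)" using ip_pos[of x] assms by force
  then show ?thesis
    unfolding ip_normalize_def lift_scaleR by (simp add: line_through_scaleR)
qed

lemma ip_normalize_continuous: "continuous_map (top_of_set (sphere 0 1)) (sphere_topology (lie_algebra G A) ip) (ip_normalize ip)"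
proof -
  have "continuous_on (sphere 0 1) (\<lambda>x. (1 / sqrt (ip (lift x) (lift x))) *\<^sub>R x)"
  proof (intro continuous_intros continuous_ip ballI)
    fix x :: 'e assume "x \<in> sphere 0 1"
    then have "0 < ip (lift x) (lift x)" using ip_pos[of x] by force
    then show "sqrt (ip (lift x) (lift x)) \<noteq> 0" by simp
  qed
  from continuous_on_compose2[OF continuous_on_lift this subset_UNIV]
  have "continuous_on (sphere 0 1) (ip_normalize ip)"
    unfolding ip_normalize_def .
  moreover have "ip_normalize ip x \<in> unit_sphere (lie_algebra G A) ip" if "x \<in> sphere 0 1" for x
  proof -
    have "0 < ip (lift x) (lift x)" using ip_pos[of x] that by force
    then show ?thesis
      unfolding unit_sphere_def ip_normalize_def by (simp add: lift_in ip_scale)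
  qed
  ultimately show ?thesis
    unfolding sphere_topology_def by auto
qed

lemma ip_normalize_sphere: "ip_normalize ip ` sphere 0 1 = topspace (sphere_topology (lie_algebra G A) ip)"
proof (rule equalityI; rule subsetI)
  fix v assume "v \<in> ip_normalize ip ` sphere 0 1"
  then show "v \<in> topspace (sphere_topology (lie_algebra G A) ip)"
    using ip_normalize_continuous by (auto simp: continuous_map_def)
next
  fix v assume "v \<in> topspace (sphere_topology (lie_algebra G A) ip)"
  then have v: "v \<in> lie_algebra G A" "ip v v = 1"
    by (auto simp: sphere_topology_def unit_sphere_def)
  then obtain w where w: "v = lift w" using lie_algebra_eq_range_lift by blast
  have "w \<noteq> 0"
  proof
    assume "w = 0"
    then have "ip (lift w) (lift w) = 0" using ip_scale[of 0 0 0 0] by simp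
    then show False using v w by simp
  qed
  then have "sgn w \<in> sphere 0 1" by (simp add: norm_sgn)
  moreover have "ip_normalize ip (sgn w) = v"
  proof -
    have "ip (lift (sgn w)) (lift (sgn w)) = (inverse (norm w))\<^sup>2"
      using v w by (simp add: sgn_div_norm ip_scale power2_eq_square)
    then show ?thesis
      using \<open>w \<noteq> 0\<close> by (simp add: ip_normalize_def w) (simp add: sgn_div_norm)
  qed
  ultimately show "v \<in> ip_normalize ip ` sphere 0 1" by blast
qed

end

end

theorem theorem1p5:
  fixes G :: "('a, 'm) monoid_scheme"
    and T :: "'a topology"
    and A :: "('a, 'e::euclidean_space) chart set"
  assumes "lie_group G T A"
    and "connected_space T"
  shows
    "(\<forall>\<sigma>. unoriented_config G T A \<sigma> \<and>
        linear_config G T A (proj_topology (lie_algebra G A)) \<sigma> \<longrightarrow>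
        \<one>\<^bsub>G\<^esub> \<in> unoriented_space G T A \<sigma>) \<and>
     (\<forall>\<sigma>. unoriented_config G T A \<sigma> \<and>
        taut_config G T A (proj_topology (lie_algebra G A)) \<sigma> \<longrightarrow>
        contains_nbhd_of_one G T (unoriented_space G T A \<sigma>) \<and>
        (\<forall>M. left_haar_measure G T M \<longrightarrow>
           unoriented_space G T A \<sigma> \<in> sets M \<and> 0 < emeasure M (unoriented_space G T A \<sigma>))) \<and>
     (odd DIM('e) \<longrightarrow>
       (\<forall>ip. inner_product_on (lie_algebra G A) ip \<longrightarrow>
         (\<forall>\<sigma>. oriented_config G T A ip \<sigma> \<and>
            linear_config G T A (sphere_topology (lie_algebra G A) ip) \<sigma> \<longrightarrow>
            \<one>\<^bsub>G\<^esub> \<in> oriented_space G T A ip \<sigma>) \<and>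
         (\<forall>\<sigma>. oriented_config G T A ip \<sigma> \<and>
            taut_config G T A (sphere_topology (lie_algebra G A) ip) \<sigma> \<longrightarrow>
            contains_nbhd_of_one G T (oriented_space G T A ip \<sigma>) \<and>
            (\<forall>M. left_haar_measure G T M \<longrightarrow>
               oriented_space G T A ip \<sigma> \<in> sets M \<and> 0 < emeasure M (oriented_space G T A ip \<sigma>)))))"
proof -
  interpret lie_group G T A by (rule assms)
  have "\<one>\<^bsub>G\<^esub> \<in> topspace T" by (simp add: topspace_eq)
  \<comment> \<open>Charts cover the group; any chart around the identity fixes the identification
    of the Lie algebra with the model space.\<close>
  then obtain c where "c \<in> A" "\<one>\<^bsub>G\<^esub> \<in> fst c"
    using manifold unfolding smooth_manifold_def smooth_atlas_def by blast
  then interpret lie_group_chart G T A c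
    by unfold_locales
  let ?V = "lie_algebra G A"
  have U: "unoriented_space G T A \<sigma> = (\<Union>L\<in>topspace (proj_topology ?V). \<sigma> L <#\<^bsub>G\<^esub> (lie_exp G T A ` L))" for \<sigma>
    by (simp add: unoriented_space_def topspace_proj_topology)
  have O: "oriented_space G T A ip \<sigma> =
      (\<Union>x\<in>topspace (sphere_topology ?V ip). \<sigma> x <#\<^bsub>G\<^esub> (lie_exp G T A ` line_through x))" for ip \<sigma>
    by (simp add: oriented_space_def sphere_topology_def)
  have coll: "\<exists>x\<in>sphere 0 1. \<exists>t. f (ip_normalize ip x) = t *\<^sub>R x"
    if "odd DIM('e)" "continuous_on (sphere 0 1) (\<lambda>x. f (ip_normalize ip x))" for f :: "_ \<Rightarrow> 'e" and ip
    by (rule exists_collinear_odd_dim[OF that])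
  show ?thesis
  proof (intro conjI allI impI)
    fix \<sigma> assume "unoriented_config G T A \<sigma> \<and> linear_config G T A (proj_topology ?V) \<sigma>"
    then show "\<one>\<^bsub>G\<^esub> \<in> unoriented_space G T A \<sigma>"
      unfolding U
      by (intro one_in_space_if_collinear[OF line_through_lift_continuous _ unoriented_collinear]) auto
  next
    fix \<sigma> assume \<sigma>: "unoriented_config G T A \<sigma> \<and> taut_config G T A (proj_topology ?V) \<sigma>"
    have *: "contains_nbhd_of_one G T (unoriented_space G T A \<sigma>) \<and> (\<forall>M. left_haar_measure G T M \<longrightarrow>
           unoriented_space G T A \<sigma> \<in> sets M \<and> 0 < emeasure M (unoriented_space G T A \<sigma>))"
      unfolding U
      by (rule taut_space[OF line_through_lift_continuous line_through_lift_sphere _ unoriented_collinear])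
         (use \<sigma> in \<open>auto simp: unoriented_config_def\<close>)
    show "contains_nbhd_of_one G T (unoriented_space G T A \<sigma>)" using * by blast
    fix M assume "left_haar_measure G T M"
    with * show "unoriented_space G T A \<sigma> \<in> sets M" "0 < emeasure M (unoriented_space G T A \<sigma>)"
      by blast+
  next
    fix ip \<sigma> assume odd: "odd DIM('e)" and ip: "inner_product_on ?V ip"
      and "oriented_config G T A ip \<sigma> \<and> linear_config G T A (sphere_topology ?V ip) \<sigma>"
    then show "\<one>\<^bsub>G\<^esub> \<in> oriented_space G T A ip \<sigma>"
      unfolding O
      by (intro one_in_space_if_collinear[where P = "ip_normalize ip"] ip_normalize_continuous[OF ip]
          line_through_ip_normalize[OF ip] coll[OF odd]) auto
  next
    fix ip \<sigma> assume odd: "odd DIM('e)" and ip: "inner_product_on ?V ip"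
      and \<sigma>: "oriented_config G T A ip \<sigma> \<and> taut_config G T A (sphere_topology ?V ip) \<sigma>"
    have *: "contains_nbhd_of_one G T (oriented_space G T A ip \<sigma>) \<and> (\<forall>M. left_haar_measure G T M \<longrightarrow>
           oriented_space G T A ip \<sigma> \<in> sets M \<and> 0 < emeasure M (oriented_space G T A ip \<sigma>))"
      unfolding O
      by (rule taut_space[where P = "ip_normalize ip"], rule ip_normalize_continuous[OF ip],
          rule ip_normalize_sphere[OF ip], erule line_through_ip_normalize[OF ip], erule coll[OF odd])
         (use \<sigma> in \<open>auto simp: oriented_config_def\<close>)
    show "contains_nbhd_of_one G T (oriented_space G T A ip \<sigma>)" using * by blast
    fix M assume "left_haar_measure G T M"
    with * show "oriented_space G T A ip \<sigma> \<in> sets M" "0 < emeasure M (oriented_space G T A ip \<sigma>)"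
      by blast+
  qed
qed

end
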